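(* Let $1<p\leq q<\infty$, $0<r<\infty$ and $0<\alpha\leq 1$. Let $\mathcal S$ be a (non-empty) sparse collection of dyadic cubes in $\mathbb R^n$ and let $\omega,\sigma\in A_\infty$ be two weights on $\mathbb R^n$. Then the operator $f\mapsto A^{r,\alpha}_{\mathcal S}(f\sigma)$ maps $L^p_\sigma$ boundedly into $L^q_\omega$ if and only if $$[\omega,\sigma]_{A_{pq}^\alpha(\mathcal S)}:=\sup_{Q\in\mathcal S}|Q|^{-\alpha}\,\omega(Q)^{1/q}\,\sigma(Q)^{1/p'}$$ is finite. In this case $$[\omega,\sigma]_{A_{pq}^\alpha(\mathcal S)}\ \leq\ \|A^{r,\alpha}_{\mathcal S}(\cdot\,\sigma)\|_{L^p_\sigma\to L^q_\omega}\ \lesssim\ [\omega,\sigma]_{A_{pq}^\alpha(\mathcal S)}\cdot K,$$ where, unless $p=q>r$ and $\alpha<1$, $$K=[\sigma]_{A_\infty}^{\frac1q}+[\omega]_{A_\infty}^{\left(\frac1r-\frac1p\right)_+},$$ and, in the remaining case $p=q>r$ and $\alpha<1$, $$K=[\omega]_{A_\infty}^{\frac1r\left(1-\frac rp\right)^2}[\sigma]_{A_\infty}^{\frac1r\left(1-\left(1-\frac rp\right)^2\right)}+[\omega]_{A_\infty}^{\frac1r\left(1-\left(\frac rp\right)^2\right)}[\sigma]_{A_\infty}^{\frac1r\left(\frac rp\right)^2}.$$ Here $x_+:=\max(x,0)$.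
   Context: A weight on $\mathbb R^n$ is a locally integrable function $\omega:\mathbb R^n\to[0,\infty)$; $\omega(Q)=\int_Q\omega$, $|Q|$ is Lebesgue measure, and $\|f\|_{L^p_\omega}=(\int|f|^p\omega)^{1/p}$. $p'=p/(p-1)$. Cubes have sides parallel to the axes and positive finite diameter. Dyadic cubes: all dyadic cubes under consideration belong to one fixed dyadic grid, i.e. the standard grid $\mathcal D=\{2^{-j}([0,1)^n+m): j\in\mathbb Z, m\in\mathbb Z^n\}$ or a shifted grid $\{Q+\sum_{j:2^{-j}<\ell(Q)}2^{-j}\theta_j: Q\in\mathcal D\}$ with $(\theta_j)_{j\in\mathbb Z}\in(\{0,1\}^n)^{\mathbb Z}$, where $\ell(Q)$ is the side length. A collection $\mathcal S$ of dyadic cubes is sparse if for some $\eta>0$ there are pairwise disjoint measurable sets $(E_Q)_{Q\in\mathcal S}$ with $E_Q\subset Q$ and $|E_Q|\geq\eta|Q|$ for every $Q\in\mathcal S$. For measurable $f\geq0$, the sparse operator is $$A^{r,\alpha}_{\mathcal S}(f)=\Big(\sum_{Q\in\mathcal S}\Big(|Q|^{-\alpha}\int_Qf\Big)^r\mathbf 1_Q\Big)^{1/r}.$$ The norm $\|A^{r,\alpha}_{\mathcal S}(\cdot\,\sigma)\|_{L^p_\sigma\to L^q_\omega}$ is the supremum of $\|A^{r,\alpha}_{\mathcal S}(f\sigma)\|_{L^q_\omega}$ over measurable $f\geq0$ with $\|f\|_{L^p_\sigma}\leq1$, and boundedness means that it is finite. $\omega\in A_\infty$ means that $[\omega]_{A_\infty}:=\sup_Q\frac1{\omega(Q)}\int_QM(\mathbf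 1_Q\omega)<\infty$ (supremum over all cubes; in particular $\omega(Q)>0$ for all cubes $Q$), where $Mf(x)=\sup_{Q\ni x}|Q|^{-1}\int_Q|f|$ is the Hardy--Littlewood maximal function. The implied constant in $\lesssim$ depends only on $n,p,q,r,\alpha$ and the sparsity constant $\eta$, and not on $\omega,\sigma$ or otherwise on $\mathcal S$. *)

theory Defs
  imports "HOL-Analysis.Analysis"
begin

text \<open>
  Real powers on \<open>[0, \<infinity>]\<close>, with \<open>x\<^sup>0 = 1\<close> (also for \<open>x = 0\<close> and \<open>x = \<infinity>\<close>), in contrast to
  \<open>0 powr 0 = 0\<close>.
\<close>

definition epowr :: "ennreal \<Rightarrow> real \<Rightarrow> ennreal"  (infixr \<open>epowr\<close> 80) where
  "x epowr a =
     (if a = 0 then 1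
      else if x = 0 then (if a > 0 then 0 else \<infinity>)
      else if x = \<infinity> then (if a > 0 then \<infinity> else 0)
      else ennreal (enn2real x powr a))"

text \<open>
  A cube may contain any part of its boundary, so that closed, open and half-open cubes are all
  included.
\<close>

definition is_cube :: "(real ^ 'n) set \<Rightarrow> bool" where
  "is_cube Q \<longleftrightarrow> (\<exists>(a :: real ^ 'n) (l :: real) (I :: 'n \<Rightarrow> real set). l > 0 \<and>
     (\<forall>i. {a $ i <..< a $ i + l} \<subseteq> I i \<and> I i \<subseteq> {a $ i .. a $ i + l}) \<and>
     Q = {x. \<forall>i. x $ i \<in> I i})"

abbreviation vol :: "(real ^ 'n) set \<Rightarrow> real" where
  "vol Q \<equiv> measure lebesgue Q"

subsection \<open>Dyadic grids\<close>

definition dyadic_cube :: "int \<Rightarrow> int ^ 'n \<Rightarrow> (real ^ 'n) set" where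
  "dyadic_cube j m =
     {x. \<forall>i. 2 powi (- j) * of_int (m $ i) \<le> x $ i \<and> x $ i < 2 powi (- j) * (of_int (m $ i) + 1)}"

definition standard_grid :: "(real ^ 'n) set set" where
  "standard_grid = {dyadic_cube j m | j m. True}"

text \<open>The cube \<open>dyadic_cube k m\<close> has side length \<open>2 powi (- k)\<close>.\<close>

definition shifted_grid :: "(int \<Rightarrow> real ^ 'n) \<Rightarrow> (real ^ 'n) set set" where
  "shifted_grid \<theta> =
     {(\<lambda>x. x + (\<Sum>\<^sub>\<infinity>j\<in>{j. (2 :: real) powi (- j) < 2 powi (- k)}. 2 powi (- j) *\<^sub>R \<theta> j)) ` dyadic_cube k m
        | k m. True}"

definition is_dyadic_grid :: "(real ^ 'n) set set \<Rightarrow> bool" where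
  "is_dyadic_grid \<D> \<longleftrightarrow>
     \<D> = standard_grid \<or> (\<exists>\<theta>. (\<forall>j i. \<theta> j $ i \<in> {0, 1}) \<and> \<D> = shifted_grid \<theta>)"

definition sparse_collection :: "real \<Rightarrow> (real ^ 'n) set set \<Rightarrow> bool" where
  "sparse_collection \<eta> \<S> \<longleftrightarrow> \<eta> > 0 \<and>
     (\<exists>E. disjoint_family_on E \<S> \<and>
          (\<forall>Q\<in>\<S>. E Q \<in> sets lebesgue \<and> E Q \<subseteq> Q \<and> vol (E Q) \<ge> \<eta> * vol Q))"

subsection \<open>Weights\<close>

definition weight :: "(real ^ 'n \<Rightarrow> real) \<Rightarrow> bool" where
  "weight \<omega> \<longleftrightarrow> (\<forall>x. \<omega> x \<ge> 0) \<and> (\<forall>K. compact K \<longrightarrow> set_integrable lebesgue K \<omega>)"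

definition wmeas :: "(real ^ 'n \<Rightarrow> real) \<Rightarrow> (real ^ 'n) set \<Rightarrow> ennreal" where
  "wmeas \<omega> Q = (\<integral>\<^sup>+x\<in>Q. ennreal (\<omega> x) \<partial>lebesgue)"

definition wnorm :: "real \<Rightarrow> (real ^ 'n \<Rightarrow> real) \<Rightarrow> (real ^ 'n \<Rightarrow> ennreal) \<Rightarrow> ennreal" where
  "wnorm p \<omega> g = (\<integral>\<^sup>+x. (g x epowr p) * ennreal (\<omega> x) \<partial>lebesgue) epowr (1 / p)"

definition maximal_fun :: "(real ^ 'n \<Rightarrow> real) \<Rightarrow> real ^ 'n \<Rightarrow> ennreal" where
  "maximal_fun f x =
     (SUP Q\<in>{Q. is_cube Q \<and> x \<in> Q}. (\<integral>\<^sup>+y\<in>Q. ennreal \<bar>f y\<bar> \<partial>lebesgue) / ennreal (vol Q))"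

definition Ainf_const :: "(real ^ 'n \<Rightarrow> real) \<Rightarrow> ennreal" where
  "Ainf_const \<omega> =
     (SUP Q\<in>{Q. is_cube Q}.
        (\<integral>\<^sup>+x\<in>Q. maximal_fun (\<lambda>y. indicator Q y * \<omega> y) x \<partial>lebesgue) / wmeas \<omega> Q)"

text \<open>
  Positivity of \<open>wmeas \<omega> Q\<close> is required separately because \<open>0 / 0 = 0\<close> in \<^typ>\<open>ennreal\<close>.
\<close>

definition Ainf_weight :: "(real ^ 'n \<Rightarrow> real) \<Rightarrow> bool" where
  "Ainf_weight \<omega> \<longleftrightarrow>
     weight \<omega> \<and> (\<forall>Q. is_cube Q \<longrightarrow> wmeas \<omega> Q > 0) \<and> Ainf_const \<omega> < \<infinity>"

subsection \<open>The sparse operator and its two-weight norm\<close>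

definition sparse_op ::
    "real \<Rightarrow> real \<Rightarrow> (real ^ 'n) set set \<Rightarrow> (real ^ 'n \<Rightarrow> real) \<Rightarrow> real ^ 'n \<Rightarrow> ennreal" where
  "sparse_op r \<alpha> \<S> f x =
     (\<Sum>\<^sub>\<infinity>Q\<in>\<S>. ((ennreal (vol Q powr (- \<alpha>)) * (\<integral>\<^sup>+y\<in>Q. ennreal (f y) \<partial>lebesgue)) epowr r)
               * indicator Q x) epowr (1 / r)"

definition sparse_op_norm ::
    "real \<Rightarrow> real \<Rightarrow> (real ^ 'n) set set \<Rightarrow> real \<Rightarrow> real \<Rightarrow>
     (real ^ 'n \<Rightarrow> real) \<Rightarrow> (real ^ 'n \<Rightarrow> real) \<Rightarrow> ennreal" where
  "sparse_op_norm r \<alpha> \<S> p q \<sigma> \<omega> =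
     (SUP f\<in>{f. f \<in> borel_measurable lebesgue \<and> (\<forall>x. f x \<ge> 0) \<and>
                wnorm p \<sigma> (\<lambda>x. ennreal (f x)) \<le> 1}.
        wnorm q \<omega> (sparse_op r \<alpha> \<S> (\<lambda>x. f x * \<sigma> x)))"

definition conj_exp :: "real \<Rightarrow> real" where
  "conj_exp p = p / (p - 1)"

definition Apq_char ::
    "real \<Rightarrow> real \<Rightarrow> real \<Rightarrow> (real ^ 'n) set set \<Rightarrow>
     (real ^ 'n \<Rightarrow> real) \<Rightarrow> (real ^ 'n \<Rightarrow> real) \<Rightarrow> ennreal" where
  "Apq_char p q \<alpha> \<S> \<omega> \<sigma> =
     (SUP Q\<in>\<S>. ennreal (vol Q powr (- \<alpha>)) * (wmeas \<omega> Q epowr (1 / q))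
                 * (wmeas \<sigma> Q epowr (1 / conj_exp p)))"

definition K_const ::
    "real \<Rightarrow> real \<Rightarrow> real \<Rightarrow> real \<Rightarrow> (real ^ 'n \<Rightarrow> real) \<Rightarrow> (real ^ 'n \<Rightarrow> real) \<Rightarrow> ennreal" where
  "K_const p q r \<alpha> \<omega> \<sigma> =
     (if p = q \<and> q > r \<and> \<alpha> < 1 then
        (Ainf_const \<omega> epowr (1 / r * (1 - r / p)\<^sup>2))
          * (Ainf_const \<sigma> epowr (1 / r * (1 - (1 - r / p)\<^sup>2)))
        + (Ainf_const \<omega> epowr (1 / r * (1 - (r / p)\<^sup>2)))
          * (Ainf_const \<sigma> epowr (1 / r * (r / p)\<^sup>2))
      else
        (Ainf_const \<sigma> epowr (1 / q))
        + (Ainf_const \<omega> epowr (max (1 / r - 1 / p) 0)))"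

end

theory Submission
  imports Defs
begin

text \<open>
  Testing the operator on normalised indicators of cubes gives the lower bound. For the upper bound,
  monotone convergence reduces to finite families, and \<open>\<ell>\<^sup>p \<subseteq> \<ell>\<^sup>r\<close> reduces to \<open>r \<le> p\<close>. Put
  \<open>x = r / p\<close> and \<open>y = r / q\<close>. By duality one has to bound the sum of
  \<open>|Q| powr (- \<alpha> r) (\<integral>\<^sub>Q f \<sigma>) powr r \<integral>\<^sub>Q g \<omega>\<close>, which after inserting the two-weight characteristic is
  controlled by the sum of \<open>\<sigma>(Q) powr x \<omega>(Q) powr (1 - y)\<close> times averages of \<open>f\<close> and \<open>g\<close>. The averages
  are replaced by their maxima over larger cubes, and summation by parts along the nested family
  (in place of stopping cubes) expresses everything through increments of these maxima, which are
  controlled by Doob's inequality; the \<open>A\<^sub>\<infinity>\<close> constants enter only as Carleson constants of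
  \<open>\<sigma>(Q)\<close> and \<open>\<omega>(Q)\<close>. For \<open>p < q\<close> or \<open>\<alpha> = 1\<close>, the weights \<open>\<sigma>(Q) powr x \<omega>(Q) powr (1 - y)\<close> are
  themselves Carleson on families where the characteristic is essentially constant, by a
  Kolmogorov-type estimate with no \<open>A\<^sub>\<infinity>\<close> constant, and this turns the product of the two constants
  into a sum. In the remaining case Hoelder's inequality alone suffices.
\<close>

subsection \<open>Inequalities for real powers\<close>

text \<open>The obstacle is the sum in \<open>K\<close>. If both averages are replaced by maxima at
  once, Hoelder's inequality charges both Carleson constants and yields their product, which
  \<open>K\<close> dominates when \<open>p = q > r\<close> and \<open>\<alpha> < 1\<close> but not
  in general. The constants separate once the summation by parts acts on the product of the two
  maxima: the Leibniz rule turns one of them into an increment, and only the other is charged. What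
  decides whether this is possible is a count of exponents. Trading an \<open>\<epsilon>\<close>-th
  power of the characteristic for \<open>|Q| powr (\<alpha> \<epsilon>)\<close> leaves exponents
  that add up to \<open>1 + (x - y) - \<epsilon> (1 / p' + 1 / q - \<alpha>)\<close>, and the
  Kolmogorov-type estimate asks for at least \<open>1\<close>: a small \<open>\<epsilon>\<close>
  achieves this for \<open>p < q\<close>, every \<open>\<epsilon>\<close> for \<open>p = q\<close>
  and \<open>\<alpha> = 1\<close>, none for \<open>p = q\<close> and \<open>\<alpha> < 1\<close>.
  Cutting into level sets of the characteristic is harmless, since level \<open>k\<close>
  contributes a multiple of \<open>2 powr (k r)\<close> and these factors sum geometrically.\<close>

lemma powr_superadd:
  fixes a b s :: real
  assumes "0 \<le> b" "b \<le> a" "1 \<le> s"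
  shows "(a - b) powr s \<le> a powr s - b powr s"
proof (cases "a = 0")
  case True
  then show ?thesis using assms by simp
next
  case False
  then have a: "a > 0" using assms by simp
  \<comment> \<open>The chord of slope \<open>a powr (s - 1)\<close> from the origin dominates the
    power on \<open>[0, a]\<close>; adding this for \<open>a - b\<close> and \<open>b\<close> gives
    superadditivity.\<close>
  have le: "x powr s \<le> x * a powr (s - 1)" if "0 \<le> x" "x \<le> a" for x
  proof (cases "x = 0")
    case False
    then have "x powr s = x * x powr (s - 1)"
      using that by (simp add: powr_mult_base)
    also have "\<dots> \<le> x * a powr (s - 1)"
      using that assms by (intro mult_left_mono powr_mono2) auto
    finally show ?thesis .
  qed simp
  have "(a - b) powr s + b powr s \<le> (a - b) * a powr (s - 1) + b * a powr (s - 1)"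
    using assms by (intro add_mono le) auto
  also have "\<dots> = a powr s"
    using a by (simp add: algebra_simps powr_mult_base)
  finally show ?thesis by simp
qed

text \<open>A difference form of \<open>d(t powr p) = p / (p - 1) * t * d(t powr (p - 1))\<close>,
  which explains the constant \<open>conj_exp p\<close>. The discretisation error has the right sign
  by Young's inequality for \<open>a * b powr (p - 1)\<close>.\<close>

lemma powr_diff_doob:
  fixes a b p :: real
  assumes "0 \<le> b" "b \<le> a" "1 < p"
  shows "a powr p - b powr p \<le> conj_exp p * a * (a powr (p - 1) - b powr (p - 1))"
proof (cases "b = 0")
  case True
  have "a powr p = a * a powr (p - 1)"
    using assms by (cases "a = 0") (auto simp: powr_mult_base)
  then have "a powr p - b powr p = 1 * (a * (a powr (p - 1) - b powr (p - 1)))"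
    using True by simp
  also have "\<dots> \<le> conj_exp p * (a * (a powr (p - 1) - b powr (p - 1)))"
    using True assms by (intro mult_right_mono) (auto simp: conj_exp_def field_simps)
  finally show ?thesis by (simp add: mult_ac)
next
  case False
  then have ab: "b > 0" "a > 0" using assms by auto
  have "(a powr p) powr (1 / p) * (b powr p) powr (1 - 1 / p) \<le> 1 / p * a powr p + (1 - 1 / p) * b powr p"
    using assms ab by (intro Youngs_inequality_0) auto
  moreover have "(a powr p) powr (1 / p) = a"
    using ab assms by (simp add: powr_powr)
  moreover have "(b powr p) powr (1 - 1 / p) = b powr (p - 1)"
    using ab assms by (simp add: powr_powr algebra_simps)
  ultimately have "p * (a * b powr (p - 1)) \<le> p * (1 / p * a powr p + (1 - 1 / p) * b powr p)"
    using assms by (intro mult_left_mono) auto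
  also have "\<dots> = a powr p + (p - 1) * b powr p"
    using assms by (simp add: field_simps)
  finally have "p * (a * b powr (p - 1)) \<le> a powr p + (p - 1) * b powr p" .
  moreover have "a powr p = a * a powr (p - 1)"
    using ab by (simp add: powr_mult_base)
  ultimately show ?thesis
    using assms by (simp add: conj_exp_def field_simps)
qed

text \<open>A difference form of \<open>d(t powr \<theta>) / t = \<theta> / (1 - \<theta>) * (- d(t
  powr (\<theta> - 1)))\<close>; again Young's inequality gives the sign of the discretisation
  error. Dividing by the larger value \<open>a\<close> fits a jump of a maximum, whose new value is
  a quotient of two set functions.\<close>

lemma powr_diff_kolmogorov:
  fixes a b \<theta> :: real
  assumes "0 < b" "b \<le> a" "0 < \<theta>" "\<theta> < 1"
  shows "(a powr \<theta> - b powr \<theta>) / a \<le> \<theta> / (1 - \<theta>) * (b powr (\<theta> - 1) - a powr (\<theta> - 1))"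
proof -
  have a: "a > 0" using assms by simp
  have "a powr \<theta> * b powr (1 - \<theta>) \<le> \<theta> * a + (1 - \<theta>) * b"
    using assms a Youngs_inequality_0[of \<theta> "1 - \<theta>" a b] by auto
  then have "a powr \<theta> * b powr (1 - \<theta>) * (b powr (\<theta> - 1) / a) \<le> (\<theta> * a + (1 - \<theta>) * b) * (b powr (\<theta> - 1) / a)"
    using a by (intro mult_right_mono) auto
  moreover have "b powr (1 - \<theta>) * b powr (\<theta> - 1) = 1"
    using assms by (simp flip: powr_add)
  then have "a powr \<theta> * b powr (1 - \<theta>) * (b powr (\<theta> - 1) / a) = a powr \<theta> / a"
    by (simp add: mult.assoc)
  moreover have "b * b powr (\<theta> - 1) = b powr \<theta>" "a powr (\<theta> - 1) = a powr \<theta> / a"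
    using assms a by (simp_all add: powr_diff)
  then have "(\<theta> * a + (1 - \<theta>) * b) * (b powr (\<theta> - 1) / a)
      = \<theta> * b powr (\<theta> - 1) + (1 - \<theta>) * (b powr \<theta> / a)"
    using a by (simp add: field_simps)
  ultimately have "a powr \<theta> / a \<le> \<theta> * b powr (\<theta> - 1) + (1 - \<theta>) * (b powr \<theta> / a)"
    by metis
  with \<open>a powr (\<theta> - 1) = a powr \<theta> / a\<close> assms a show ?thesis
    by (simp add: field_simps)
qed

lemma Hoelder_sum:
  fixes \<alpha> \<beta> :: "'b \<Rightarrow> real"
  assumes "finite I" "\<And>i. i \<in> I \<Longrightarrow> 0 \<le> \<alpha> i" "\<And>i. i \<in> I \<Longrightarrow> 0 \<le> \<beta> i" and x: "0 < x" "x < 1"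
    and X: "sum \<alpha> I \<le> X" and Y: "sum \<beta> I \<le> Y"
  shows "(\<Sum>i\<in>I. \<alpha> i powr x * \<beta> i powr (1 - x)) \<le> X powr x * Y powr (1 - x)"
proof -
  have X0: "0 \<le> X" and Y0: "0 \<le> Y"
    using X Y assms sum_nonneg[of I \<alpha>] sum_nonneg[of I \<beta>] by force+
  show ?thesis
  proof (cases "X = 0 \<or> Y = 0")
    case True
    have "\<alpha> i powr x * \<beta> i powr (1 - x) = 0" if "i \<in> I" for i
    proof -
      have "sum \<alpha> I \<le> 0 \<Longrightarrow> \<alpha> i = 0" "sum \<beta> I \<le> 0 \<Longrightarrow> \<beta> i = 0"
        using assms that sum_nonneg_eq_0_iff[of I \<alpha>] sum_nonneg_eq_0_iff[of I \<beta>]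
          sum_nonneg[of I \<alpha>] sum_nonneg[of I \<beta>] by (metis order_antisym)+
      with True X Y show ?thesis by auto
    qed
    then show ?thesis by (simp add: sum.neutral)
  next
    case False
    then have pos: "X > 0" "Y > 0" using X0 Y0 by auto
    have young: "u powr x * v powr (1 - x) \<le> x * u + (1 - x) * v" if "0 \<le> u" "0 \<le> v" for u v :: real
    proof (cases "u = 0 \<or> v = 0")
      case True
      then show ?thesis using that x by auto
    next
      case False
      then show ?thesis using that x by (intro Youngs_inequality_0) auto
    qed
    have "(\<alpha> i / X) powr x * (\<beta> i / Y) powr (1 - x) \<le> x * (\<alpha> i / X) + (1 - x) * (\<beta> i / Y)"
      if "i \<in> I" for i
      using assms that pos by (intro young) auto
    then have "(\<Sum>i\<in>I. (\<alpha> i / X) powr x * (\<beta> i / Y) powr (1 - x))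
        \<le> (\<Sum>i\<in>I. x * (\<alpha> i / X) + (1 - x) * (\<beta> i / Y))"
      by (rule sum_mono)
    also have "\<dots> = x * (sum \<alpha> I / X) + (1 - x) * (sum \<beta> I / Y)"
      by (simp add: sum.distrib sum_distrib_left sum_divide_distrib)
    also have "\<dots> \<le> x * 1 + (1 - x) * 1"
      using X Y pos assms by (intro add_mono mult_left_mono) auto
    finally have "(\<Sum>i\<in>I. (\<alpha> i / X) powr x * (\<beta> i / Y) powr (1 - x)) \<le> 1" by simp
    moreover have "(\<Sum>i\<in>I. (\<alpha> i / X) powr x * (\<beta> i / Y) powr (1 - x))
       = (\<Sum>i\<in>I. \<alpha> i powr x * \<beta> i powr (1 - x)) / (X powr x * Y powr (1 - x))"
      using assms pos by (simp add: powr_divide sum_divide_distrib)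
    ultimately show ?thesis
      using pos by (simp add: divide_le_eq)
  qed
qed

text \<open>Only the power \<open>1 - x\<close> of \<beta> is passed to Hoelder's inequality; the
  surplus \<open>z - (1 - x)\<close> is estimated pointwise by \<open>M\<close>. Hence the Carleson
  constant \<open>W\<close> enters with exponent \<open>1 - x\<close> rather than \<open>z\<close>,
  which later produces the exponents \<open>1 / q\<close> and \<open>1 / r - 1 / p\<close> in
  \<open>K\<close>.\<close>

lemma Hoelder_sum_Carleson:
  fixes \<alpha> \<beta> :: "'b \<Rightarrow> real"
  assumes fin: "finite I" and a: "\<And>i. i \<in> I \<Longrightarrow> 0 \<le> \<alpha> i" and b: "\<And>i. i \<in> I \<Longrightarrow> 0 \<le> \<beta> i"
    and x: "0 < x" "x \<le> 1" and z: "1 - x \<le> z" "0 < z"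
    and X: "sum \<alpha> I \<le> X" and M: "\<And>i. i \<in> I \<Longrightarrow> \<beta> i \<le> M" "0 \<le> M"
    and WM: "sum \<beta> I \<le> W * M" and W: "0 < W"
  shows "(\<Sum>i\<in>I. \<alpha> i powr x * \<beta> i powr z) \<le> X powr x * W powr (1 - x) * M powr z"
proof (cases "x = 1")
  case True
  have "(\<Sum>i\<in>I. \<alpha> i powr x * \<beta> i powr z) \<le> (\<Sum>i\<in>I. \<alpha> i * M powr z)"
    using True assms by (intro sum_mono mult_mono powr_mono2) auto
  also have "\<dots> = sum \<alpha> I * M powr z" by (simp add: sum_distrib_right)
  also have "\<dots> \<le> X * M powr z" using X by (intro mult_right_mono) auto
  finally show ?thesis
    using True W X sum_nonneg[of I \<alpha>] a by force
next
  case False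
  then have x1: "x < 1" using x by simp
  have "\<alpha> i powr x * \<beta> i powr z \<le> M powr (z - (1 - x)) * (\<alpha> i powr x * \<beta> i powr (1 - x))" if "i \<in> I" for i
  proof -
    have "\<beta> i powr z = \<beta> i powr (z - (1 - x)) * \<beta> i powr (1 - x)"
      by (simp flip: powr_add)
    also have "\<dots> \<le> M powr (z - (1 - x)) * \<beta> i powr (1 - x)"
      using that assms by (intro mult_right_mono powr_mono2) auto
    finally have "\<alpha> i powr x * \<beta> i powr z \<le> \<alpha> i powr x * (M powr (z - (1 - x)) * \<beta> i powr (1 - x))"
      by (intro mult_left_mono) auto
    then show ?thesis by (simp add: mult_ac)
  qed
  then have "(\<Sum>i\<in>I. \<alpha> i powr x * \<beta> i powr z)
      \<le> M powr (z - (1 - x)) * (\<Sum>i\<in>I. \<alpha> i powr x * \<beta> i powr (1 - x))"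
    unfolding sum_distrib_left by (rule sum_mono)
  also have "\<dots> \<le> M powr (z - (1 - x)) * (X powr x * (W * M) powr (1 - x))"
    using assms x1 by (intro mult_left_mono Hoelder_sum) auto
  also have "(W * M) powr (1 - x) = W powr (1 - x) * M powr (1 - x)"
    using M W by (simp add: powr_mult)
  also have "M powr (z - (1 - x)) * (X powr x * (W powr (1 - x) * M powr (1 - x)))
     = X powr x * W powr (1 - x) * (M powr (z - (1 - x)) * M powr (1 - x))"
    by (simp only: mult_ac)
  also have "M powr (z - (1 - x)) * M powr (1 - x) = M powr z"
    by (simp flip: powr_add)
  finally show ?thesis .
qed

text \<open>The indices are distinct integers up to \<open>L\<close>, so the sum is part of a
  geometric series descending from the integer part of \<open>L\<close>.\<close>

lemma sum_powr_two_le: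
  fixes L \<rho> :: real
  assumes "finite K" "\<And>k. k \<in> K \<Longrightarrow> of_int k \<le> L" "0 < \<rho>"
  shows "(\<Sum>k\<in>K. 2 powr (of_int k * \<rho>)) \<le> 2 powr (L * \<rho>) / (1 - 2 powr (- \<rho>))"
proof -
  define j where "j k = nat (\<lfloor>L\<rfloor> - k)" for k
  define z where "z = (2::real) powr (- \<rho>)"
  have z: "0 < z" "z < 1" using assms by (auto simp: z_def powr_less_one)
  have K: "k \<le> \<lfloor>L\<rfloor>" if "k \<in> K" for k using assms(2)[OF that] by linarith
  have inj: "inj_on j K" 
  proof (rule inj_onI)
    fix k l assume "k \<in> K" "l \<in> K" "j k = j l"
    then show "k = l" using K[of k] K[of l] by (simp add: j_def)
  qed
  have eq: "2 powr (of_int k * \<rho>) = 2 powr (of_int \<lfloor>L\<rfloor> * \<rho>) * z ^ j k" if "k \<in> K" for k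
  proof -
    have "z ^ j k = z powr real (j k)" using z by (simp add: powr_realpow)
    also have "\<dots> = 2 powr (- \<rho> * real (j k))" by (simp add: z_def powr_powr)
    also have "real (j k) = of_int \<lfloor>L\<rfloor> - of_int k" using K[OF that] by (simp add: j_def)
    finally show ?thesis by (simp add: algebra_simps flip: powr_add)
  qed
  have "(\<Sum>k\<in>K. 2 powr (of_int k * \<rho>)) = 2 powr (of_int \<lfloor>L\<rfloor> * \<rho>) * (\<Sum>k\<in>K. z ^ j k)"
    by (simp add: eq sum_distrib_left cong: sum.cong)
  also have "(\<Sum>k\<in>K. z ^ j k) = (\<Sum>i\<in>j ` K. z ^ i)"
    by (simp add: sum.reindex[OF inj])
  also have "\<dots> \<le> (\<Sum>i. z ^ i)"
    using z assms by (intro sum_le_suminf summable_geometric) auto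
  also have "\<dots> = 1 / (1 - z)" using z by (simp add: suminf_geometric)
  finally have "(\<Sum>k\<in>K. 2 powr (of_int k * \<rho>)) \<le> 2 powr (of_int \<lfloor>L\<rfloor> * \<rho>) * (1 / (1 - z))"
    by (auto simp: mult_left_mono)
  also have "\<dots> \<le> 2 powr (L * \<rho>) * (1 / (1 - z))"
    using z assms by (intro mult_right_mono powr_mono) auto
  finally show ?thesis by (simp add: z_def)
qed

subsection \<open>Increments along finite nested families\<close>

definition nested :: "'a set set \<Rightarrow> bool" where
  "nested S \<longleftrightarrow> (\<forall>Q\<in>S. \<forall>R\<in>S. Q \<inter> R = {} \<or> Q \<subseteq> R \<or> R \<subseteq> Q)"

text \<open>
  For \<open>R \<in> S\<close> the increment compares \<open>F\<close> on the ancestors of \<open>R\<close> with and without \<open>R\<close> itself, so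
  increments telescope along chains.
\<close>

definition increment :: "'a set set \<Rightarrow> ('a set set \<Rightarrow> real) \<Rightarrow> 'a set \<Rightarrow> real" where
  "increment S F R = F {R'\<in>S. R \<subseteq> R'} - F {R'\<in>S. R \<subset> R'}"

text \<open>The inserted \<open>0\<close> gives the empty family the value \<open>0\<close>, so
  powers of \<open>setmax\<close> satisfy \<open>F {} = 0\<close> and telescoping along ancestors
  leaves no boundary term.\<close>

definition setmax :: "('a set \<Rightarrow> real) \<Rightarrow> 'a set set \<Rightarrow> real" where
  "setmax a T = Max (insert 0 (a ` T))"

lemma setmax_empty [simp]: "setmax a {} = 0"
  by (simp add: setmax_def)

lemma setmax_nonneg: "finite T \<Longrightarrow> 0 \<le> setmax a T"
  by (simp add: setmax_def)

lemma setmax_mono: "finite T \<Longrightarrow> T' \<subseteq> T \<Longrightarrow> setmax a T' \<le> setmax a T"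
  unfolding setmax_def by (intro Max_mono) auto

lemma setmax_ge: "finite T \<Longrightarrow> Q \<in> T \<Longrightarrow> a Q \<le> setmax a T"
  unfolding setmax_def by (intro Max_ge) auto

text \<open>This dichotomy replaces the choice of stopping cubes: where passing to \<open>Q\<close>
  changes the maximum, the new maximum is \<open>a Q\<close> itself. A nonzero increment can
  therefore be rewritten through the quotient that defines \<open>a Q\<close>.\<close>

lemma setmax_strict_supersets:
  assumes "finite S" "Q \<in> S"
  shows "setmax a {R\<in>S. Q \<subset> R} = setmax a {R\<in>S. Q \<subseteq> R} \<or> setmax a {R\<in>S. Q \<subseteq> R} = a Q"
proof -
  have "{R\<in>S. Q \<subseteq> R} = insert Q {R\<in>S. Q \<subset> R}" using assms by auto
  then have "setmax a {R\<in>S. Q \<subseteq> R} = Max (insert (a Q) (insert 0 (a ` {R\<in>S. Q \<subset> R})))"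
    by (simp add: setmax_def insert_commute)
  also have "\<dots> = max (a Q) (setmax a {R\<in>S. Q \<subset> R})"
    using assms by (subst Max_insert) (auto simp: setmax_def)
  finally show ?thesis by (auto simp: max_def)
qed

text \<open>Increments look only at ancestors, so deleting the minimal member of a chain leaves all
  other increments unchanged and removes exactly \<open>F T - F (T - {R0})\<close>.\<close>

lemma sum_increment_chain:
  assumes "finite T" "\<And>Q R. Q \<in> T \<Longrightarrow> R \<in> T \<Longrightarrow> Q \<subseteq> R \<or> R \<subseteq> Q"
  shows "(\<Sum>R\<in>T. increment T F R) = F T - F {}"
  using assms
proof (induction "card T" arbitrary: T)
  case 0
  then show ?case by simp
next
  case (Suc n)
  then have "T \<noteq> {}" by auto
  then obtain R0 where R0: "R0 \<in> T" "\<And>R. R \<in> T \<Longrightarrow> R \<subseteq> R0 \<Longrightarrow> R0 = R"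
    using finite_has_minimal[OF Suc.prems(1)] by blast
  then have min: "R0 \<subseteq> R" if "R \<in> T" for R using Suc.prems(2) that by blast
  let ?T = "T - {R0}"
  have "increment T F R0 = F T - F ?T"
  proof -
    have "{R'\<in>T. R0 \<subseteq> R'} = T" "{R'\<in>T. R0 \<subset> R'} = ?T" using min by auto
    then show ?thesis by (simp add: increment_def)
  qed
  moreover have "increment T F R = increment ?T F R" if "R \<in> ?T" for R
  proof -
    have "{R'\<in>T. R \<subseteq> R'} = {R'\<in>?T. R \<subseteq> R'}" "{R'\<in>T. R \<subset> R'} = {R'\<in>?T. R \<subset> R'}"
      using that R0 by auto
    then show ?thesis by (simp add: increment_def)
  qed
  moreover have "(\<Sum>R\<in>?T. increment ?T F R) = F ?T - F {}"
    using Suc.prems Suc.hyps R0 by (intro Suc.hyps(1)) auto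
  ultimately show ?case
    using Suc.prems R0 by (simp add: sum.remove[of T R0])
qed

text \<open>An up-closed subfamily contains all ancestors of its members, so increments relative to
  \<open>S\<close> and to \<open>T\<close> coincide and the chain case applies. The two instances
  below are the members containing a given set and those containing a given point.\<close>

lemma sum_increment_upclosed:
  assumes "finite S" "T \<subseteq> S" "\<And>Q R. Q \<in> T \<Longrightarrow> R \<in> S \<Longrightarrow> Q \<subseteq> R \<Longrightarrow> R \<in> T"
    "\<And>Q R. Q \<in> T \<Longrightarrow> R \<in> T \<Longrightarrow> Q \<subseteq> R \<or> R \<subseteq> Q"
  shows "(\<Sum>R\<in>T. increment S F R) = F T - F {}"
proof -
  have "increment S F R = increment T F R" if "R \<in> T" for R
  proof -
    have "{R'\<in>S. R \<subseteq> R'} = {R'\<in>T. R \<subseteq> R'}" "{R'\<in>S. R \<subset> R'} = {R'\<in>T. R \<subset> R'}"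
      using that assms by auto
    then show ?thesis by (simp add: increment_def)
  qed
  then show ?thesis
    using assms sum_increment_chain[of T F] finite_subset[of T S] by simp
qed

lemma sum_increment_supersets:
  assumes "finite S" "nested S" "{} \<notin> S" "Q \<in> S"
  shows "(\<Sum>R | R \<in> S \<and> Q \<subseteq> R. increment S F R) = F {R\<in>S. Q \<subseteq> R} - F {}"
proof (rule sum_increment_upclosed)
  fix R R' assume "R \<in> {R \<in> S. Q \<subseteq> R}" "R' \<in> {R \<in> S. Q \<subseteq> R}"
  moreover have "Q \<noteq> {}" using assms by auto
  ultimately show "R \<subseteq> R' \<or> R' \<subseteq> R"
    using assms(2) unfolding nested_def by blast
qed (use assms in auto)

lemma sum_increment_at:
  assumes "finite S" "nested S"
  shows "(\<Sum>R\<in>S. increment S F R * indicator R x) = F {R\<in>S. x \<in> R} - F {}"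
proof -
  have "(\<Sum>R\<in>S. increment S F R * indicator R x) = (\<Sum>R | R \<in> S \<and> x \<in> R. increment S F R)"
    using assms by (simp add: sum.If_cases indicator_def Int_def cong: sum.cong)
  also have "\<dots> = F {R\<in>S. x \<in> R} - F {}"
  proof (rule sum_increment_upclosed)
    fix R R' assume "R \<in> {R \<in> S. x \<in> R}" "R' \<in> {R \<in> S. x \<in> R}"
    then show "R \<subseteq> R' \<or> R' \<subseteq> R"
      using assms(2) unfolding nested_def by blast
  qed (use assms in auto)
  finally show ?thesis .
qed

text \<open>The Carleson embedding in Abel-summation form: writing \<open>F\<close> on the ancestors
  of \<open>Q\<close> as a sum of increments and exchanging the order leaves, for each
  \<open>R\<close>, the sum of \<open>c\<close> over its descendants, which the hypothesis on
  \<open>c\<close> controls.\<close>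

lemma Carleson_sum_le:
  fixes c d :: "'a set \<Rightarrow> real"
  assumes S: "finite S" "nested S" "{} \<notin> S"
    and F: "F {} = 0" "\<And>R. R \<in> S \<Longrightarrow> 0 \<le> increment S F R"
    and c: "\<And>R. R \<in> S \<Longrightarrow> (\<Sum>Q | Q \<in> S \<and> Q \<subseteq> R. c Q) \<le> \<Gamma> * d R"
  shows "(\<Sum>Q\<in>S. c Q * F {R\<in>S. Q \<subseteq> R}) \<le> \<Gamma> * (\<Sum>R\<in>S. d R * increment S F R)"
proof -
  have "(\<Sum>Q\<in>S. c Q * F {R\<in>S. Q \<subseteq> R}) = (\<Sum>Q\<in>S. c Q * (\<Sum>R | R \<in> S \<and> Q \<subseteq> R. increment S F R))"
    using S F by (simp add: sum_increment_supersets cong: sum.cong)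
  also have "\<dots> = (\<Sum>Q\<in>S. \<Sum>R | R \<in> S \<and> Q \<subseteq> R. c Q * increment S F R)"
    by (simp add: sum_distrib_left)
  also have "\<dots> = (\<Sum>R\<in>S. \<Sum>Q | Q \<in> S \<and> Q \<subseteq> R. c Q * increment S F R)"
    using S by (rule_tac sum.swap_restrict)
  also have "\<dots> = (\<Sum>R\<in>S. (\<Sum>Q | Q \<in> S \<and> Q \<subseteq> R. c Q) * increment S F R)"
    by (simp add: sum_distrib_right)
  also have "\<dots> \<le> (\<Sum>R\<in>S. \<Gamma> * d R * increment S F R)"
    using c F by (intro sum_mono mult_right_mono) auto
  finally show ?thesis by (simp add: sum_distrib_left mult_ac)
qed

lemma increment_powr_setmax_nonneg:
  assumes "finite S" "0 \<le> s"
  shows "0 \<le> increment S (\<lambda>T. setmax a T powr s) R"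
  unfolding increment_def using assms
  by (auto intro!: powr_mono2 setmax_mono setmax_nonneg)

text \<open>Integrating the pointwise telescoping identity turns sums of increments weighted by a
  measure into the integral of a step function; this is the bridge from the combinatorial sums to
  integrals.\<close>

lemma sum_measure_increment:
  assumes "finite S" "nested S" "\<And>Q. Q \<in> S \<Longrightarrow> Q \<in> sets M" "\<And>Q. Q \<in> S \<Longrightarrow> emeasure M Q < \<infinity>"
    and "F {} = 0"
  shows "integrable M (\<lambda>x. F {R\<in>S. x \<in> R})"
    and "(\<Sum>R\<in>S. measure M R * increment S F R) = (\<integral>x. F {R\<in>S. x \<in> R} \<partial>M)"
proof -
  have eq: "F {R\<in>S. x \<in> R} = (\<Sum>R\<in>S. increment S F R * indicator R x)" for x
    using sum_increment_at[OF assms(1,2)] assms(5) by simp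
  have int: "integrable M (\<lambda>x. increment S F R * indicator R x)" if "R \<in> S" for R
    using assms that by (intro integrable_mult_right integrable_real_indicator) auto
  show "integrable M (\<lambda>x. F {R\<in>S. x \<in> R})"
    unfolding eq using int by (intro Bochner_Integration.integrable_sum) auto
  have "(\<integral>x. F {R\<in>S. x \<in> R} \<partial>M) = (\<Sum>R\<in>S. \<integral>x. increment S F R * indicator R x \<partial>M)"
    unfolding eq by (rule Bochner_Integration.integral_sum) (rule int)
  also have "\<dots> = (\<Sum>R\<in>S. increment S F R * measure M R)"
    using assms sets.sets_into_space by (intro sum.cong) (auto simp: Int_absorb1 Int_commute)
  finally show "(\<Sum>R\<in>S. measure M R * increment S F R) = (\<integral>x. F {R\<in>S. x \<in> R} \<partial>M)"
    by (simp add: mult_ac)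
qed

text \<open>The first conclusion sums over the family and pays \<Gamma>; the second bounds a single
  term by monotonicity of \<sigma>. The second supplies the pointwise bound \<open>M\<close> of
  \<open>Hoelder_sum_Carleson\<close>, so that surplus exponents cost no Carleson constant.\<close>

lemma Carleson_setmax:
  fixes \<sigma> :: "'a set \<Rightarrow> real"
  assumes S: "finite S" "nested S" "{} \<notin> S" and "0 \<le> s"
    and N: "(\<Sum>R\<in>S. \<sigma> R * increment S (\<lambda>T. setmax a T powr s) R) \<le> N"
    and \<sigma>0: "\<And>Q. Q \<in> S \<Longrightarrow> 0 \<le> \<sigma> Q"
  shows Carleson_setmax_sum:
      "(\<And>R. R \<in> S \<Longrightarrow> (\<Sum>Q | Q \<in> S \<and> Q \<subseteq> R. \<sigma> Q) \<le> \<Gamma> * \<sigma> R) \<Longrightarrow> 0 \<le> \<Gamma> \<Longrightarrow>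
       (\<Sum>Q\<in>S. \<sigma> Q * setmax a {R\<in>S. Q \<subseteq> R} powr s) \<le> \<Gamma> * N"
    and Carleson_setmax_single:
      "(\<And>Q R. Q \<in> S \<Longrightarrow> R \<in> S \<Longrightarrow> Q \<subseteq> R \<Longrightarrow> \<sigma> Q \<le> \<sigma> R) \<Longrightarrow> Q \<in> S \<Longrightarrow>
       \<sigma> Q * setmax a {R\<in>S. Q \<subseteq> R} powr s \<le> N"
proof -
  let ?i = "increment S (\<lambda>T. setmax a T powr s)"
  have i0: "0 \<le> ?i R" for R by (rule increment_powr_setmax_nonneg) (use assms in auto)
  {
    assume "\<And>R. R \<in> S \<Longrightarrow> (\<Sum>Q | Q \<in> S \<and> Q \<subseteq> R. \<sigma> Q) \<le> \<Gamma> * \<sigma> R" "0 \<le> \<Gamma>"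
    then have "(\<Sum>Q\<in>S. \<sigma> Q * setmax a {R\<in>S. Q \<subseteq> R} powr s) \<le> \<Gamma> * (\<Sum>R\<in>S. \<sigma> R * ?i R)"
      using i0 S by (intro Carleson_sum_le) auto
    also have "\<dots> \<le> \<Gamma> * N" using N \<open>0 \<le> \<Gamma>\<close> by (rule mult_left_mono)
    finally show "(\<Sum>Q\<in>S. \<sigma> Q * setmax a {R\<in>S. Q \<subseteq> R} powr s) \<le> \<Gamma> * N" .
  next
    assume mono: "\<And>Q R. Q \<in> S \<Longrightarrow> R \<in> S \<Longrightarrow> Q \<subseteq> R \<Longrightarrow> \<sigma> Q \<le> \<sigma> R" and Q: "Q \<in> S"
    have "\<sigma> Q * setmax a {R\<in>S. Q \<subseteq> R} powr s = (\<Sum>R | R \<in> S \<and> Q \<subseteq> R. \<sigma> Q * ?i R)"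
      using sum_increment_supersets[OF S Q, of "\<lambda>T. setmax a T powr s"]
      by (simp flip: sum_distrib_left)
    also have "\<dots> \<le> (\<Sum>R | R \<in> S \<and> Q \<subseteq> R. \<sigma> R * ?i R)"
      using mono Q i0 by (intro sum_mono mult_right_mono) auto
    also have "\<dots> \<le> (\<Sum>R\<in>S. \<sigma> R * ?i R)"
      using S \<sigma>0 i0 by (intro sum_mono2) auto
    also note N
    finally show "\<sigma> Q * setmax a {R\<in>S. Q \<subseteq> R} powr s \<le> N" .
  }
qed

text \<open>Summation by parts is applied once, to the product of both maxima, and costs the single
  factor \<Gamma>. In each of the two terms of the Leibniz rule one maximum has become an increment,
  whose weighted sum is at most \<open>N\<close> or \<open>M\<close> outright; Hoelder's inequality
  then charges only the other one, with exponent \<open>y\<close> for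
  \<open>\<Gamma>\<^sub>\<sigma>\<close> and \<open>1 - x\<close> for
  \<open>\<Gamma>\<^sub>\<omega>\<close>.\<close>

lemma bilinear_Carleson:
  fixes \<sigma> \<omega> a b :: "'a set \<Rightarrow> real"
  assumes S: "finite S" "nested S" "{} \<notin> S"
    and xy: "0 < y" "y \<le> x" "x \<le> 1" "y < 1" and p: "0 < p"
    and pos: "\<And>Q. Q \<in> S \<Longrightarrow> 0 < \<sigma> Q" "\<And>Q. Q \<in> S \<Longrightarrow> 0 < \<omega> Q"
    and mono: "\<And>Q R. Q \<in> S \<Longrightarrow> R \<in> S \<Longrightarrow> Q \<subseteq> R \<Longrightarrow> \<sigma> Q \<le> \<sigma> R"
      "\<And>Q R. Q \<in> S \<Longrightarrow> R \<in> S \<Longrightarrow> Q \<subseteq> R \<Longrightarrow> \<omega> Q \<le> \<omega> R"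
    and N: "(\<Sum>R\<in>S. \<sigma> R * increment S (\<lambda>T. setmax a T powr p) R) \<le> N"
    and M: "(\<Sum>R\<in>S. \<omega> R * increment S (\<lambda>T. setmax b T powr (1 / (1 - y))) R) \<le> M"
    and C\<sigma>: "\<And>R. R \<in> S \<Longrightarrow> (\<Sum>Q | Q \<in> S \<and> Q \<subseteq> R. \<sigma> Q) \<le> \<Gamma>\<^sub>\<sigma> * \<sigma> R" "0 < \<Gamma>\<^sub>\<sigma>"
    and C\<omega>: "\<And>R. R \<in> S \<Longrightarrow> (\<Sum>Q | Q \<in> S \<and> Q \<subseteq> R. \<omega> Q) \<le> \<Gamma>\<^sub>\<omega> * \<omega> R" "0 < \<Gamma>\<^sub>\<omega>"
    and C: "\<And>R. R \<in> S \<Longrightarrow> (\<Sum>Q | Q \<in> S \<and> Q \<subseteq> R. \<sigma> Q powr x * \<omega> Q powr (1 - y))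
              \<le> \<Gamma> * (\<sigma> R powr x * \<omega> R powr (1 - y))" "0 \<le> \<Gamma>"
    and ab: "\<And>Q. Q \<in> S \<Longrightarrow> 0 \<le> a Q" "\<And>Q. Q \<in> S \<Longrightarrow> 0 \<le> b Q"
  shows "(\<Sum>Q\<in>S. \<sigma> Q powr x * \<omega> Q powr (1 - y) * (a Q powr (x * p) * b Q))
           \<le> \<Gamma> * ((\<Gamma>\<^sub>\<sigma> powr y + \<Gamma>\<^sub>\<omega> powr (1 - x)) * N powr x * M powr (1 - y))"
proof -
  define F where "F T = setmax a T powr (x * p) * setmax b T" for T
  define U V V' where "U R = setmax a {R'\<in>S. R \<subseteq> R'}" and "V R = setmax b {R'\<in>S. R \<subseteq> R'}"
    and "V' R = setmax b {R'\<in>S. R \<subset> R'}" for R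
  let ?iU = "increment S (\<lambda>T. setmax a T powr p)"
  let ?iu = "increment S (\<lambda>T. setmax a T powr (x * p))"
  let ?iV = "increment S (\<lambda>T. setmax b T powr (1 / (1 - y)))"
  let ?iv = "increment S (setmax b)"
  have U0: "0 \<le> U R" and V0: "0 \<le> V R" and V'0: "0 \<le> V' R" and V'V: "V' R \<le> V R" for R
    using S unfolding U_def V_def V'_def by (auto intro!: setmax_nonneg setmax_mono)
  have iU0: "0 \<le> ?iU R" and iu0: "0 \<le> ?iu R" and iV0: "0 \<le> ?iV R" for R
    using S xy p by (auto intro!: increment_powr_setmax_nonneg)
  have iv0: "0 \<le> ?iv R" for R
    using V'V[of R] by (simp add: increment_def V_def V'_def)
  \<comment> \<open>Discrete Leibniz rule: \<open>U\<close> is taken with \<open>R\<close> and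
    \<open>V'\<close> without it, so the identity is exact.\<close>
  have prod: "increment S F R = U R powr (x * p) * ?iv R + ?iu R * V' R" for R
    by (simp add: increment_def F_def U_def V'_def algebra_simps)
  have iF0: "0 \<le> increment S F R" for R
    unfolding prod using iv0 iu0 V'0 by simp
  have "(\<Sum>Q\<in>S. \<sigma> Q powr x * \<omega> Q powr (1 - y) * (a Q powr (x * p) * b Q))
      \<le> (\<Sum>Q\<in>S. \<sigma> Q powr x * \<omega> Q powr (1 - y) * F {R\<in>S. Q \<subseteq> R})"
    unfolding F_def using S xy p ab
    by (intro sum_mono mult_left_mono mult_mono powr_mono2 setmax_ge) auto
  also have "\<dots> \<le> \<Gamma> * (\<Sum>R\<in>S. (\<sigma> R powr x * \<omega> R powr (1 - y)) * increment S F R)"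
  proof (rule Carleson_sum_le)
    show "F {} = 0" by (simp add: F_def)
  qed (use S C iF0 in auto)
  also have "(\<Sum>R\<in>S. (\<sigma> R powr x * \<omega> R powr (1 - y)) * increment S F R)
     \<le> (\<Sum>R\<in>S. (\<omega> R * ?iV R) powr (1 - y) * (\<sigma> R * U R powr p) powr x)
       + (\<Sum>R\<in>S. (\<sigma> R * ?iU R) powr x * (\<omega> R * V R powr (1 / (1 - y))) powr (1 - y))"
    unfolding sum.distrib[symmetric]
  proof (rule sum_mono)
    fix R assume R: "R \<in> S"
    \<comment> \<open>As \<open>1 / (1 - y) \<ge> 1\<close>, superadditivity lets the power pass
      inside the increment, so that the hypothesis on \<open>M\<close> applies. The same device with
      the exponent \<open>1 / x\<close> serves for \<open>a\<close>.\<close>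
    have "?iv R = ((?iv R) powr (1 / (1 - y))) powr (1 - y)"
      using iv0[of R] xy by (simp add: powr_powr)
    also have "\<dots> \<le> ?iV R powr (1 - y)"
      unfolding increment_def V_def[symmetric] V'_def[symmetric]
      using V'V[of R] V'0[of R] xy by (intro powr_mono2 powr_superadd) (auto simp: field_simps)
    finally have 1: "?iv R \<le> ?iV R powr (1 - y)" .
    have "?iu R = ((?iu R) powr (1 / x)) powr x"
      using iu0[of R] xy by (simp add: powr_powr)
    also have "\<dots> \<le> ?iU R powr x"
    proof (intro powr_mono2)
      have "(?iu R) powr (1 / x) \<le> (setmax a {R'\<in>S. R \<subseteq> R'} powr (x * p)) powr (1 / x)
          - (setmax a {R'\<in>S. R \<subset> R'} powr (x * p)) powr (1 / x)"
        unfolding increment_def using S xy p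
        by (intro powr_superadd powr_mono2 setmax_mono setmax_nonneg) auto
      also have "\<dots> = ?iU R"
        using xy by (simp add: increment_def powr_powr)
      finally show "(?iu R) powr (1 / x) \<le> ?iU R" .
    qed (use xy in auto)
    finally have 2: "?iu R \<le> ?iU R powr x" .
    have "\<sigma> R powr x * \<omega> R powr (1 - y) * (U R powr (x * p) * ?iv R)
        \<le> \<sigma> R powr x * \<omega> R powr (1 - y) * (U R powr (x * p) * ?iV R powr (1 - y))"
      using 1 by (intro mult_left_mono) auto
    also have "\<dots> = (\<omega> R * ?iV R) powr (1 - y) * (\<sigma> R * U R powr p) powr x"
      using pos[OF R] iV0[of R] U0[of R] by (simp add: powr_mult powr_powr mult_ac)
    finally have 3: "\<sigma> R powr x * \<omega> R powr (1 - y) * (U R powr (x * p) * ?iv R)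
      \<le> (\<omega> R * ?iV R) powr (1 - y) * (\<sigma> R * U R powr p) powr x" .
    have "\<sigma> R powr x * \<omega> R powr (1 - y) * (?iu R * V' R)
        \<le> \<sigma> R powr x * \<omega> R powr (1 - y) * (?iU R powr x * V R)"
      using 2 V'V[of R] V'0[of R] iu0[of R] by (intro mult_left_mono mult_mono) auto
    also have "\<dots> = (\<sigma> R * ?iU R) powr x * (\<omega> R * V R powr (1 / (1 - y))) powr (1 - y)"
      using pos[OF R] iU0[of R] V0[of R] xy by (simp add: powr_mult powr_powr mult_ac)
    finally show "\<sigma> R powr x * \<omega> R powr (1 - y) * increment S F R
        \<le> (\<omega> R * ?iV R) powr (1 - y) * (\<sigma> R * U R powr p) powr x
        + (\<sigma> R * ?iU R) powr x * (\<omega> R * V R powr (1 / (1 - y))) powr (1 - y)"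
      unfolding prod distrib_left using 3 by linarith
  qed
  \<comment> \<open>Here the increment carries the exponent \<open>1 - y\<close> and the full
    maximum the exponent \<open>x\<close>; the surplus condition \<open>1 - (1 - y) \<le> x\<close>
    is \<open>y \<le> x\<close>, which in the application is \<open>p \<le> q\<close>.\<close>
  also have "(\<Sum>R\<in>S. (\<omega> R * ?iV R) powr (1 - y) * (\<sigma> R * U R powr p) powr x)
      \<le> M powr (1 - y) * \<Gamma>\<^sub>\<sigma> powr (1 - (1 - y)) * N powr x"
  proof (rule Hoelder_sum_Carleson)
    show "\<sigma> R * U R powr p \<le> N" if "R \<in> S" for R
      unfolding U_def using S p pos mono N that
      by (intro Carleson_setmax_single) (auto simp: less_imp_le)
    show "(\<Sum>R\<in>S. \<sigma> R * U R powr p) \<le> \<Gamma>\<^sub>\<sigma> * N"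
      unfolding U_def using S p pos C\<sigma> N
      by (intro Carleson_setmax_sum) (auto simp: less_imp_le)
    show "0 \<le> N"
      using N by (rule order_trans[rotated]) (use pos iU0 in \<open>auto intro!: sum_nonneg mult_nonneg_nonneg simp: less_imp_le\<close>)
  qed (use S xy pos iV0 U0 M C\<sigma> in \<open>auto simp: less_imp_le\<close>)
  also have "(\<Sum>R\<in>S. (\<sigma> R * ?iU R) powr x * (\<omega> R * V R powr (1 / (1 - y))) powr (1 - y))
      \<le> N powr x * \<Gamma>\<^sub>\<omega> powr (1 - x) * M powr (1 - y)"
  proof (rule Hoelder_sum_Carleson)
    show "\<omega> R * V R powr (1 / (1 - y)) \<le> M" if "R \<in> S" for R
      unfolding V_def using S xy pos mono M that
      by (intro Carleson_setmax_single) (auto simp: less_imp_le)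
    show "(\<Sum>R\<in>S. \<omega> R * V R powr (1 / (1 - y))) \<le> \<Gamma>\<^sub>\<omega> * M"
      unfolding V_def using S xy pos C\<omega> M
      by (intro Carleson_setmax_sum) (auto simp: less_imp_le)
    show "0 \<le> M"
      using M by (rule order_trans[rotated]) (use pos iV0 in \<open>auto intro!: sum_nonneg mult_nonneg_nonneg simp: less_imp_le\<close>)
  qed (use S xy pos iU0 V0 N C\<omega> in \<open>auto simp: less_imp_le\<close>)
  finally have "(\<Sum>Q\<in>S. \<sigma> Q powr x * \<omega> Q powr (1 - y) * (a Q powr (x * p) * b Q))
      \<le> \<Gamma> * (M powr (1 - y) * \<Gamma>\<^sub>\<sigma> powr (1 - (1 - y)) * N powr x + N powr x * \<Gamma>\<^sub>\<omega> powr (1 - x) * M powr (1 - y))"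
    using C(2) by (simp add: mult_left_mono)
  then show ?thesis by (simp add: algebra_simps)
qed

text \<open>The exponents add up to exactly \<open>1\<close> and both averages are replaced by
  maxima at once, so Hoelder's inequality is followed by one Carleson embedding for each weight, and
  both constants appear as a product.\<close>

lemma bilinear_Hoelder:
  fixes \<sigma> \<omega> a b :: "'a set \<Rightarrow> real"
  assumes S: "finite S" "nested S" "{} \<notin> S"
    and x: "0 < x" "x < 1" and p: "0 < p"
    and pos: "\<And>Q. Q \<in> S \<Longrightarrow> 0 < \<sigma> Q" "\<And>Q. Q \<in> S \<Longrightarrow> 0 < \<omega> Q"
    and N: "(\<Sum>R\<in>S. \<sigma> R * increment S (\<lambda>T. setmax a T powr p) R) \<le> N"
    and M: "(\<Sum>R\<in>S. \<omega> R * increment S (\<lambda>T. setmax b T powr (1 / (1 - x))) R) \<le> M"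
    and C\<sigma>: "\<And>R. R \<in> S \<Longrightarrow> (\<Sum>Q | Q \<in> S \<and> Q \<subseteq> R. \<sigma> Q) \<le> \<Gamma>\<^sub>\<sigma> * \<sigma> R" "0 < \<Gamma>\<^sub>\<sigma>"
    and C\<omega>: "\<And>R. R \<in> S \<Longrightarrow> (\<Sum>Q | Q \<in> S \<and> Q \<subseteq> R. \<omega> Q) \<le> \<Gamma>\<^sub>\<omega> * \<omega> R" "0 < \<Gamma>\<^sub>\<omega>"
    and ab: "\<And>Q. Q \<in> S \<Longrightarrow> 0 \<le> a Q" "\<And>Q. Q \<in> S \<Longrightarrow> 0 \<le> b Q"
  shows "(\<Sum>Q\<in>S. \<sigma> Q powr x * \<omega> Q powr (1 - x) * (a Q powr (x * p) * b Q))
           \<le> (\<Gamma>\<^sub>\<sigma> * N) powr x * (\<Gamma>\<^sub>\<omega> * M) powr (1 - x)"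
proof -
  define U V where "U R = setmax a {R'\<in>S. R \<subseteq> R'}" and "V R = setmax b {R'\<in>S. R \<subseteq> R'}" for R
  have U0: "0 \<le> U R" and V0: "0 \<le> V R" for R
    using S unfolding U_def V_def by (auto intro!: setmax_nonneg)
  have "(\<Sum>Q\<in>S. \<sigma> Q powr x * \<omega> Q powr (1 - x) * (a Q powr (x * p) * b Q))
      \<le> (\<Sum>Q\<in>S. \<sigma> Q powr x * \<omega> Q powr (1 - x) * (U Q powr (x * p) * V Q))"
    unfolding U_def V_def using S x p ab
    by (intro sum_mono mult_left_mono mult_mono powr_mono2 setmax_ge) auto
  also have "\<dots> = (\<Sum>Q\<in>S. (\<sigma> Q * U Q powr p) powr x * (\<omega> Q * V Q powr (1 / (1 - x))) powr (1 - x))"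
  proof (rule sum.cong)
    fix Q assume "Q \<in> S"
    then show "\<sigma> Q powr x * \<omega> Q powr (1 - x) * (U Q powr (x * p) * V Q)
       = (\<sigma> Q * U Q powr p) powr x * (\<omega> Q * V Q powr (1 / (1 - x))) powr (1 - x)"
      using pos[of Q] U0[of Q] V0[of Q] x by (simp add: powr_mult powr_powr mult_ac)
  qed simp
  also have "\<dots> \<le> (\<Gamma>\<^sub>\<sigma> * N) powr x * (\<Gamma>\<^sub>\<omega> * M) powr (1 - x)"
  proof (rule Hoelder_sum)
    show "(\<Sum>R\<in>S. \<sigma> R * U R powr p) \<le> \<Gamma>\<^sub>\<sigma> * N"
      unfolding U_def using S p pos C\<sigma> N
      by (intro Carleson_setmax_sum) (auto simp: less_imp_le)
    show "(\<Sum>R\<in>S. \<omega> R * V R powr (1 / (1 - x))) \<le> \<Gamma>\<^sub>\<omega> * M"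
      unfolding V_def using S x pos C\<omega> M
      by (intro Carleson_setmax_sum) (auto simp: less_imp_le)
  qed (use S x pos in \<open>auto simp: less_imp_le\<close>)
  finally show ?thesis .
qed

section \<open>Doob's maximal inequality over a finite nested family\<close>

lemma integrable_powr_imp_integrable_on:
  fixes f :: "'a \<Rightarrow> real"
  assumes Q: "Q \<in> sets M" "emeasure M Q < \<infinity>" and p: "1 < p"
    and f: "f \<in> borel_measurable M" "\<And>x. 0 \<le> f x" "integrable M (\<lambda>x. f x powr p)"
  shows "integrable M (\<lambda>x. f x * indicator Q x)"
proof (rule Bochner_Integration.integrable_bound)
  show "integrable M (\<lambda>x. f x powr p + indicator Q x)"
    using Q f by (intro Bochner_Integration.integrable_add integrable_real_indicator) auto
  have "f x \<le> f x powr p + 1" for x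
  proof (cases "f x \<le> 1")
    case False
    then have "f x powr 1 \<le> f x powr p" using p by (intro powr_mono) auto
    then show ?thesis using False by simp
  qed (simp add: add_increasing)
  then show "AE x in M. norm (f x * indicator Q x) \<le> norm (f x powr p + indicator Q x)"
    using f by (intro AE_I2) (auto simp: indicator_def)
qed (use f Q in measurable)

text \<open>At a jump the maximum equals \<open>a R\<close>, so \<open>measure M R\<close> times it
  is the integral of \<open>f\<close> over \<open>R\<close>. The increments of the
  \<open>p\<close>-th power are thereby reduced to the integral of
  \<open>f * h powr (p - 1)\<close>, where \<open>h\<close> is the maximal function of the family;
  half of the integral of \<open>h powr p\<close> is then absorbed.\<close>

lemma Doob_maximal:
  fixes f :: "'a \<Rightarrow> real"
  assumes S: "finite S" "nested S" and p: "1 < p"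
    and sets: "\<And>Q. Q \<in> S \<Longrightarrow> Q \<in> sets M" and fin: "\<And>Q. Q \<in> S \<Longrightarrow> emeasure M Q < \<infinity>"
    and pos: "\<And>Q. Q \<in> S \<Longrightarrow> 0 < measure M Q"
    and f: "f \<in> borel_measurable M" "\<And>x. 0 \<le> f x" "integrable M (\<lambda>x. f x powr p)"
    and a: "\<And>Q. Q \<in> S \<Longrightarrow> a Q = (\<integral>x. f x * indicator Q x \<partial>M) / measure M Q"
  shows "(\<Sum>R\<in>S. measure M R * increment S (\<lambda>T. setmax a T powr p) R)
           \<le> 2 * (2 * conj_exp p) powr p * (\<integral>x. f x powr p \<partial>M)"
proof -
  define P where "P = conj_exp p"
  define h where "h x = setmax a {R\<in>S. x \<in> R}" for x
  have P: "P > 0" using p by (simp add: P_def conj_exp_def)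
  have h0: "0 \<le> h x" for x using S by (simp add: h_def setmax_nonneg)
  let ?i = "increment S (\<lambda>T. setmax a T powr p)"
  let ?j = "increment S (\<lambda>T. setmax a T powr (p - 1))"
  have int_f: "integrable M (\<lambda>x. f x * indicator Q x)" if "Q \<in> S" for Q
    using sets[OF that] fin[OF that] p f by (rule integrable_powr_imp_integrable_on)
  have step: "measure M R * ?i R \<le> P * (?j R * (\<integral>x. f x * indicator R x \<partial>M))" if R: "R \<in> S" for R
  proof -
    let ?u = "setmax a {R'\<in>S. R \<subseteq> R'}" and ?v = "setmax a {R'\<in>S. R \<subset> R'}"
    have uv: "0 \<le> ?v" "?v \<le> ?u" using S by (auto intro!: setmax_nonneg setmax_mono)
    show ?thesis
    proof (cases "?v = ?u")
      case True
      then show ?thesis by (simp add: increment_def)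
    next
      case False
      then have u: "?u = a R" using setmax_strict_supersets[OF S(1) R] by blast
      have "measure M R * ?i R \<le> measure M R * (P * ?u * ?j R)"
        unfolding increment_def P_def using uv p
        by (intro mult_left_mono powr_diff_doob) auto
      also have "\<dots> = P * (?j R * (measure M R * a R))"
        by (simp add: u)
      also have "measure M R * a R = (\<integral>x. f x * indicator R x \<partial>M)"
        using a[OF R] pos[OF R] by simp
      finally show ?thesis .
    qed
  qed
  have fh: "f x * h x powr (p - 1) = (\<Sum>R\<in>S. ?j R * (f x * indicator R x))" for x
  proof -
    have "(\<Sum>R\<in>S. ?j R * (f x * indicator R x)) = f x * (\<Sum>R\<in>S. ?j R * indicator R x)"
      by (simp add: sum_distrib_left mult_ac)
    then show ?thesis
      using sum_increment_at[OF S, of "\<lambda>T. setmax a T powr (p - 1)" x] by (simp add: h_def)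
  qed
  have int_fh: "integrable M (\<lambda>x. f x * h x powr (p - 1))"
    unfolding fh using int_f by (intro Bochner_Integration.integrable_sum integrable_mult_right) auto
  \<comment> \<open>Integrability of \<open>h powr p\<close> makes the later absorption legitimate;
    it holds because \<open>h\<close> is a step function carried by finitely many sets of finite
    measure.\<close>
  have int_h: "integrable M (\<lambda>x. h x powr p)"
    and N: "(\<Sum>R\<in>S. measure M R * ?i R) = (\<integral>x. h x powr p \<partial>M)"
    unfolding h_def using S sets fin by (auto intro!: sum_measure_increment)
  have "(\<Sum>R\<in>S. measure M R * ?i R) \<le> (\<Sum>R\<in>S. P * (?j R * (\<integral>x. f x * indicator R x \<partial>M)))"
    by (intro sum_mono step)
  also have "\<dots> = P * (\<integral>x. f x * h x powr (p - 1) \<partial>M)"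
    unfolding fh using int_f
    by (subst Bochner_Integration.integral_sum) (auto simp: sum_distrib_left)
  also have "\<dots> = (\<integral>x. P * (f x * h x powr (p - 1)) \<partial>M)" by simp
  also have "\<dots> \<le> (\<integral>x. h x powr p / 2 + (2 * P) powr p * f x powr p \<partial>M)"
  proof (rule integral_mono)
    \<comment> \<open>The threshold \<open>h = 2 * P * f\<close> is chosen so that above it
      \<open>P * f\<close> is less than \<open>h / 2\<close>, while below it a power of
      \<open>f\<close> controls everything. This is the origin of the factors \<open>2\<close> in
      the bound.\<close>
    fix x
    show "P * (f x * h x powr (p - 1)) \<le> h x powr p / 2 + (2 * P) powr p * f x powr p"
    proof (cases "h x \<le> 2 * P * f x")
      case True
      have "P * (f x * h x powr (p - 1)) \<le> (2 * P * f x) * (2 * P * f x) powr (p - 1)"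
      proof -
        have "h x powr (p - 1) \<le> (2 * P * f x) powr (p - 1)"
          using True h0[of x] p by (intro powr_mono2) auto
        then have "P * f x * h x powr (p - 1) \<le> (2 * P * f x) * (2 * P * f x) powr (p - 1)"
          using f(2)[of x] P by (intro mult_mono) auto
        then show ?thesis by (simp add: mult_ac)
      qed
      also have "\<dots> = (2 * P) powr p * f x powr p"
      proof (cases "f x = 0")
        case False
        then have "(2 * P * f x) * (2 * P * f x) powr (p - 1) = (2 * P * f x) powr p"
          using P f(2)[of x] by (simp add: powr_mult_base)
        then show ?thesis using P f(2)[of x] by (simp add: powr_mult)
      qed simp
      finally show ?thesis by (simp add: add_increasing)
    next
      case False
      then have "P * f x * h x powr (p - 1) \<le> h x / 2 * h x powr (p - 1)"
        by (intro mult_right_mono) auto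
      also have "\<dots> = h x powr p / 2"
        using h0[of x] by (cases "h x = 0") (auto simp: powr_mult_base)
      finally show ?thesis by (simp add: mult_ac add_increasing2)
    qed
  qed (use int_fh int_h f in auto)
  also have "\<dots> = (\<integral>x. h x powr p \<partial>M) / 2 + (2 * P) powr p * (\<integral>x. f x powr p \<partial>M)"
    using int_h f by simp
  finally show ?thesis unfolding N P_def by simp
qed

subsection \<open>A Kolmogorov-type estimate\<close>

text \<open>With \<open>a Q = measure M Q / v Q\<close>, a jump of the maximum at \<open>R\<close>
  means \<open>v R = measure M R / a R\<close>, so the \<open>v\<close>-weighted increments of its
  \<open>\<theta>\<close>-th power turn into \<open>M\<close>-weighted decrements of its power
  \<open>\<theta> - 1\<close>. These telescope against a nonnegative integral, hence together amount
  to at most the contribution of the top set \<open>R0\<close>. The measure \<open>M\<close> enters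
  through additivity alone, so no Carleson constant of \<open>M\<close> appears.\<close>

lemma Kolmogorov_single:
  fixes v :: "'a set \<Rightarrow> real"
  assumes S: "finite S" "nested S" "{} \<notin> S" and \<theta>: "0 < \<theta>" "\<theta> < 1"
    and sets: "\<And>Q. Q \<in> S \<Longrightarrow> Q \<in> sets M" and fin: "\<And>Q. Q \<in> S \<Longrightarrow> emeasure M Q < \<infinity>"
    and pos: "\<And>Q. Q \<in> S \<Longrightarrow> 0 < measure M Q" "\<And>Q. Q \<in> S \<Longrightarrow> 0 < v Q"
    and R0: "R0 \<in> S" "\<And>Q. Q \<in> S \<Longrightarrow> Q \<subseteq> R0"
    and C: "\<And>R. R \<in> S \<Longrightarrow> (\<Sum>Q | Q \<in> S \<and> Q \<subseteq> R. v Q) \<le> \<Gamma> * v R" "0 \<le> \<Gamma>"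
  shows "(\<Sum>Q\<in>S. v Q * (measure M Q / v Q) powr \<theta>) \<le> \<Gamma> / (1 - \<theta>) * (v R0 * (measure M R0 / v R0) powr \<theta>)"
proof -
  define a where "a Q = measure M Q / v Q" for Q
  have a0: "0 < a Q" if "Q \<in> S" for Q using pos[OF that] by (simp add: a_def)
  \<comment> \<open>The exponent is negative, so \<open>G\<close> decreases along nonempty chains;
    but \<open>0 powr (\<theta> - 1) = 0\<close> makes \<open>G {} = 0\<close>, and its increment at
    \<open>R0\<close> is positive. This is why \<open>R0\<close> is split off below.\<close>
  define G where "G T = setmax a T powr (\<theta> - 1)" for T
  define \<kappa> where "\<kappa> = \<theta> / (1 - \<theta>)"
  have \<kappa>: "\<kappa> \<ge> 0" using \<theta> by (simp add: \<kappa>_def)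
  let ?i = "increment S (\<lambda>T. setmax a T powr \<theta>)"
  have sup0: "{R'\<in>S. R0 \<subset> R'} = {}" "{R'\<in>S. R0 \<subseteq> R'} = {R0}"
    using R0 by auto
  have m0: "setmax a {R0} = a R0"
    using a0[OF R0(1)] by (simp add: setmax_def)
  have i0: "?i R0 = a R0 powr \<theta>" and j0: "increment S G R0 = a R0 powr (\<theta> - 1)"
    using sup0 m0 by (simp_all only: increment_def G_def setmax_empty powr_0 diff_zero)
  have step: "v R * ?i R \<le> \<kappa> * (measure M R * (- increment S G R))" if R: "R \<in> S" "R \<noteq> R0" for R
  proof -
    let ?u = "setmax a {R'\<in>S. R \<subseteq> R'}" and ?w = "setmax a {R'\<in>S. R \<subset> R'}"
    have uw: "?w \<le> ?u" using S by (auto intro!: setmax_mono)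
    have "a R0 \<le> ?w" using R R0 S by (intro setmax_ge) auto
    then have w: "0 < ?w" using a0[OF R0(1)] by linarith
    show ?thesis
    proof (cases "?w = ?u")
      case True
      then show ?thesis by (simp add: increment_def G_def)
    next
      case False
      then have u: "?u = a R" using setmax_strict_supersets[OF S(1) R(1)] by blast
      have "v R * ?i R = measure M R * ((?u powr \<theta> - ?w powr \<theta>) / ?u)"
        unfolding increment_def u using pos[OF R(1)] by (simp add: a_def)
      also have "\<dots> \<le> measure M R * (\<kappa> * (?w powr (\<theta> - 1) - ?u powr (\<theta> - 1)))"
        unfolding \<kappa>_def using uw w \<theta> by (intro mult_left_mono powr_diff_kolmogorov) auto
      finally show ?thesis by (simp add: increment_def G_def mult_ac)
    qed
  qed
  have "(\<Sum>R\<in>S. measure M R * increment S G R) = (\<integral>x. G {R\<in>S. x \<in> R} \<partial>M)"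
    using S sets fin by (intro sum_measure_increment) (auto simp: G_def)
  \<comment> \<open>Nonnegativity of \<open>G\<close> says that, in the \<open>M\<close>-weighted
    sum, the total decrease below \<open>R0\<close> is at most the increase at
    \<open>R0\<close>.\<close>
  also have "\<dots> \<ge> 0" by (simp add: G_def)
  finally have "0 \<le> (\<Sum>R\<in>S. measure M R * increment S G R)" .
  also have "\<dots> = measure M R0 * a R0 powr (\<theta> - 1) + (\<Sum>R\<in>S - {R0}. measure M R * increment S G R)"
    using S R0 j0 by (simp add: sum.remove)
  also have "measure M R0 * a R0 powr (\<theta> - 1) = v R0 * a R0 powr \<theta>"
  proof -
    have "a R0 powr \<theta> = a R0 * a R0 powr (\<theta> - 1)" using a0[OF R0(1)] by (simp add: powr_mult_base)
    then show ?thesis using pos[OF R0(1)] by (simp add: a_def)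
  qed
  finally have tel: "(\<Sum>R\<in>S - {R0}. measure M R * (- increment S G R)) \<le> v R0 * a R0 powr \<theta>"
    by (simp add: sum_negf)
  have "(\<Sum>Q\<in>S. v Q * a Q powr \<theta>) \<le> (\<Sum>Q\<in>S. v Q * setmax a {R\<in>S. Q \<subseteq> R} powr \<theta>)"
    using S \<theta> pos a0 by (intro sum_mono mult_left_mono powr_mono2 setmax_ge) (auto simp: less_imp_le)
  also have "\<dots> \<le> \<Gamma> * (\<Sum>R\<in>S. v R * ?i R)"
    using S C \<theta> by (intro Carleson_sum_le increment_powr_setmax_nonneg) auto
  also have "(\<Sum>R\<in>S. v R * ?i R) = v R0 * a R0 powr \<theta> + (\<Sum>R\<in>S - {R0}. v R * ?i R)"
    using S R0 i0 by (simp add: sum.remove)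
  also have "(\<Sum>R\<in>S - {R0}. v R * ?i R) \<le> \<kappa> * (\<Sum>R\<in>S - {R0}. measure M R * (- increment S G R))"
    unfolding sum_distrib_left using step by (intro sum_mono) auto
  also have "\<dots> \<le> \<kappa> * (v R0 * a R0 powr \<theta>)"
    using tel \<kappa> by (rule mult_left_mono)
  also have "v R0 * a R0 powr \<theta> + \<kappa> * (v R0 * a R0 powr \<theta>) = v R0 * a R0 powr \<theta> / (1 - \<theta>)"
    using \<theta> by (simp add: \<kappa>_def field_simps)
  finally show ?thesis
    using C(2) by (simp add: a_def mult_left_mono mult_ac)
qed

text \<open>Dividing the exponents by their sum \<open>m\<close> makes them add up to
  \<open>1\<close>, and the summand becomes \<open>v\<close> times powers of the two densities
  \<open>X\<close> and \<open>Y\<close>; the surplus \<open>m - 1 \<ge> 0\<close> is estimated by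
  monotonicity. Comparison with the values at \<open>R0\<close> splits the two densities into two
  applications of \<open>Kolmogorov_single\<close>, hence the factor \<open>2\<close>; the remaining
  factor is \<open>1 / (1 - \<theta>) = (x + y + z) / z\<close>.\<close>

lemma Kolmogorov_triple:
  fixes v :: "'a set \<Rightarrow> real"
  assumes S: "finite S" "nested S" "{} \<notin> S" and xyz: "0 < x" "0 < y" "0 < z" "1 \<le> x + y + z"
    and sets: "\<And>Q. Q \<in> S \<Longrightarrow> Q \<in> sets M" "\<And>Q. Q \<in> S \<Longrightarrow> Q \<in> sets N"
    and fin: "\<And>Q. Q \<in> S \<Longrightarrow> emeasure M Q < \<infinity>" "\<And>Q. Q \<in> S \<Longrightarrow> emeasure N Q < \<infinity>"
    and pos: "\<And>Q. Q \<in> S \<Longrightarrow> 0 < measure M Q" "\<And>Q. Q \<in> S \<Longrightarrow> 0 < measure N Q" "\<And>Q. Q \<in> S \<Longrightarrow> 0 < v Q"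
    and mono: "\<And>Q R. Q \<in> S \<Longrightarrow> R \<in> S \<Longrightarrow> Q \<subseteq> R \<Longrightarrow> v Q \<le> v R"
    and C: "\<And>R. R \<in> S \<Longrightarrow> (\<Sum>Q | Q \<in> S \<and> Q \<subseteq> R. v Q) \<le> \<Gamma> * v R" "0 \<le> \<Gamma>"
    and R0: "R0 \<in> S"
  shows "(\<Sum>Q | Q \<in> S \<and> Q \<subseteq> R0. v Q powr z * measure M Q powr x * measure N Q powr y)
     \<le> 2 * \<Gamma> * (x + y + z) / z * (v R0 powr z * measure M R0 powr x * measure N R0 powr y)"
proof -
  define m where "m = x + y + z"
  define x' y' z' where "x' = x / m" and "y' = y / m" and "z' = z / m"
  define \<theta> where "\<theta> = x' + y'"
  have m: "1 \<le> m" "0 < m" using xyz by (auto simp: m_def)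
  have z': "z' = 1 - \<theta>" using m by (simp add: \<theta>_def x'_def y'_def z'_def divide_simps) (simp add: m_def)
  have xy': "0 < x'" "0 < y'" "0 < z'" using xyz m by (auto simp: x'_def y'_def z'_def)
  then have \<theta>: "0 < \<theta>" "\<theta> < 1" using z' by (auto simp: \<theta>_def)
  define S0 where "S0 = {Q\<in>S. Q \<subseteq> R0}"
  have S0: "finite S0" "nested S0" "{} \<notin> S0" "R0 \<in> S0" "S0 \<subseteq> S" and S0R: "\<And>Q. Q \<in> S0 \<Longrightarrow> Q \<subseteq> R0"
    using S R0 by (auto simp: S0_def nested_def)
  have C0: "(\<Sum>Q | Q \<in> S0 \<and> Q \<subseteq> R. v Q) \<le> \<Gamma> * v R" if "R \<in> S0" for R
  proof -
    have "{Q. Q \<in> S0 \<and> Q \<subseteq> R} = {Q. Q \<in> S \<and> Q \<subseteq> R}" using that by (auto simp: S0_def)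
    then show ?thesis using C that S0 by auto
  qed
  define X Y where "X Q = measure M Q / v Q" and "Y Q = measure N Q / v Q" for Q
  have XY0: "0 < X Q" "0 < Y Q" "0 < v Q" if "Q \<in> S0" for Q
    using pos that S0 by (auto simp: X_def Y_def)
  define T where "T Q = v Q powr z' * measure M Q powr x' * measure N Q powr y'" for Q
  have T: "T Q = v Q * (X Q powr x' * Y Q powr y')" if "Q \<in> S0" for Q
  proof -
    have v: "0 < v Q" using pos that S0 by auto
    have "v Q powr z' = v Q / (v Q powr x' * v Q powr y')"
      using v by (simp add: z' \<theta>_def powr_diff powr_add)
    then show ?thesis using v pos that S0
      by (simp add: T_def X_def Y_def powr_divide)
  qed
  have single: "(\<Sum>Q\<in>S0. v Q * (measure L Q / v Q) powr \<theta>) \<le> \<Gamma> / (1 - \<theta>) * (v R0 * (measure L R0 / v R0) powr \<theta>)"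
    if "\<And>Q. Q \<in> S \<Longrightarrow> Q \<in> sets L" "\<And>Q. Q \<in> S \<Longrightarrow> emeasure L Q < \<infinity>" "\<And>Q. Q \<in> S \<Longrightarrow> 0 < measure L Q" for L
    using S0 C0 S0R that pos(3) C(2) \<theta> by (intro Kolmogorov_single) auto
  have "T Q \<le> v Q * X Q powr \<theta> * (T R0 / (v R0 * X R0 powr \<theta>)) + v Q * Y Q powr \<theta> * (T R0 / (v R0 * Y R0 powr \<theta>))"
    if Q: "Q \<in> S0" for Q
  proof -
    \<comment> \<open>Normalising at \<open>R0\<close> makes the two densities comparable
      quantities, so that the larger can stand for both.\<close>
    define \<xi> \<zeta> where "\<xi> = X Q / X R0" and "\<zeta> = Y Q / Y R0"
    have pos': "0 < \<xi>" "0 < \<zeta>" using XY0 Q S0 by (auto simp: \<xi>_def \<zeta>_def)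
    have "\<xi> powr x' * \<zeta> powr y' \<le> max \<xi> \<zeta> powr x' * max \<xi> \<zeta> powr y'"
      using pos' xy' by (intro mult_mono powr_mono2) auto
    also have "\<dots> = max \<xi> \<zeta> powr \<theta>" by (simp add: \<theta>_def powr_add)
    also have "\<dots> \<le> \<xi> powr \<theta> + \<zeta> powr \<theta>" by (auto simp: max_def)
    finally have "v Q * (X R0 powr x' * Y R0 powr y') * (\<xi> powr x' * \<zeta> powr y')
        \<le> v Q * (X R0 powr x' * Y R0 powr y') * (\<xi> powr \<theta> + \<zeta> powr \<theta>)"
      using XY0[OF Q] by (intro mult_left_mono) auto
    also have "v Q * (X R0 powr x' * Y R0 powr y') * (\<xi> powr x' * \<zeta> powr y') = T Q"
      using XY0[OF Q] XY0[OF S0(4)] by (simp add: T[OF Q] \<xi>_def \<zeta>_def powr_divide)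
    also have "v Q * (X R0 powr x' * Y R0 powr y') * (\<xi> powr \<theta> + \<zeta> powr \<theta>)
        = v Q * X Q powr \<theta> * (T R0 / (v R0 * X R0 powr \<theta>)) + v Q * Y Q powr \<theta> * (T R0 / (v R0 * Y R0 powr \<theta>))"
      using XY0[OF Q] XY0[OF S0(4)] by (simp add: T[OF S0(4)] \<xi>_def \<zeta>_def powr_divide field_simps)
    finally show ?thesis .
  qed
  then have "(\<Sum>Q\<in>S0. T Q) \<le> (\<Sum>Q\<in>S0. v Q * X Q powr \<theta> * (T R0 / (v R0 * X R0 powr \<theta>))
      + v Q * Y Q powr \<theta> * (T R0 / (v R0 * Y R0 powr \<theta>)))"
    by (rule sum_mono)
  also have "\<dots> = (\<Sum>Q\<in>S0. v Q * X Q powr \<theta>) * (T R0 / (v R0 * X R0 powr \<theta>))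
      + (\<Sum>Q\<in>S0. v Q * Y Q powr \<theta>) * (T R0 / (v R0 * Y R0 powr \<theta>))"
    by (simp only: sum.distrib sum_distrib_right)
  also have "\<dots> \<le> \<Gamma> / (1 - \<theta>) * (v R0 * X R0 powr \<theta>) * (T R0 / (v R0 * X R0 powr \<theta>))
      + \<Gamma> / (1 - \<theta>) * (v R0 * Y R0 powr \<theta>) * (T R0 / (v R0 * Y R0 powr \<theta>))"
    using single[of M] single[of N] sets fin pos XY0[OF S0(4)]
    by (intro add_mono mult_right_mono) (auto simp: X_def Y_def T_def)
  also have "\<dots> = 2 * \<Gamma> / (1 - \<theta>) * T R0"
    using XY0[OF S0(4)] by simp
  finally have sumT: "(\<Sum>Q\<in>S0. T Q) \<le> 2 * \<Gamma> / (1 - \<theta>) * T R0" .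
  have Tm: "v Q powr z * measure M Q powr x * measure N Q powr y = T Q powr m" if "Q \<in> S" for Q
    using m pos[OF that] by (simp add: T_def powr_mult powr_powr x'_def y'_def z'_def)
  have T0: "0 \<le> T Q" if "Q \<in> S" for Q by (simp add: T_def)
  have Tmono: "T Q \<le> T R0" if "Q \<in> S0" for Q
  proof -
    have "measure M Q \<le> measure M R0"
      using that R0 S0 S0R sets fin by (intro measure_mono_fmeasurable) (auto simp: fmeasurable_def)
    moreover have "measure N Q \<le> measure N R0"
      using that R0 S0 S0R sets fin by (intro measure_mono_fmeasurable) (auto simp: fmeasurable_def)
    moreover have "v Q \<le> v R0" using mono that R0 S0 S0R by auto
    ultimately show ?thesis unfolding T_def using xy' XY0[OF that]
      by (intro mult_mono powr_mono2) auto
  qed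
  have powr_split: "t powr m = t * t powr (m - 1)" if "0 \<le> t" for t :: real
    using that m by (cases "t = 0") (auto simp: powr_mult_base)
  have "(\<Sum>Q | Q \<in> S \<and> Q \<subseteq> R0. v Q powr z * measure M Q powr x * measure N Q powr y) = (\<Sum>Q\<in>S0. T Q powr m)"
    using Tm by (auto intro!: sum.cong simp: S0_def)
  also have "\<dots> \<le> (\<Sum>Q\<in>S0. T Q * T R0 powr (m - 1))"
  proof (rule sum_mono)
    fix Q assume Q: "Q \<in> S0"
    then have "0 \<le> T Q" using T0 S0 by auto
    then show "T Q powr m \<le> T Q * T R0 powr (m - 1)"
      using Tmono[OF Q] m by (subst powr_split) (auto intro!: mult_left_mono powr_mono2)
  qed
  also have "\<dots> = (\<Sum>Q\<in>S0. T Q) * T R0 powr (m - 1)"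
    by (simp add: sum_distrib_right)
  also have "\<dots> \<le> 2 * \<Gamma> / (1 - \<theta>) * T R0 * T R0 powr (m - 1)"
    using sumT by (intro mult_right_mono) auto
  also have "\<dots> = 2 * \<Gamma> / (1 - \<theta>) * T R0 powr m"
    using T0[OF R0] by (simp add: powr_split)
  also have "2 * \<Gamma> / (1 - \<theta>) = 2 * \<Gamma> * (x + y + z) / z"
    using z'[symmetric] xyz m by (simp add: z'_def m_def)
  finally show ?thesis by (simp add: Tm R0)
qed

subsection \<open>Geometry of dyadic grids\<close>

text \<open>The shift of a cube of side \<open>2 powi (- k)\<close> sums over the strictly finer
  scales, and \<open>2 powi (- j) < 2 powi (- k)\<close> is just \<open>k < j\<close>.\<close>

definition grid_shift :: "(int \<Rightarrow> real ^ 'n) \<Rightarrow> int \<Rightarrow> real ^ 'n" where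
  "grid_shift \<theta> k = (\<Sum>\<^sub>\<infinity>j\<in>{k<..}. 2 powi (- j) *\<^sub>R \<theta> j)"

definition grid_cube :: "(int \<Rightarrow> real ^ 'n) \<Rightarrow> int \<Rightarrow> int ^ 'n \<Rightarrow> (real ^ 'n) set" where
  "grid_cube \<theta> k m = {x. \<forall>i. 2 powi (- k) * of_int (m $ i) \<le> x $ i - grid_shift \<theta> k $ i \<and>
     x $ i - grid_shift \<theta> k $ i < 2 powi (- k) * (of_int (m $ i) + 1)}"

lemma shifted_grid_eq:
  fixes \<theta> :: "int \<Rightarrow> real ^ 'n"
  shows "shifted_grid \<theta> = {grid_cube \<theta> k m | k m. True}"
proof -
  have "{j. (2 :: real) powi (- j) < 2 powi (- k)} = {k<..}" for k :: int
    by (auto simp: powr_real_of_int'[symmetric])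
  moreover have "(\<lambda>x. x + c) ` dyadic_cube k m = {x. \<forall>i. 2 powi (- k) * of_int (m $ i) \<le> x $ i - c $ i \<and>
     x $ i - c $ i < 2 powi (- k) * (of_int (m $ i) + 1)}" for c k and m :: "int ^ 'n"
  proof safe
    fix x assume *: "\<forall>i. 2 powi (- k) * of_int (m $ i) \<le> x $ i - c $ i \<and>
     x $ i - c $ i < 2 powi (- k) * (of_int (m $ i) + 1)"
    show "x \<in> (\<lambda>x. x + c) ` dyadic_cube k m"
      by (rule image_eqI[of _ _ "x - c"]) (use * in \<open>auto simp: dyadic_cube_def\<close>)
  qed (auto simp: dyadic_cube_def)
  ultimately show ?thesis
    by (simp add: shifted_grid_def grid_cube_def grid_shift_def)
qed

lemma dyadic_grid_cases:
  assumes "is_dyadic_grid \<D>"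
  obtains \<theta> where "\<And>j i. \<theta> j $ i \<in> {0, 1}" "\<D> = {grid_cube \<theta> k m | k m. True}"
proof -
  \<comment> \<open>The standard grid is the one with zero shifts, so from here on every grid is
    treated as a shifted one.\<close>
  have "standard_grid = shifted_grid (\<lambda>_. 0 :: real ^ 'n)"
    by (simp add: standard_grid_def shifted_grid_def)
  with assms that show ?thesis
    unfolding is_dyadic_grid_def shifted_grid_eq[symmetric]
    by (metis insertCI zero_index)
qed

text \<open>
  No summability is needed here: the two index sets differ by a finite set, so either both series
  converge or both sums have the junk value \<open>0\<close>.
\<close>

lemma grid_shift_diff:
  fixes \<theta> :: "int \<Rightarrow> real ^ 'n"
  assumes \<theta>: "\<And>j i. \<theta> j $ i \<in> {0, 1}" and k: "k \<le> k'"
  shows "\<exists>z :: 'n \<Rightarrow> int. \<forall>i. grid_shift \<theta> k $ i = grid_shift \<theta> k' $ i + 2 powi (- k') * of_int (z i)"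
proof -
  let ?f = "\<lambda>j. 2 powi (- j) *\<^sub>R \<theta> j"
  have un: "{k<..} = {k<..k'} \<union> {k'<..}" using k by auto
  show ?thesis
  proof (cases "?f summable_on {k'<..}")
    case True
    have "grid_shift \<theta> k = (\<Sum>j\<in>{k<..k'}. ?f j) + grid_shift \<theta> k'"
      unfolding grid_shift_def un using True by (subst infsum_Un_disjoint) auto
    \<comment> \<open>For \<open>j \<le> k'\<close> the length \<open>2 powi (- j)\<close> is an
      integer multiple of \<open>2 powi (- k')\<close>; with
      \<open>\<theta> j $ i \<in> {0, 1}\<close> this makes the difference of the shifts a lattice
      vector of the finer grid.\<close>
    moreover have "(\<Sum>j\<in>{k<..k'}. ?f j) $ i
        = 2 powi (- k') * of_int (\<Sum>j\<in>{k<..k'}. 2 ^ nat (k' - j) * \<lfloor>\<theta> j $ i\<rfloor>)" for i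
    proof -
      have "2 powi (- j) * \<theta> j $ i = 2 powi (- k') * of_int (2 ^ nat (k' - j) * \<lfloor>\<theta> j $ i\<rfloor>)"
        if "j \<in> {k<..k'}" for j
      proof -
        have "(2::real) powi (- j) = 2 powi (- k') * 2 powi (k' - j)"
          by (simp flip: power_int_add)
        also have "(2::real) powi (k' - j) = 2 ^ nat (k' - j)"
          using that by (simp add: power_int_def)
        finally show ?thesis using \<theta>[of j i] by auto
      qed
      then have "(\<Sum>j\<in>{k<..k'}. 2 powi (- j) * \<theta> j $ i)
          = (\<Sum>j\<in>{k<..k'}. 2 powi (- k') * of_int (2 ^ nat (k' - j) * \<lfloor>\<theta> j $ i\<rfloor>))"
        by (rule sum.cong[OF refl])
      then show ?thesis by (simp add: sum_distrib_left)
    qed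
    ultimately show ?thesis by (auto simp del: of_int_sum)
  next
    case False
    then have "\<not> ?f summable_on {k<..}"
      using summable_on_subset_banach[of ?f "{k<..}" "{k'<..}"] k by auto
    with False have "grid_shift \<theta> k = 0" "grid_shift \<theta> k' = 0"
      by (auto simp: grid_shift_def infsum_not_exists)
    then show ?thesis by (intro exI[of _ "\<lambda>_. 0"]) auto
  qed
qed

text \<open>In units of the finer side and relative to the finer shift, both cubes depend on a point
  only through the integers \<open>\<lfloor>y x i\<rfloor>\<close>: the fine cube fixes them and the
  coarse one confines them to integer intervals. One common point therefore forces
  inclusion.\<close>

lemma grid_cube_nested:
  assumes \<theta>: "\<And>j i. \<theta> j $ i \<in> {0, 1}" and k: "k \<le> k'"
  shows "grid_cube \<theta> k m \<inter> grid_cube \<theta> k' m' = {} \<or> grid_cube \<theta> k' m' \<subseteq> grid_cube \<theta> k m"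
proof -
  obtain z where z: "\<And>i. grid_shift \<theta> k $ i = grid_shift \<theta> k' $ i + 2 powi (- k') * of_int (z i)"
    using grid_shift_diff[of \<theta>, OF \<theta> k] by auto
  define y where "y x i = (x $ i - grid_shift \<theta> k' $ i) / 2 powi (- k')" for x i
  define n where "n = (2::int) ^ nat (k' - k)"
  have "(2::real) powi (- k) = 2 powi (- k') * 2 powi (k' - k)"
    by (simp flip: power_int_add)
  also have "(2::real) powi (k' - k) = of_int n"
    using k by (simp add: power_int_def n_def)
  finally have n: "(2::real) powi (- k) = 2 powi (- k') * of_int n" .
  define e where "e = (2::real) powi (- k')"
  have pos: "0 < e" by (simp add: e_def)
  have fine: "x \<in> grid_cube \<theta> k' m' \<longleftrightarrow> (\<forall>i. \<lfloor>y x i\<rfloor> = m' $ i)" for x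
  proof -
    have "(e * of_int (m' $ i) \<le> t \<and> t < e * (of_int (m' $ i) + 1)) \<longleftrightarrow> \<lfloor>t / e\<rfloor> = m' $ i" for t i
      using pos by (simp add: floor_eq_iff le_divide_eq divide_less_eq mult.commute)
    then show ?thesis
      by (simp only: grid_cube_def mem_Collect_eq y_def e_def)
  qed
  have coarse: "x \<in> grid_cube \<theta> k m \<longleftrightarrow> (\<forall>i. n * m $ i + z i \<le> \<lfloor>y x i\<rfloor> \<and> \<lfloor>y x i\<rfloor> < n * (m $ i + 1) + z i)" for x
  proof -
    have "(2 powi (- k) * of_int (m $ i) \<le> x $ i - grid_shift \<theta> k $ i \<and>
       x $ i - grid_shift \<theta> k $ i < 2 powi (- k) * (of_int (m $ i) + 1))
      \<longleftrightarrow> of_int (n * m $ i + z i) \<le> y x i \<and> y x i < of_int (n * (m $ i + 1) + z i)" for i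
      using pos unfolding z n y_def e_def[symmetric]
      by (simp add: le_divide_eq divide_less_eq algebra_simps)
    then show ?thesis
      by (simp only: grid_cube_def mem_Collect_eq le_floor_iff floor_less_iff)
  qed
  show ?thesis
  proof (cases "grid_cube \<theta> k m \<inter> grid_cube \<theta> k' m' = {}")
    case False
    then obtain x0 where "\<And>i. \<lfloor>y x0 i\<rfloor> = m' $ i"
      "\<And>i. n * m $ i + z i \<le> \<lfloor>y x0 i\<rfloor> \<and> \<lfloor>y x0 i\<rfloor> < n * (m $ i + 1) + z i"
      using fine coarse by blast
    then show ?thesis using fine coarse by fastforce
  qed simp
qed

lemma dyadic_grid_nested:
  assumes "is_dyadic_grid \<D>"
  shows "nested \<D>"
proof -
  obtain \<theta> where \<theta>: "\<And>j i. \<theta> j $ i \<in> {0, 1}" and \<D>: "\<D> = {grid_cube \<theta> k m | k m. True}"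
    using dyadic_grid_cases[OF assms] by blast
  have "Q \<inter> R = {} \<or> Q \<subseteq> R \<or> R \<subseteq> Q" if QR: "Q \<in> \<D>" "R \<in> \<D>" for Q R
  proof -
    obtain k m k' m' where [simp]: "Q = grid_cube \<theta> k m" "R = grid_cube \<theta> k' m'"
      using QR unfolding \<D> by blast
    show ?thesis
      using grid_cube_nested[of \<theta> k k' m m', OF \<theta>] grid_cube_nested[of \<theta> k' k m' m, OF \<theta>]
      by (cases "k \<le> k'") auto
  qed
  then show ?thesis by (auto simp: nested_def)
qed

lemma dyadic_grid_countable:
  assumes "is_dyadic_grid \<D>"
  shows "countable \<D>"
proof -
  obtain \<theta> where \<D>: "\<D> = {grid_cube \<theta> k m | k m. True}"
    using dyadic_grid_cases[OF assms] by blast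
  have "\<D> = (\<lambda>(k, m). grid_cube \<theta> k m) ` UNIV" unfolding \<D> by auto
  then show ?thesis by simp
qed

lemma dyadic_cube_box:
  assumes "is_dyadic_grid \<D>" "Q \<in> \<D>"
  obtains a l where "0 < l" "Q = {x. \<forall>i. a $ i \<le> x $ i \<and> x $ i < a $ i + l}"
proof -
  obtain \<theta> k m where Q: "Q = grid_cube \<theta> k m"
    using dyadic_grid_cases[OF assms(1)] assms(2) by blast
  let ?l = "(2::real) powi (- k)"
  have "Q = {x. \<forall>i. (\<chi> i. grid_shift \<theta> k $ i + ?l * of_int (m $ i)) $ i \<le> x $ i \<and>
      x $ i < (\<chi> i. grid_shift \<theta> k $ i + ?l * of_int (m $ i)) $ i + ?l}"
    unfolding Q grid_cube_def by (auto simp: algebra_simps)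
  then show ?thesis by (rule that[rotated]) simp
qed

lemma dyadic_grid_cube:
  fixes Q :: "(real ^ 'n) set"
  assumes "is_dyadic_grid \<D>" "Q \<in> \<D>"
  shows "is_cube Q" "Q \<noteq> {}" "bounded Q" "Q \<in> sets lebesgue" "emeasure lebesgue Q < \<infinity>" "0 < vol Q"
proof -
  obtain a l where l: "0 < l" and Q: "Q = {x. \<forall>i. a $ i \<le> x $ i \<and> x $ i < a $ i + l}"
    using dyadic_cube_box[OF assms] by blast
  let ?b = "a + (\<chi> i. l)"
  show "is_cube Q"
    unfolding is_cube_def Q using l
    by (intro exI[of _ a] exI[of _ l] exI[of _ "\<lambda>i. {a $ i..<a $ i + l}"]) auto
  have "a \<in> Q" using l Q by simp
  then show "Q \<noteq> {}" by blast
  have sub: "box a ?b \<subseteq> Q" "Q \<subseteq> cbox a ?b"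
    unfolding Q by (auto simp: mem_box_cart less_imp_le)
  show bdd: "bounded Q" using sub bounded_subset bounded_cbox by blast
  have "Q = (\<Inter>i. {x. a $ i \<le> x $ i} \<inter> {x. x $ i < a $ i + l})" unfolding Q by auto
  moreover have "{x. a $ i \<le> x $ i} \<in> sets borel" for i
    by (intro borel_closed closed_halfspace_component_ge_cart)
  moreover have "{x. x $ i < a $ i + l} \<in> sets borel" for i
    by (intro borel_open open_halfspace_component_lt_cart)
  ultimately have "Q \<in> sets borel" by (auto intro!: sets.countable_INT')
  then show sets: "Q \<in> sets lebesgue" by auto
  show fin: "emeasure lebesgue Q < \<infinity>"
    using fmeasurableD2[OF bounded_set_imp_lmeasurable[OF bdd sets]] unfolding infinity_ennreal_def less_top .
  have "(a + (\<chi> i. l / 2)) \<in> box a ?b" using l by (simp add: mem_box_cart)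
  then have "\<not> negligible (box a ?b)" using open_not_negligible[OF open_box] by blast
  then have "\<not> negligible Q" using sub negligible_subset by blast
  moreover have "Q \<in> lmeasurable" using bounded_set_imp_lmeasurable[OF bdd sets] .
  ultimately show "0 < vol Q"
    using negligible_iff_measure0 zero_less_measure_iff by (metis measure_nonneg less_eq_real_def)
qed

subsection \<open>Weights as measures\<close>

definition wm :: "(real ^ 'n \<Rightarrow> real) \<Rightarrow> (real ^ 'n) measure" where
  "wm \<omega> = density lebesgue (\<lambda>x. ennreal (\<omega> x))"

text \<open>Local integrability gives measurability of the truncations to compact sets; the weight
  is their pointwise limit over growing balls.\<close>

lemma weight_measurable:
  fixes \<omega> :: "real ^ 'n \<Rightarrow> real"
  assumes "weight \<omega>"
  shows "\<omega> \<in> borel_measurable lebesgue"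
proof (rule borel_measurable_LIMSEQ_metric)
  fix n :: nat
  have "set_integrable lebesgue (cball 0 (real n)) \<omega>"
    using assms by (auto simp: weight_def)
  then show "(\<lambda>x. indicator (cball 0 (real n)) x *\<^sub>R \<omega> x) \<in> borel_measurable lebesgue"
    unfolding set_integrable_def by (rule borel_measurable_integrable)
next
  fix x :: "real ^ 'n"
  have "eventually (\<lambda>n. norm x \<le> real n) sequentially"
    using filterlim_real_sequentially unfolding filterlim_at_top by blast
  then have "eventually (\<lambda>n. indicator (cball 0 (real n)) x *\<^sub>R \<omega> x = \<omega> x) sequentially"
    by eventually_elim simp
  then show "(\<lambda>n. indicator (cball 0 (real n)) x *\<^sub>R \<omega> x) \<longlonglongrightarrow> \<omega> x"
    by (rule tendsto_eventually)
qed

lemma sets_wm [simp]: "sets (wm \<omega>) = sets lebesgue" and space_wm [simp]: "space (wm \<omega>) = UNIV"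
  by (simp_all add: wm_def)

lemma measurable_wm [simp]: "measurable (wm \<omega>) N = measurable lebesgue N"
  by (rule measurable_cong_sets) simp_all

lemma emeasure_wm:
  fixes \<omega> :: "real ^ 'n \<Rightarrow> real"
  assumes "weight \<omega>" "Q \<in> sets lebesgue"
  shows "emeasure (wm \<omega>) Q = wmeas \<omega> Q"
  unfolding wm_def wmeas_def using weight_measurable[OF assms(1)] assms(2)
  by (subst emeasure_density) auto

lemma nn_integral_wm:
  fixes \<omega> :: "real ^ 'n \<Rightarrow> real"
  assumes "weight \<omega>" "g \<in> borel_measurable lebesgue"
  shows "(\<integral>\<^sup>+x. g x \<partial>wm \<omega>) = (\<integral>\<^sup>+x. g x * ennreal (\<omega> x) \<partial>lebesgue)"
  unfolding wm_def using weight_measurable[OF assms(1)] assms(2)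
  by (subst nn_integral_density) (auto simp: mult.commute)

lemma wmeas_finite:
  fixes \<omega> :: "real ^ 'n \<Rightarrow> real"
  assumes "weight \<omega>" "bounded Q"
  shows "wmeas \<omega> Q < \<infinity>"
proof -
  have int: "integrable lebesgue (\<lambda>x. indicator (closure Q) x * \<omega> x)"
    using assms unfolding weight_def set_integrable_def by (auto simp: compact_closure)
  have "wmeas \<omega> Q \<le> (\<integral>\<^sup>+x. ennreal (norm (indicator (closure Q) x * \<omega> x)) \<partial>lebesgue)"
    unfolding wmeas_def using assms(1) closure_subset[of Q]
    by (intro nn_integral_mono) (auto simp: indicator_def weight_def)
  also have "\<dots> < \<infinity>" using int by (simp add: integrable_iff_bounded)
  finally show ?thesis .
qed

text \<open>The sets \<open>E Q\<close> are disjoint and contained in \<open>R\<close>. The constant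
  \<open>1 / \<eta>\<close> involves no weight, which keeps the Kolmogorov-type estimate free of
  A-infinity constants.\<close>

lemma sparse_volume_Carleson:
  fixes S :: "(real ^ 'n) set set"
  assumes sparse: "sparse_collection \<eta> S" and S: "finite S" "\<And>Q. Q \<in> S \<Longrightarrow> Q \<in> lmeasurable" and R: "R \<in> lmeasurable"
  shows "(\<Sum>Q | Q \<in> S \<and> Q \<subseteq> R. vol Q) \<le> 1 / \<eta> * vol R"
proof -
  obtain E where \<eta>: "\<eta> > 0" and dis: "disjoint_family_on E S"
    and E: "\<And>Q. Q \<in> S \<Longrightarrow> E Q \<in> sets lebesgue" "\<And>Q. Q \<in> S \<Longrightarrow> E Q \<subseteq> Q" "\<And>Q. Q \<in> S \<Longrightarrow> \<eta> * vol Q \<le> vol (E Q)"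
    using sparse unfolding sparse_collection_def by blast
  let ?S = "{Q\<in>S. Q \<subseteq> R}"
  have EL: "E Q \<in> lmeasurable" if "Q \<in> S" for Q
    using fmeasurableI2[OF S(2)[OF that] E(2)[OF that] E(1)[OF that]] .
  have "\<eta> * (\<Sum>Q\<in>?S. vol Q) \<le> (\<Sum>Q\<in>?S. vol (E Q))"
    unfolding sum_distrib_left using E by (intro sum_mono) auto
  also have "\<dots> = vol (\<Union>Q\<in>?S. E Q)"
    using S EL dis by (intro measure_UNION'[symmetric]) (auto simp: disjoint_family_on_def pairwise_def disjnt_def)
  also have "\<dots> \<le> vol R"
  proof (rule measure_mono_fmeasurable)
    show "(\<Union>Q\<in>?S. E Q) \<subseteq> R" using E(2) by blast
  qed (use R S E in auto)
  finally show ?thesis using \<eta> by (simp add: field_simps)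
qed

text \<open>On \<open>Q\<close> the maximal function is at least the average over \<open>Q\<close>
  itself. The bound makes the Carleson constants positive, so that their products and powers can be
  handled in the reals.\<close>

lemma Ainf_const_ge_1:
  fixes \<omega> :: "real ^ 'n \<Rightarrow> real" and Q :: "(real ^ 'n) set"
  assumes "Ainf_weight \<omega>" "is_cube Q" "bounded Q" "Q \<in> lmeasurable" "0 < vol Q"
  shows "1 \<le> Ainf_const \<omega>"
proof -
  have \<omega>: "weight \<omega>" "0 < wmeas \<omega> Q" using assms by (auto simp: Ainf_weight_def)
  have fin: "wmeas \<omega> Q < \<infinity>" using wmeas_finite \<omega> assms by blast
  have avg: "(\<integral>\<^sup>+y\<in>Q. ennreal \<bar>indicator Q y * \<omega> y\<bar> \<partial>lebesgue) = wmeas \<omega> Q"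
    unfolding wmeas_def using \<omega> by (intro nn_integral_cong) (auto simp: indicator_def weight_def)
  have "maximal_fun (\<lambda>y. indicator Q y * \<omega> y) x \<ge> wmeas \<omega> Q / ennreal (vol Q)" if "x \<in> Q" for x
    unfolding maximal_fun_def avg[symmetric] using assms that by (intro SUP_upper) auto
  then have "(\<integral>\<^sup>+x\<in>Q. maximal_fun (\<lambda>y. indicator Q y * \<omega> y) x \<partial>lebesgue)
      \<ge> (\<integral>\<^sup>+x\<in>Q. wmeas \<omega> Q / ennreal (vol Q) \<partial>lebesgue)"
    by (intro nn_integral_mono) (auto simp: indicator_def)
  moreover have "(\<integral>\<^sup>+x\<in>Q. wmeas \<omega> Q / ennreal (vol Q) \<partial>lebesgue) = wmeas \<omega> Q"
  proof -
    have "(\<integral>\<^sup>+x\<in>Q. wmeas \<omega> Q / ennreal (vol Q) \<partial>lebesgue) = wmeas \<omega> Q / ennreal (vol Q) * emeasure lebesgue Q"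
      using assms by (intro nn_integral_cmult_indicator fmeasurableD)
    also have "\<dots> = wmeas \<omega> Q / ennreal (vol Q) * ennreal (vol Q)"
      using assms by (simp add: emeasure_eq_measure2)
    also have "\<dots> = wmeas \<omega> Q * (ennreal (vol Q) / ennreal (vol Q))"
      by (rule ennreal_divide_times)
    also have "\<dots> = wmeas \<omega> Q"
      using assms by (simp add: divide_ennreal)
    finally show ?thesis .
  qed
  ultimately have "wmeas \<omega> Q \<le> (\<integral>\<^sup>+x\<in>Q. maximal_fun (\<lambda>y. indicator Q y * \<omega> y) x \<partial>lebesgue)" by simp
  then have "wmeas \<omega> Q / wmeas \<omega> Q \<le> (\<integral>\<^sup>+x\<in>Q. maximal_fun (\<lambda>y. indicator Q y * \<omega> y) x \<partial>lebesgue) / wmeas \<omega> Q"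
    by (rule divide_right_mono_ennreal)
  also have "\<dots> \<le> Ainf_const \<omega>"
    unfolding Ainf_const_def using assms by (intro SUP_upper) auto
  finally show ?thesis using \<omega> fin by (simp add: ennreal_divide_self)
qed

text \<open>Sparseness trades \<open>measure (wm \<omega>) Q\<close> for its density times the
  volume of \<open>E Q\<close>, and on \<open>E Q\<close> this density is at most the maximal
  function of \<omega> restricted to \<open>R\<close>. As the \<open>E Q\<close> are disjoint
  subsets of \<open>R\<close>, the sum is bounded by the integral in the definition of
  \<open>Ainf_const\<close>.\<close>

lemma Ainf_Carleson:
  fixes \<omega> :: "real ^ 'n \<Rightarrow> real" and S :: "(real ^ 'n) set set"
  assumes A: "Ainf_weight \<omega>" and sparse: "sparse_collection \<eta> S" and S: "finite S"
    and cubes: "\<And>Q. Q \<in> S \<Longrightarrow> is_cube Q" "\<And>Q. Q \<in> S \<Longrightarrow> Q \<in> lmeasurable" "\<And>Q. Q \<in> S \<Longrightarrow> bounded Q" "\<And>Q. Q \<in> S \<Longrightarrow> 0 < vol Q"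
    and R: "R \<in> S"
  shows "(\<Sum>Q | Q \<in> S \<and> Q \<subseteq> R. measure (wm \<omega>) Q) \<le> enn2real (Ainf_const \<omega>) / \<eta> * measure (wm \<omega>) R"
proof -
  obtain E where \<eta>: "\<eta> > 0" and dis: "disjoint_family_on E S"
    and E: "\<And>Q. Q \<in> S \<Longrightarrow> E Q \<in> sets lebesgue" "\<And>Q. Q \<in> S \<Longrightarrow> E Q \<subseteq> Q" "\<And>Q. Q \<in> S \<Longrightarrow> \<eta> * vol Q \<le> vol (E Q)"
    using sparse unfolding sparse_collection_def by blast
  let ?S = "{Q\<in>S. Q \<subseteq> R}"
  let ?M = "maximal_fun (\<lambda>y. indicator R y * \<omega> y)"
  have \<omega>: "weight \<omega>" and pos: "\<And>Q. Q \<in> S \<Longrightarrow> 0 < wmeas \<omega> Q" and Afin: "Ainf_const \<omega> < \<infinity>"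
    using A cubes by (auto simp: Ainf_weight_def)
  have fin: "wmeas \<omega> Q < \<infinity>" if "Q \<in> S" for Q using wmeas_finite \<omega> cubes that by blast
  have meas: "ennreal (measure (wm \<omega>) Q) = wmeas \<omega> Q" if "Q \<in> S" for Q
    using emeasure_wm[OF \<omega>, of Q] cubes that fin[OF that]
    by (metis emeasure_eq_ennreal_measure fmeasurableD infinity_ennreal_def less_irrefl)
  define c where "c Q = measure (wm \<omega>) Q / vol Q" for Q
  have c: "ennreal (c Q) = wmeas \<omega> Q / ennreal (vol Q)" if "Q \<in> S" for Q
    unfolding c_def meas[OF that, symmetric] using cubes(4)[OF that] by (simp add: divide_ennreal)
  have EL: "E Q \<in> lmeasurable" if "Q \<in> S" for Q
    using fmeasurableI2[OF cubes(2)[OF that] E(2)[OF that] E(1)[OF that]] .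
  have ptw: "(\<Sum>Q\<in>?S. ennreal (c Q) * indicator (E Q) x) \<le> ?M x * indicator R x" for x
  proof (cases "\<exists>Q0\<in>?S. x \<in> E Q0")
    case True
    then obtain Q0 where Q0: "Q0 \<in> ?S" "x \<in> E Q0" by blast
    have "(\<Sum>Q\<in>?S. ennreal (c Q) * indicator (E Q) x) = (\<Sum>Q\<in>?S. if Q = Q0 then ennreal (c Q0) else 0)"
    proof (rule sum.cong)
      fix Q assume "Q \<in> ?S"
      then have "x \<notin> E Q" if "Q \<noteq> Q0"
        using dis Q0 that unfolding disjoint_family_on_def by blast
      then show "ennreal (c Q) * indicator (E Q) x = (if Q = Q0 then ennreal (c Q0) else 0)"
        using Q0 by auto
    qed simp
    also have "\<dots> = wmeas \<omega> Q0 / ennreal (vol Q0)" using S Q0 c by simp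
    also have "wmeas \<omega> Q0 = (\<integral>\<^sup>+y\<in>Q0. ennreal \<bar>indicator R y * \<omega> y\<bar> \<partial>lebesgue)"
      unfolding wmeas_def using \<omega> Q0 by (intro nn_integral_cong) (auto simp: indicator_def weight_def)
    also have "\<dots> / ennreal (vol Q0) \<le> ?M x"
    proof -
      have "x \<in> Q0" "is_cube Q0" using Q0 cubes(1) E(2)[of Q0] by auto
      then show ?thesis unfolding maximal_fun_def by (intro SUP_upper) auto
    qed
    finally have "(\<Sum>Q\<in>?S. ennreal (c Q) * indicator (E Q) x) \<le> ?M x" .
    moreover have "x \<in> R" using Q0 E(2) by blast
    ultimately show ?thesis by simp
  next
    case False
    then have "(\<Sum>Q\<in>?S. ennreal (c Q) * indicator (E Q) x) = 0" by (intro sum.neutral) auto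
    then show ?thesis by simp
  qed
  have "ennreal (\<eta> * (\<Sum>Q\<in>?S. measure (wm \<omega>) Q)) \<le> ennreal (\<Sum>Q\<in>?S. c Q * vol (E Q))"
  proof (rule ennreal_leI)
    have "\<eta> * measure (wm \<omega>) Q \<le> c Q * vol (E Q)" if "Q \<in> S" for Q
      using mult_left_mono[OF E(3)[OF that], of "c Q"] cubes(4)[OF that] by (simp add: c_def mult.commute)
    then show "\<eta> * (\<Sum>Q\<in>?S. measure (wm \<omega>) Q) \<le> (\<Sum>Q\<in>?S. c Q * vol (E Q))"
      unfolding sum_distrib_left by (intro sum_mono) auto
  qed
  also have "\<dots> = (\<Sum>Q\<in>?S. ennreal (c Q) * emeasure lebesgue (E Q))"
  proof -
    have "ennreal (\<Sum>Q\<in>?S. c Q * vol (E Q)) = (\<Sum>Q\<in>?S. ennreal (c Q * vol (E Q)))"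
      by (rule sum_ennreal[symmetric]) (simp add: c_def)
    also have "\<dots> = (\<Sum>Q\<in>?S. ennreal (c Q) * emeasure lebesgue (E Q))"
    proof (rule sum.cong)
      fix Q assume "Q \<in> ?S"
      moreover have "0 \<le> c Q" by (simp add: c_def)
      ultimately show "ennreal (c Q * vol (E Q)) = ennreal (c Q) * emeasure lebesgue (E Q)"
        using EL[of Q] by (simp add: ennreal_mult emeasure_eq_measure2)
    qed simp
    finally show ?thesis .
  qed
  also have "\<dots> = (\<integral>\<^sup>+x. (\<Sum>Q\<in>?S. ennreal (c Q) * indicator (E Q) x) \<partial>lebesgue)"
    using E by (subst nn_integral_sum) (auto simp: nn_integral_cmult_indicator)
  also have "\<dots> \<le> (\<integral>\<^sup>+x\<in>R. ?M x \<partial>lebesgue)"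
    by (intro nn_integral_mono ptw)
  \<comment> \<open>Dividing and multiplying back in \<open>ennreal\<close> relies on
    \<open>wmeas \<omega> R\<close> being positive and finite.\<close>
  also have "\<dots> = (\<integral>\<^sup>+x\<in>R. ?M x \<partial>lebesgue) / wmeas \<omega> R * wmeas \<omega> R"
    unfolding ennreal_divide_times using pos[OF R] fin[OF R] by (simp add: ennreal_divide_self)
  also have "\<dots> \<le> Ainf_const \<omega> * wmeas \<omega> R"
    unfolding Ainf_const_def using cubes R by (intro mult_right_mono SUP_upper) auto
  also have "\<dots> = ennreal (enn2real (Ainf_const \<omega>) * measure (wm \<omega>) R)"
    using Afin meas[OF R] by (simp add: ennreal_mult)
  finally have "\<eta> * (\<Sum>Q\<in>?S. measure (wm \<omega>) Q) \<le> enn2real (Ainf_const \<omega>) * measure (wm \<omega>) R"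
    by (subst (asm) ennreal_le_iff) auto
  then show ?thesis using \<eta> by (simp add: field_simps)
qed

subsection \<open>The bilinear form over finite sparse families\<close>

text \<open>Of the dyadic grid only nestedness and the geometry of single cubes are retained. All
  assumptions pass to subfamilies, so every estimate below also applies on level sets of the
  characteristic.\<close>

locale finite_sparse =
  fixes \<eta> :: real and S :: "(real ^ 'n) set set" and \<omega> \<sigma> :: "real ^ 'n \<Rightarrow> real"
  assumes finite_S: "finite S" and nested_S: "nested S"
    and cube: "Q \<in> S \<Longrightarrow> is_cube Q" and ne: "{} \<notin> S" and bdd: "Q \<in> S \<Longrightarrow> bounded Q"
    and sets_S: "Q \<in> S \<Longrightarrow> Q \<in> sets lebesgue" and vol_pos: "Q \<in> S \<Longrightarrow> 0 < vol Q"
    and sparse: "sparse_collection \<eta> S"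
    and Ainf_\<omega>: "Ainf_weight \<omega>" and Ainf_\<sigma>: "Ainf_weight \<sigma>"
begin

abbreviation "s \<equiv> measure (wm \<sigma>)"
abbreviation "w \<equiv> measure (wm \<omega>)"

lemma subfamily:
  assumes "T \<subseteq> S"
  shows "finite_sparse \<eta> T \<omega> \<sigma>"
proof
  show "nested T" using nested_S assms unfolding nested_def by blast
  show "sparse_collection \<eta> T"
    using sparse assms unfolding sparse_collection_def disjoint_family_on_def by (meson subsetD)
qed (use assms finite_S cube ne bdd sets_S vol_pos Ainf_\<omega> Ainf_\<sigma> in \<open>auto intro: finite_subset\<close>)

lemma \<eta>_pos: "0 < \<eta>"
  using sparse by (simp add: sparse_collection_def)

lemma weights: "weight \<omega>" "weight \<sigma>"
  using Ainf_\<omega> Ainf_\<sigma> by (auto simp: Ainf_weight_def)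

lemma lmeas: "Q \<in> S \<Longrightarrow> Q \<in> lmeasurable"
  using bounded_set_imp_lmeasurable bdd sets_S by blast

lemma emeasure_fin:
  assumes "Q \<in> S"
  shows "emeasure (wm \<sigma>) Q < \<infinity>" "emeasure (wm \<omega>) Q < \<infinity>"
  using wmeas_finite[of _ Q] weights bdd[OF assms] emeasure_wm[OF _ sets_S[OF assms]] by auto

lemma wmeas_eq:
  assumes "Q \<in> S"
  shows "wmeas \<sigma> Q = ennreal (s Q)" "wmeas \<omega> Q = ennreal (w Q)"
  using emeasure_fin[OF assms] emeasure_wm[OF weights(1) sets_S[OF assms]] emeasure_wm[OF weights(2) sets_S[OF assms]]
  by (metis emeasure_eq_ennreal_measure infinity_ennreal_def less_irrefl)+

lemma pos:
  assumes "Q \<in> S"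
  shows "0 < s Q" "0 < w Q"
proof -
  have "0 < wmeas \<sigma> Q" "0 < wmeas \<omega> Q"
    using Ainf_\<omega> Ainf_\<sigma> cube[OF assms] by (auto simp: Ainf_weight_def)
  then show "0 < s Q" "0 < w Q" using wmeas_eq[OF assms] by auto
qed

lemma mono:
  assumes "Q \<in> S" "R \<in> S" "Q \<subseteq> R"
  shows "s Q \<le> s R" "w Q \<le> w R" "vol Q \<le> vol R"
proof -
  show "s Q \<le> s R" "w Q \<le> w R"
    using assms emeasure_fin[OF assms(2)] sets_S[OF assms(1)] sets_S[OF assms(2)]
    by (auto intro!: measure_mono_fmeasurable simp: fmeasurable_def)
  show "vol Q \<le> vol R"
    using assms sets_S lmeas by (intro measure_mono_fmeasurable) auto
qed

definition "\<Gamma>\<sigma> = enn2real (Ainf_const \<sigma>) / \<eta>"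
definition "\<Gamma>\<omega> = enn2real (Ainf_const \<omega>) / \<eta>"

lemma Ainf_const_eq:
  assumes "S \<noteq> {}"
  shows "Ainf_const \<sigma> = ennreal (enn2real (Ainf_const \<sigma>))" "1 \<le> enn2real (Ainf_const \<sigma>)"
    and "Ainf_const \<omega> = ennreal (enn2real (Ainf_const \<omega>))" "1 \<le> enn2real (Ainf_const \<omega>)"
proof -
  obtain Q where Q: "Q \<in> S" using assms by blast
  have ge: "1 \<le> Ainf_const \<sigma>" "1 \<le> Ainf_const \<omega>"
    using Ainf_const_ge_1[OF _ cube[OF Q] bdd[OF Q] lmeas[OF Q] vol_pos[OF Q]] Ainf_\<omega> Ainf_\<sigma> by auto
  show eq: "Ainf_const \<sigma> = ennreal (enn2real (Ainf_const \<sigma>))" "Ainf_const \<omega> = ennreal (enn2real (Ainf_const \<omega>))"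
    using Ainf_\<omega> Ainf_\<sigma> by (auto simp: Ainf_weight_def)
  show "1 \<le> enn2real (Ainf_const \<sigma>)" "1 \<le> enn2real (Ainf_const \<omega>)"
    using ge by (metis eq ennreal_1 ennreal_le_iff enn2real_nonneg)+
qed

lemma \<Gamma>_pos:
  assumes "S \<noteq> {}"
  shows "0 < \<Gamma>\<sigma>" "0 < \<Gamma>\<omega>"
  using Ainf_const_eq[OF assms] \<eta>_pos by (auto simp: \<Gamma>\<sigma>_def \<Gamma>\<omega>_def)

lemma Carleson:
  assumes "R \<in> S"
  shows "(\<Sum>Q | Q \<in> S \<and> Q \<subseteq> R. s Q) \<le> \<Gamma>\<sigma> * s R" "(\<Sum>Q | Q \<in> S \<and> Q \<subseteq> R. w Q) \<le> \<Gamma>\<omega> * w R"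
  unfolding \<Gamma>\<sigma>_def \<Gamma>\<omega>_def
  by (rule Ainf_Carleson[OF _ sparse finite_S]; use cube lmeas bdd vol_pos assms Ainf_\<omega> Ainf_\<sigma> in auto)+

definition avg\<sigma> :: "(real ^ 'n \<Rightarrow> real) \<Rightarrow> (real ^ 'n) set \<Rightarrow> real" where
  "avg\<sigma> f Q = (\<integral>x. f x * indicator Q x \<partial>wm \<sigma>) / s Q"

definition avg\<omega> :: "(real ^ 'n \<Rightarrow> real) \<Rightarrow> (real ^ 'n) set \<Rightarrow> real" where
  "avg\<omega> f Q = (\<integral>x. f x * indicator Q x \<partial>wm \<omega>) / w Q"

lemma Doob:
  assumes "1 < p" "f \<in> borel_measurable lebesgue" "\<And>x. 0 \<le> f x"
  shows "integrable (wm \<sigma>) (\<lambda>x. f x powr p) \<Longrightarrow>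
      (\<Sum>R\<in>S. s R * increment S (\<lambda>T. setmax (avg\<sigma> f) T powr p) R)
        \<le> 2 * (2 * conj_exp p) powr p * (\<integral>x. f x powr p \<partial>wm \<sigma>)"
    and "integrable (wm \<omega>) (\<lambda>x. f x powr p) \<Longrightarrow>
      (\<Sum>R\<in>S. w R * increment S (\<lambda>T. setmax (avg\<omega> f) T powr p) R)
        \<le> 2 * (2 * conj_exp p) powr p * (\<integral>x. f x powr p \<partial>wm \<omega>)"
  using assms pos emeasure_fin sets_S finite_S nested_S
  by (auto intro!: Doob_maximal simp: avg\<sigma>_def avg\<omega>_def)

lemma avg_nonneg:
  assumes "\<And>x. 0 \<le> f x"
  shows "0 \<le> avg\<sigma> f Q" "0 \<le> avg\<omega> f Q"
  using assms by (auto simp: avg\<sigma>_def avg\<omega>_def intro!: divide_nonneg_nonneg integral_nonneg)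

definition char :: "real \<Rightarrow> real \<Rightarrow> real \<Rightarrow> (real ^ 'n) set \<Rightarrow> real" where
  "char p q \<alpha> Q = vol Q powr (- \<alpha>) * w Q powr (1 / q) * s Q powr (1 / conj_exp p)"

text \<open>The power \<open>r\<close> is included so that the \<open>r\<close>-th power of the
  operator is a linear combination of indicators with these coefficients.\<close>

definition coeff :: "real \<Rightarrow> real \<Rightarrow> (real ^ 'n \<Rightarrow> real) \<Rightarrow> (real ^ 'n) set \<Rightarrow> real" where
  "coeff r \<alpha> f Q = (vol Q powr (- \<alpha>) * (\<integral>x. f x * indicator Q x \<partial>wm \<sigma>)) powr r"

lemma char_pos: "Q \<in> S \<Longrightarrow> 0 < char p q \<alpha> Q"
  using pos[of Q] vol_pos[of Q] by (simp add: char_def)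

text \<open>Splitting \<open>r = r / conj_exp p + r / p\<close> for \<sigma> and
  \<open>1 = r / q + (1 - r / q)\<close> for \<omega> isolates the characteristic and leaves the
  exponents \<open>x = r / p\<close> and \<open>1 - y = 1 - r / q\<close>.\<close>

lemma coeff_eq:
  assumes Q: "Q \<in> S" and f: "\<And>x. 0 \<le> f x" and "1 < p" "0 < q" "0 < r"
  shows "coeff r \<alpha> f Q * w Q = char p q \<alpha> Q powr r * (s Q powr (r / p) * w Q powr (1 - r / q) * avg\<sigma> f Q powr r)"
proof -
  have p: "1 / conj_exp p * r + r / p = r" using assms(3) by (simp add: conj_exp_def field_simps)
  have "coeff r \<alpha> f Q = (vol Q powr (- \<alpha>) * (s Q * avg\<sigma> f Q)) powr r"
    using pos[OF Q] by (simp add: coeff_def avg\<sigma>_def)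
  also have "\<dots> = (vol Q powr (- \<alpha>)) powr r * s Q powr r * avg\<sigma> f Q powr r"
    using pos[OF Q] avg_nonneg[OF f] by (simp add: powr_mult)
  also have "s Q powr r = s Q powr (1 / conj_exp p * r) * s Q powr (r / p)"
    by (simp only: p flip: powr_add)
  finally have 1: "coeff r \<alpha> f Q = (vol Q powr (- \<alpha>)) powr r * (s Q powr (1 / conj_exp p * r) * s Q powr (r / p)) * avg\<sigma> f Q powr r" .
  have "w Q = w Q powr (1 / q * r) * w Q powr (1 - r / q)"
    using pos[OF Q] by (simp flip: powr_add)
  then have "coeff r \<alpha> f Q * w Q = coeff r \<alpha> f Q * (w Q powr (1 / q * r) * w Q powr (1 - r / q))" by simp
  also have "\<dots> = char p q \<alpha> Q powr r * (s Q powr (r / p) * w Q powr (1 - r / q) * avg\<sigma> f Q powr r)"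
    unfolding 1 char_def using pos[OF Q] by (simp add: powr_mult powr_powr mult_ac)
  finally show ?thesis .
qed

lemma form_eq:
  assumes Q: "Q \<in> S" and f: "\<And>x. 0 \<le> f x" and "1 < p" "0 < q" "0 < r"
  shows "coeff r \<alpha> f Q * (\<integral>x. g x * indicator Q x \<partial>wm \<omega>)
     = char p q \<alpha> Q powr r * (s Q powr (r / p) * w Q powr (1 - r / q) * (avg\<sigma> f Q powr r * avg\<omega> g Q))"
proof -
  have "coeff r \<alpha> f Q * (\<integral>x. g x * indicator Q x \<partial>wm \<omega>) = coeff r \<alpha> f Q * w Q * avg\<omega> g Q"
    using pos[OF Q] by (simp add: avg\<omega>_def)
  then show ?thesis unfolding coeff_eq[OF assms] by (simp only: mult_ac)
qed

text \<open>For \<open>p = q = r\<close> the exponent \<open>1 - r / q\<close> of \<omega> vanishes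
  and the dual exponent \<open>1 / (1 - r / q)\<close> degenerates. The sum then involves averages
  of \<open>f\<close> alone, and one Carleson embedding for \<sigma> followed by Doob's inequality
  bounds it.\<close>

lemma diagonal_end_bound:
  assumes A: "\<And>Q. Q \<in> S \<Longrightarrow> char p p \<alpha> Q \<le> A" and p: "1 < p" and S: "S \<noteq> {}"
    and f: "f \<in> borel_measurable lebesgue" "\<And>x. 0 \<le> f x" "integrable (wm \<sigma>) (\<lambda>x. f x powr p)"
      "(\<integral>x. f x powr p \<partial>wm \<sigma>) \<le> 1"
  shows "(\<Sum>Q\<in>S. coeff p \<alpha> f Q * w Q) \<le> A powr p * (\<Gamma>\<sigma> * (2 * (2 * conj_exp p) powr p))"
proof -
  let ?N = "2 * (2 * conj_exp p) powr p"
  have N: "(\<Sum>R\<in>S. s R * increment S (\<lambda>T. setmax (avg\<sigma> f) T powr p) R) \<le> ?N"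
    using Doob(1)[OF p f(1-3)] f(4) mult_left_mono[OF f(4), of ?N] by simp
  have "(\<Sum>Q\<in>S. coeff p \<alpha> f Q * w Q) = (\<Sum>Q\<in>S. char p p \<alpha> Q powr p * (s Q * avg\<sigma> f Q powr p))"
  proof (rule sum.cong)
    fix Q assume Q: "Q \<in> S"
    show "coeff p \<alpha> f Q * w Q = char p p \<alpha> Q powr p * (s Q * avg\<sigma> f Q powr p)"
      using coeff_eq[OF Q f(2) p, of p p \<alpha>] p pos[OF Q] by simp
  qed simp
  also have "\<dots> \<le> (\<Sum>Q\<in>S. A powr p * (s Q * setmax (avg\<sigma> f) {R\<in>S. Q \<subseteq> R} powr p))"
    using A char_pos p finite_S avg_nonneg[OF f(2)]
    by (intro sum_mono mult_mono powr_mono2 setmax_ge) (auto simp: less_imp_le)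
  also have "\<dots> = A powr p * (\<Sum>Q\<in>S. s Q * setmax (avg\<sigma> f) {R\<in>S. Q \<subseteq> R} powr p)"
    by (simp add: sum_distrib_left)
  also have "\<dots> \<le> A powr p * (\<Gamma>\<sigma> * ?N)"
    using finite_S nested_S ne p N Carleson \<Gamma>_pos[OF S]
    by (intro mult_left_mono Carleson_setmax_sum) auto
  finally show ?thesis .
qed

lemma diagonal_form_bound:
  assumes A: "\<And>Q. Q \<in> S \<Longrightarrow> char p p \<alpha> Q \<le> A" and p: "1 < p" and r: "0 < r" "r < p" and S: "S \<noteq> {}"
    and f: "f \<in> borel_measurable lebesgue" "\<And>x. 0 \<le> f x" "integrable (wm \<sigma>) (\<lambda>x. f x powr p)"
      "(\<integral>x. f x powr p \<partial>wm \<sigma>) \<le> 1"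
    and g: "g \<in> borel_measurable lebesgue" "\<And>x. 0 \<le> g x" "integrable (wm \<omega>) (\<lambda>x. g x powr (1 / (1 - r / p)))"
  shows "(\<Sum>Q\<in>S. coeff r \<alpha> f Q * (\<integral>x. g x * indicator Q x \<partial>wm \<omega>))
    \<le> A powr r * ((\<Gamma>\<sigma> * (2 * (2 * conj_exp p) powr p)) powr (r / p) *
        (\<Gamma>\<omega> * (2 * (2 * conj_exp (1 / (1 - r / p))) powr (1 / (1 - r / p))
          * (\<integral>x. g x powr (1 / (1 - r / p)) \<partial>wm \<omega>))) powr (1 - r / p))"
proof -
  let ?N = "2 * (2 * conj_exp p) powr p"
  have x: "0 < r / p" "r / p < 1" using p r by auto
  then have "1 < 1 / (1 - r / p)" by simp
  note M = Doob(2)[OF this g(1,2,3)]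
  have N: "(\<Sum>R\<in>S. s R * increment S (\<lambda>T. setmax (avg\<sigma> f) T powr p) R) \<le> ?N"
    using Doob(1)[OF p f(1-3)] f(4) mult_left_mono[OF f(4), of ?N] by simp
  have "(\<Sum>Q\<in>S. coeff r \<alpha> f Q * (\<integral>x. g x * indicator Q x \<partial>wm \<omega>))
      = (\<Sum>Q\<in>S. char p p \<alpha> Q powr r * (s Q powr (r / p) * w Q powr (1 - r / p) * (avg\<sigma> f Q powr r * avg\<omega> g Q)))"
    using p r f(2) by (intro sum.cong form_eq) auto
  also have "\<dots> \<le> (\<Sum>Q\<in>S. A powr r * (s Q powr (r / p) * w Q powr (1 - r / p) * (avg\<sigma> f Q powr r * avg\<omega> g Q)))"
    using A char_pos r avg_nonneg[OF f(2)] avg_nonneg[OF g(2)]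
    by (intro sum_mono mult_right_mono powr_mono2) (auto simp: less_imp_le)
  also have "\<dots> = A powr r * (\<Sum>Q\<in>S. s Q powr (r / p) * w Q powr (1 - r / p) * (avg\<sigma> f Q powr (r / p * p) * avg\<omega> g Q))"
    using p by (simp add: sum_distrib_left)
  also have "\<dots> \<le> A powr r * ((\<Gamma>\<sigma> * ?N) powr (r / p) *
      (\<Gamma>\<omega> * (2 * (2 * conj_exp (1 / (1 - r / p))) powr (1 / (1 - r / p))
          * (\<integral>x. g x powr (1 / (1 - r / p)) \<partial>wm \<omega>))) powr (1 - r / p))"
    by (rule mult_left_mono[OF bilinear_Hoelder])
      (use finite_S nested_S ne x p pos N M Carleson \<Gamma>_pos[OF S] avg_nonneg[OF f(2)] avg_nonneg[OF g(2)] in auto)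
  finally show ?thesis .
qed

text \<open>
  On a level set of the characteristic, \<open>vol Q powr \<alpha>\<close> is comparable to a geometric mean of the two
  weights; trading an \<open>\<epsilon>\<close> of it produces the positive power of the volume that
  the Kolmogorov-type estimate requires.
\<close>

lemma level_Carleson:
  assumes pq: "1 < p" "1 < q" and xy: "0 < x" "0 < y'"
    and \<epsilon>: "0 < \<epsilon>" "\<epsilon> / conj_exp p < x" "\<epsilon> / q < y'" "1 \<le> (x - \<epsilon> / conj_exp p) + (y' - \<epsilon> / q) + \<alpha> * \<epsilon>" and \<alpha>: "0 < \<alpha>"
    and B: "\<And>Q. Q \<in> S \<Longrightarrow> B \<le> char p q \<alpha> Q" "\<And>Q. Q \<in> S \<Longrightarrow> char p q \<alpha> Q \<le> 2 * B" "0 < B"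
    and R: "R \<in> S"
  shows "(\<Sum>Q | Q \<in> S \<and> Q \<subseteq> R. s Q powr x * w Q powr y')
     \<le> 2 powr \<epsilon> * (2 * (1 / \<eta>) * (x - \<epsilon> / conj_exp p + (y' - \<epsilon> / q) + \<alpha> * \<epsilon>) / (\<alpha> * \<epsilon>)) * (s R powr x * w R powr y')"
proof -
  define C where "C = 2 * (1 / \<eta>) * (x - \<epsilon> / conj_exp p + (y' - \<epsilon> / q) + \<alpha> * \<epsilon>) / (\<alpha> * \<epsilon>)"
  have P: "0 < conj_exp p" using pq by (simp add: conj_exp_def)
  define u where "u Q = vol Q powr (\<alpha> * \<epsilon>) * s Q powr (x - \<epsilon> / conj_exp p) * w Q powr (y' - \<epsilon> / q)" for Q
  have eq: "s Q powr x * w Q powr y' = char p q \<alpha> Q powr \<epsilon> * u Q" if Q: "Q \<in> S" for Q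
  proof -
    have "char p q \<alpha> Q powr \<epsilon> * u Q = (vol Q powr (- \<alpha> * \<epsilon>) * vol Q powr (\<alpha> * \<epsilon>))
       * (s Q powr (\<epsilon> / conj_exp p) * s Q powr (x - \<epsilon> / conj_exp p))
       * (w Q powr (\<epsilon> / q) * w Q powr (y' - \<epsilon> / q))"
      using pos[OF Q] vol_pos[OF Q] by (simp add: char_def u_def powr_mult powr_powr mult_ac)
    also have "\<dots> = s Q powr x * w Q powr y'"
      unfolding powr_add[symmetric] using vol_pos[OF Q] by simp
    finally show ?thesis by simp
  qed
  have u0: "0 \<le> u Q" for Q by (simp add: u_def)
  have C0: "0 \<le> C"
    using \<epsilon> \<alpha> \<eta>_pos unfolding C_def by (intro divide_nonneg_pos mult_nonneg_nonneg) auto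
  have "(\<Sum>Q | Q \<in> S \<and> Q \<subseteq> R. s Q powr x * w Q powr y') = (\<Sum>Q | Q \<in> S \<and> Q \<subseteq> R. char p q \<alpha> Q powr \<epsilon> * u Q)"
    by (intro sum.cong) (auto simp: eq)
  also have "\<dots> \<le> (\<Sum>Q | Q \<in> S \<and> Q \<subseteq> R. (2 * B) powr \<epsilon> * u Q)"
    using B \<epsilon> u0 char_pos by (intro sum_mono mult_right_mono powr_mono2) (auto simp: less_imp_le)
  also have "\<dots> = (2 * B) powr \<epsilon> * (\<Sum>Q | Q \<in> S \<and> Q \<subseteq> R. u Q)"
    by (simp add: sum_distrib_left)
  also have "\<dots> \<le> (2 * B) powr \<epsilon> * (C * u R)"
  proof (rule mult_left_mono)
    show "(\<Sum>Q | Q \<in> S \<and> Q \<subseteq> R. u Q) \<le> C * u R"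
      unfolding u_def C_def
    proof (rule Kolmogorov_triple)
      \<comment> \<open>The Carleson set function \<open>v\<close> is the volume; the two weights
        play the part of the measures \<open>M\<close> and \<open>N\<close>.\<close>
      show "(\<Sum>Q | Q \<in> S \<and> Q \<subseteq> R'. vol Q) \<le> 1 / \<eta> * vol R'" if "R' \<in> S" for R'
        using sparse_volume_Carleson[OF sparse finite_S lmeas lmeas] that by blast
    qed (use finite_S nested_S ne \<epsilon> \<alpha> sets_S emeasure_fin pos vol_pos mono \<eta>_pos R in auto)
  qed simp
  also have "\<dots> = 2 powr \<epsilon> * C * (B powr \<epsilon> * u R)"
    using B(3) by (simp add: powr_mult)
  also have "\<dots> \<le> 2 powr \<epsilon> * C * (char p q \<alpha> R powr \<epsilon> * u R)"
    using B \<epsilon> u0 C0 R by (intro mult_left_mono mult_right_mono powr_mono2) auto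
  finally show ?thesis unfolding eq[OF R] C_def .
qed

text \<open>Every dyadic level set of the characteristic is charged the full norms of
  \<open>f\<close> and \<open>g\<close>. This is affordable because level \<open>k\<close> carries
  the factor \<open>2 powr (k * r)\<close>, and these factors sum geometrically to a multiple of
  \<open>A powr r\<close>.\<close>

lemma level_form_bound:
  assumes pq: "1 < p" "p \<le> q" and r: "0 < r" "r \<le> p" "r < q" and S: "S \<noteq> {}"
    and \<epsilon>: "0 < \<epsilon>" "\<epsilon> / conj_exp p < r / p" "\<epsilon> / q < 1 - r / q"
      "1 \<le> (r / p - \<epsilon> / conj_exp p) + (1 - r / q - \<epsilon> / q) + \<alpha> * \<epsilon>" and \<alpha>: "0 < \<alpha>"
    and A: "\<And>Q. Q \<in> S \<Longrightarrow> char p q \<alpha> Q \<le> A"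
    and f: "f \<in> borel_measurable lebesgue" "\<And>x. 0 \<le> f x" "integrable (wm \<sigma>) (\<lambda>x. f x powr p)"
      "(\<integral>x. f x powr p \<partial>wm \<sigma>) \<le> 1"
    and g: "g \<in> borel_measurable lebesgue" "\<And>x. 0 \<le> g x" "integrable (wm \<omega>) (\<lambda>x. g x powr (1 / (1 - r / q)))"
    and D: "D = 2 powr \<epsilon> * (2 * (1 / \<eta>) * (r / p - \<epsilon> / conj_exp p + (1 - r / q - \<epsilon> / q) + \<alpha> * \<epsilon>) / (\<alpha> * \<epsilon>))"
  shows "(\<Sum>Q\<in>S. coeff r \<alpha> f Q * (\<integral>x. g x * indicator Q x \<partial>wm \<omega>))
    \<le> 2 powr r / (1 - 2 powr (- r)) * D * A powr r *
       ((\<Gamma>\<sigma> powr (r / q) + \<Gamma>\<omega> powr (1 - r / p)) * (2 * (2 * conj_exp p) powr p) powr (r / p)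
       * (2 * (2 * conj_exp (1 / (1 - r / q))) powr (1 / (1 - r / q))
          * (\<integral>x. g x powr (1 / (1 - r / q)) \<partial>wm \<omega>)) powr (1 - r / q))"
proof -
  define N where "N = 2 * (2 * conj_exp p) powr p"
  define M where "M = 2 * (2 * conj_exp (1 / (1 - r / q))) powr (1 / (1 - r / q))
          * (\<integral>x. g x powr (1 / (1 - r / q)) \<partial>wm \<omega>)"
  define X where "X = (\<Gamma>\<sigma> powr (r / q) + \<Gamma>\<omega> powr (1 - r / p)) * N powr (r / p) * M powr (1 - r / q)"
  define lev where "lev Q = \<lfloor>log 2 (char p q \<alpha> Q)\<rfloor>" for Q
  have x: "0 < r / q" "r / q \<le> r / p" "r / p \<le> 1" "r / q < 1" using pq r by (auto simp: frac_le)
  then have q': "1 < 1 / (1 - r / q)" by simp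
  have D0: "0 \<le> D"
    using \<epsilon> \<alpha> \<eta>_pos unfolding D by (intro divide_nonneg_pos mult_nonneg_nonneg) auto
  have X0: "0 \<le> X" by (simp add: X_def)
  have Apos: "0 < A" using S A char_pos by (meson ex_in_conv less_le_trans)
  have level: "(\<Sum>Q\<in>{Q\<in>S. lev Q = k}. coeff r \<alpha> f Q * (\<integral>x. g x * indicator Q x \<partial>wm \<omega>))
      \<le> 2 powr r * D * X * 2 powr (of_int k * r)" for k
  proof -
    define B where "B = (2::real) powr of_int k"
    let ?T = "{Q\<in>S. lev Q = k}"
    \<comment> \<open>The level set has the same \<open>\<Gamma>\<sigma>\<close> and
      \<open>\<Gamma>\<omega>\<close> as \<open>S\<close>, since these depend on the weights and
      \<eta> alone.\<close>
    interpret T: finite_sparse \<eta> ?T \<omega> \<sigma> by (rule subfamily) auto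
    have B: "B \<le> char p q \<alpha> Q" "char p q \<alpha> Q \<le> 2 * B" if "Q \<in> ?T" for Q
    proof -
      have c: "0 < char p q \<alpha> Q" using that char_pos by auto
      have "of_int k \<le> log 2 (char p q \<alpha> Q)" "log 2 (char p q \<alpha> Q) \<le> of_int k + 1"
        using that by (auto simp: lev_def)
      then have "2 powr of_int k \<le> 2 powr (log 2 (char p q \<alpha> Q))"
        "2 powr (log 2 (char p q \<alpha> Q)) \<le> 2 powr (of_int k + 1)"
        by (auto intro!: powr_mono)
      then show "B \<le> char p q \<alpha> Q" "char p q \<alpha> Q \<le> 2 * B"
        using c by (simp_all add: B_def powr_add)
    qed
    have Bpos: "0 < B" by (simp add: B_def)
    have Nk: "(\<Sum>R\<in>?T. s R * increment ?T (\<lambda>T. setmax (avg\<sigma> f) T powr p) R) \<le> N"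
      using T.Doob(1)[OF pq(1) f(1-3)] f(4) mult_left_mono[OF f(4), of N] by (simp add: N_def)
    have Mk: "(\<Sum>R\<in>?T. w R * increment ?T (\<lambda>T. setmax (avg\<omega> g) T powr (1 / (1 - r / q))) R) \<le> M"
      using T.Doob(2)[OF q' g(1-3)] by (simp add: M_def)
    have "(\<Sum>Q\<in>?T. coeff r \<alpha> f Q * (\<integral>x. g x * indicator Q x \<partial>wm \<omega>))
        = (\<Sum>Q\<in>?T. char p q \<alpha> Q powr r * (s Q powr (r / p) * w Q powr (1 - r / q) * (avg\<sigma> f Q powr r * avg\<omega> g Q)))"
      using pq r f(2) by (intro sum.cong form_eq) auto
    also have "\<dots> \<le> (\<Sum>Q\<in>?T. (2 * B) powr r * (s Q powr (r / p) * w Q powr (1 - r / q) * (avg\<sigma> f Q powr r * avg\<omega> g Q)))"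
      using B char_pos r avg_nonneg[OF f(2)] avg_nonneg[OF g(2)]
      by (intro sum_mono mult_right_mono powr_mono2) (auto simp: less_imp_le)
    also have "\<dots> = (2 * B) powr r * (\<Sum>Q\<in>?T. s Q powr (r / p) * w Q powr (1 - r / q) * (avg\<sigma> f Q powr (r / p * p) * avg\<omega> g Q))"
      using pq by (simp add: sum_distrib_left)
    also have "\<dots> \<le> (2 * B) powr r * (D * ((\<Gamma>\<sigma> powr (r / q) + \<Gamma>\<omega> powr (1 - r / p)) * N powr (r / p) * M powr (1 - r / q)))"
    proof (rule mult_left_mono[OF bilinear_Carleson])
      show "(\<Sum>Q | Q \<in> ?T \<and> Q \<subseteq> R. s Q powr (r / p) * w Q powr (1 - r / q))
          \<le> D * (s R powr (r / p) * w R powr (1 - r / q))" if "R \<in> ?T" for R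
        unfolding D using that B Bpos pq r x \<epsilon> \<alpha>
        by (intro T.level_Carleson[where B = B]) auto
    qed (use T.finite_S T.nested_S T.ne x pq T.pos T.mono Nk Mk T.Carleson \<Gamma>_pos[OF S] D0 avg_nonneg[OF f(2)] avg_nonneg[OF g(2)]
        in \<open>auto simp: T.\<Gamma>\<sigma>_def T.\<Gamma>\<omega>_def \<Gamma>\<sigma>_def \<Gamma>\<omega>_def\<close>)
    also have "\<dots> = 2 powr r * D * X * 2 powr (of_int k * r)"
      by (simp add: X_def B_def powr_mult powr_powr)
    finally show ?thesis .
  qed
  have "(\<Sum>Q\<in>S. coeff r \<alpha> f Q * (\<integral>x. g x * indicator Q x \<partial>wm \<omega>))
      = (\<Sum>k\<in>lev ` S. \<Sum>Q\<in>{Q\<in>S. lev Q = k}. coeff r \<alpha> f Q * (\<integral>x. g x * indicator Q x \<partial>wm \<omega>))"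
    using finite_S by (intro sum.group[symmetric]) auto
  also have "\<dots> \<le> (\<Sum>k\<in>lev ` S. 2 powr r * D * X * 2 powr (of_int k * r))"
    by (intro sum_mono level)
  also have "\<dots> = 2 powr r * D * X * (\<Sum>k\<in>lev ` S. 2 powr (of_int k * r))"
    by (simp add: sum_distrib_left)
  also have "\<dots> \<le> 2 powr r * D * X * (2 powr (log 2 A * r) / (1 - 2 powr (- r)))"
  proof (intro mult_left_mono sum_powr_two_le)
    fix k assume "k \<in> lev ` S"
    then obtain Q where Q: "Q \<in> S" "k = lev Q" by blast
    have "of_int k \<le> log 2 (char p q \<alpha> Q)" unfolding Q lev_def by simp
    also have "\<dots> \<le> log 2 A" using A[OF Q(1)] char_pos[OF Q(1)] Apos by simp
    finally show "of_int k \<le> log 2 A" .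
  qed (use finite_S r D0 X0 in auto)
  also have "2 powr (log 2 A * r) = A powr r"
    using Apos by (simp flip: powr_powr)
  finally show ?thesis by (simp add: X_def N_def M_def mult_ac)
qed

end

text \<open>With \<open>\<phi>\<close> the sum on the left, the form is tested against \<open>g = \<phi> powr (1 / y - 1)\<close>.\<close>

lemma norm_from_form:
  fixes a :: "'a set \<Rightarrow> real"
  assumes S: "finite S" "nested S" "\<And>Q. Q \<in> S \<Longrightarrow> Q \<in> sets M" "\<And>Q. Q \<in> S \<Longrightarrow> emeasure M Q < \<infinity>"
    and y: "0 < y" "y < 1" and a: "\<And>Q. Q \<in> S \<Longrightarrow> 0 \<le> a Q" and K: "0 \<le> K"
    and form: "\<And>g :: 'a \<Rightarrow> real. g \<in> borel_measurable M \<Longrightarrow> (\<And>x. 0 \<le> g x) \<Longrightarrow> integrable M (\<lambda>x. g x powr (1 / (1 - y))) \<Longrightarrow>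
       (\<Sum>Q\<in>S. a Q * (\<integral>x. g x * indicator Q x \<partial>M)) \<le> K * (\<integral>x. g x powr (1 / (1 - y)) \<partial>M) powr (1 - y)"
  shows "(\<integral>x. (\<Sum>Q\<in>S. a Q * indicator Q x) powr (1 / y) \<partial>M) powr y \<le> K"
proof -
  define \<phi> where "\<phi> x = (\<Sum>Q\<in>S. a Q * indicator Q x)" for x
  have \<phi>: "\<phi> x = sum a {R\<in>S. x \<in> R}" for x
    unfolding \<phi>_def using S by (simp add: sum.If_cases indicator_def Int_def cong: sum.cong)
  have \<phi>0: "0 \<le> \<phi> x" for x unfolding \<phi>_def using a by (intro sum_nonneg) auto
  define Y where "Y = (\<integral>x. \<phi> x powr (1 / y) \<partial>M)"
  define g where "g x = \<phi> x powr (1 / y - 1)" for x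
  have int: "integrable M (\<lambda>x. \<phi> x powr (1 / y))" and intg: "integrable M g"
    unfolding g_def \<phi> by (rule sum_measure_increment; use S in auto)+
  \<comment> \<open>The power \<open>1 / (1 - y)\<close> of \<open>g\<close> is again
    \<open>\<phi> powr (1 / y)\<close>, so both sides of the form bound become expressions in
    \<open>Y\<close>.\<close>
  have gy: "g x powr (1 / (1 - y)) = \<phi> x powr (1 / y)" for x
  proof -
    have "(1 / y - 1) * (1 / (1 - y)) = 1 / y" using y by (simp add: field_simps)
    then show ?thesis unfolding g_def powr_powr by simp
  qed
  have "\<phi> x powr (1 / y) = (\<Sum>Q\<in>S. a Q * (g x * indicator Q x))" for x
  proof -
    have "\<phi> x powr (1 / y) = \<phi> x * g x"
      using \<phi>0[of x] by (cases "\<phi> x = 0") (auto simp: g_def powr_mult_base)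
    also have "\<dots> = (\<Sum>Q\<in>S. a Q * indicator Q x * g x)"
      unfolding \<phi>_def by (rule sum_distrib_right)
    finally show ?thesis by (simp add: mult_ac)
  qed
  then have "Y = (\<integral>x. (\<Sum>Q\<in>S. a Q * (g x * indicator Q x)) \<partial>M)" by (simp add: Y_def)
  also have "\<dots> = (\<Sum>Q\<in>S. a Q * (\<integral>x. g x * indicator Q x \<partial>M))"
    using intg S by (subst Bochner_Integration.integral_sum) (auto intro!: integrable_mult_right integrable_real_mult_indicator)
  also have "\<dots> \<le> K * (\<integral>x. g x powr (1 / (1 - y)) \<partial>M) powr (1 - y)"
  proof (rule form)
    show "g \<in> borel_measurable M" using intg by (rule borel_measurable_integrable)
    show "integrable M (\<lambda>x. g x powr (1 / (1 - y)))" using int by (simp only: gy)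
  qed (simp add: g_def)
  finally have le: "Y \<le> K * Y powr (1 - y)" by (simp add: gy Y_def)
  \<comment> \<open>As \<open>int\<close> makes \<open>Y\<close> a genuine finite integral, a
    positive power of it may be cancelled; this is why the duality is carried out over finite
    families.\<close>
  have "Y powr y \<le> K"
  proof (cases "Y = 0")
    case False
    then have "0 < Y" by (simp add: Y_def order_less_le integral_nonneg)
    then have "Y = Y powr y * Y powr (1 - y)" by (simp flip: powr_add)
    with le \<open>0 < Y\<close> show ?thesis by (metis mult_le_cancel_right powr_gt_zero order_less_imp_not_less less_irrefl)
  qed (use K y in simp)
  then show ?thesis by (simp add: Y_def \<phi>_def)
qed

section \<open>Comparison of constants, and the operator norm over a finite family\<close>

lemma powr_interchange_le:
  fixes S W :: real
  assumes "0 < W" "W \<le> S" "a \<le> a'" "a + b = a' + b'"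
  shows "S powr a * W powr b \<le> S powr a' * W powr b'"
proof -
  have "b = b' + (a' - a)" using assms by simp
  then have "S powr a * W powr b = S powr a * W powr (a' - a) * W powr b'"
    by (simp add: powr_add mult_ac)
  also have "\<dots> \<le> S powr a * S powr (a' - a) * W powr b'"
    using assms by (intro mult_left_mono mult_right_mono powr_mono2) auto
  finally show ?thesis by (simp flip: powr_add)
qed

lemma sum_powr_le_powr_sum:
  fixes u :: "'b \<Rightarrow> real"
  assumes "finite I" "\<And>i. i \<in> I \<Longrightarrow> 0 \<le> u i" "1 \<le> t"
  shows "(\<Sum>i\<in>I. u i powr t) \<le> (\<Sum>i\<in>I. u i) powr t"
  using assms
proof (induction I)
  case (insert i I)
  have "0 \<le> sum u I" "0 \<le> u i" using insert.prems by (auto intro: sum_nonneg)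
  then have "(u i + sum u I - u i) powr t \<le> (u i + sum u I) powr t - u i powr t"
    using insert.prems by (intro powr_superadd) auto
  then show ?case using insert by force
qed simp

lemma powr_add_le:
  fixes u v t :: real
  assumes "0 \<le> u" "0 \<le> v" "0 < t"
  shows "(u + v) powr t \<le> 2 powr t * (u powr t + v powr t)"
proof -
  have "(u + v) powr t \<le> (2 * max u v) powr t" using assms by (intro powr_mono2) auto
  also have "\<dots> = 2 powr t * max u v powr t" using assms by (simp add: powr_mult)
  also have "\<dots> \<le> 2 powr t * (u powr t + v powr t)"
    by (intro mult_left_mono) (auto simp: max_def)
  finally show ?thesis .
qed

context finite_sparse
begin

definition K_real :: "real \<Rightarrow> real \<Rightarrow> real \<Rightarrow> real \<Rightarrow> real" where
  "K_real p q r \<alpha> =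
     (if p = q \<and> q > r \<and> \<alpha> < 1 then
        enn2real (Ainf_const \<omega>) powr (1 / r * (1 - r / p)\<^sup>2) * enn2real (Ainf_const \<sigma>) powr (1 / r * (1 - (1 - r / p)\<^sup>2))
        + enn2real (Ainf_const \<omega>) powr (1 / r * (1 - (r / p)\<^sup>2)) * enn2real (Ainf_const \<sigma>) powr (1 / r * (r / p)\<^sup>2)
      else
        enn2real (Ainf_const \<sigma>) powr (1 / q) + enn2real (Ainf_const \<omega>) powr (max (1 / r - 1 / p) 0))"

lemma K_real_nonneg: "0 \<le> K_real p q r \<alpha>"
  by (simp add: K_real_def)

definition op_norm :: "real \<Rightarrow> real \<Rightarrow> real \<Rightarrow> (real ^ 'n \<Rightarrow> real) \<Rightarrow> real" where
  "op_norm q r \<alpha> f = (\<integral>x. (\<Sum>Q\<in>S. coeff r \<alpha> f Q * indicator Q x) powr (q / r) \<partial>wm \<omega>) powr (1 / q)"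

lemma op_norm_le_of_form:
  assumes r: "0 < r" "r < q" and K: "0 \<le> K"
    and form: "\<And>g. g \<in> borel_measurable lebesgue \<Longrightarrow> (\<And>x. 0 \<le> g x) \<Longrightarrow> integrable (wm \<omega>) (\<lambda>x. g x powr (1 / (1 - r / q))) \<Longrightarrow>
       (\<Sum>Q\<in>S. coeff r \<alpha> f Q * (\<integral>x. g x * indicator Q x \<partial>wm \<omega>))
         \<le> K powr r * (\<integral>x. g x powr (1 / (1 - r / q)) \<partial>wm \<omega>) powr (1 - r / q)"
  shows "op_norm q r \<alpha> f \<le> K"
proof -
  have "(\<integral>x. (\<Sum>Q\<in>S. coeff r \<alpha> f Q * indicator Q x) powr (1 / (r / q)) \<partial>wm \<omega>) powr (r / q) \<le> K powr r"
    by (rule norm_from_form)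
      (use finite_S nested_S sets_S emeasure_fin r form in \<open>auto simp: coeff_def\<close>)
  then have "((\<integral>x. (\<Sum>Q\<in>S. coeff r \<alpha> f Q * indicator Q x) powr (q / r) \<partial>wm \<omega>) powr (r / q)) powr (1 / r) \<le> (K powr r) powr (1 / r)"
    using r by (intro powr_mono2) auto
  then show ?thesis using r K by (simp add: op_norm_def powr_powr)
qed

end

section \<open>Norm bounds over finite families in the three ranges of exponents\<close>

lemma finite_bound_diagonal_end:
  fixes p \<alpha> \<eta> :: real
  assumes p: "1 < p" and \<eta>: "0 < \<eta>"
  shows "\<exists>C>0. \<forall>(S :: (real ^ 'n) set set) \<omega> \<sigma> A f. finite_sparse \<eta> S \<omega> \<sigma> \<longrightarrow> S \<noteq> {} \<longrightarrow>
     (\<forall>Q\<in>S. finite_sparse.char \<omega> \<sigma> p p \<alpha> Q \<le> A) \<longrightarrow>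
     f \<in> borel_measurable lebesgue \<longrightarrow> (\<forall>x. 0 \<le> f x) \<longrightarrow> integrable (wm \<sigma>) (\<lambda>x. f x powr p) \<longrightarrow>
     (\<integral>x. f x powr p \<partial>wm \<sigma>) \<le> 1 \<longrightarrow>
     finite_sparse.op_norm S \<omega> \<sigma> p p \<alpha> f \<le> C * A * finite_sparse.K_real \<omega> \<sigma> p p p \<alpha>"
proof -
  define N where "N = 2 * (2 * conj_exp p) powr p"
  define C where "C = (N / \<eta>) powr (1 / p)"
  have N: "0 < N" using p by (simp add: N_def conj_exp_def)
  show ?thesis
  proof (intro exI[of _ C] conjI allI impI)
    show "0 < C" using N \<eta> by (simp add: C_def)
    fix S :: "(real ^ 'n) set set" and \<omega> \<sigma> A f
    assume "finite_sparse \<eta> S \<omega> \<sigma>"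
    then interpret finite_sparse \<eta> S \<omega> \<sigma> .
    assume S: "S \<noteq> {}" and A: "\<forall>Q\<in>S. char p p \<alpha> Q \<le> A"
      and f: "f \<in> borel_measurable lebesgue" "\<forall>x. 0 \<le> f x" "integrable (wm \<sigma>) (\<lambda>x. f x powr p)"
        "(\<integral>x. f x powr p \<partial>wm \<sigma>) \<le> 1"
    have A0: "0 < A" using S A char_pos by (meson ex_in_conv less_le_trans)
    let ?s = "enn2real (Ainf_const \<sigma>)"
    \<comment> \<open>The outer exponent is \<open>q / r = p / p = 1\<close>, so the
      \<open>p\<close>-th power of the norm is a plain sum over \<open>Q\<close>.\<close>
    have "(\<integral>x. (\<Sum>Q\<in>S. coeff p \<alpha> f Q * indicator Q x) powr (p / p) \<partial>wm \<omega>)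
        = (\<integral>x. (\<Sum>Q\<in>S. coeff p \<alpha> f Q * indicator Q x) \<partial>wm \<omega>)"
    proof -
      have "(\<Sum>Q\<in>S. coeff p \<alpha> f Q * indicator Q x) \<ge> 0" for x :: "real ^ 'n"
        by (intro sum_nonneg) (simp add: coeff_def)
      then show ?thesis using p by simp
    qed
    also have "\<dots> = (\<Sum>Q\<in>S. coeff p \<alpha> f Q * w Q)"
    proof (subst Bochner_Integration.integral_sum)
      fix Q assume Q: "Q \<in> S"
      then show "integrable (wm \<omega>) (\<lambda>x. coeff p \<alpha> f Q * indicator Q x)"
        using emeasure_fin[OF Q] sets_S[OF Q] by (intro integrable_mult_right integrable_real_indicator) auto
    qed (use sets_S in auto)
    also have "\<dots> \<le> A powr p * (\<Gamma>\<sigma> * N)"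
      unfolding N_def using A p S f by (intro diagonal_end_bound) auto
    finally have "op_norm p p \<alpha> f \<le> (A powr p * (\<Gamma>\<sigma> * N)) powr (1 / p)"
      unfolding op_norm_def using p by (intro powr_mono2 integral_nonneg) auto
    also have "\<dots> = C * A * ?s powr (1 / p)"
      using A0 N \<eta> p Ainf_const_eq[OF S] by (simp add: \<Gamma>\<sigma>_def C_def powr_mult powr_powr powr_divide)
    also have "\<dots> \<le> C * A * K_real p p p \<alpha>"
      using \<open>0 < C\<close> A0 by (intro mult_left_mono) (auto simp: K_real_def)
    finally show "op_norm p p \<alpha> f \<le> C * A * K_real p p p \<alpha>" .
  qed
qed

text \<open>Hoelder's bound carries the product of the two A-infinity constants with exponents
  \<open>x / r\<close> and \<open>(1 - x) / r\<close>. Moving part of an exponent from the smaller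
  constant to the larger one only increases a product, so one of the two terms of \<open>K\<close>
  dominates it; which one depends on which constant is larger.\<close>

lemma finite_bound_diagonal:
  fixes p r \<alpha> \<eta> :: real
  assumes p: "1 < p" and r: "0 < r" "r < p" and \<eta>: "0 < \<eta>" and \<alpha>: "\<alpha> < 1"
  shows "\<exists>C>0. \<forall>(S :: (real ^ 'n) set set) \<omega> \<sigma> A f. finite_sparse \<eta> S \<omega> \<sigma> \<longrightarrow> S \<noteq> {} \<longrightarrow>
     (\<forall>Q\<in>S. finite_sparse.char \<omega> \<sigma> p p \<alpha> Q \<le> A) \<longrightarrow>
     f \<in> borel_measurable lebesgue \<longrightarrow> (\<forall>x. 0 \<le> f x) \<longrightarrow> integrable (wm \<sigma>) (\<lambda>x. f x powr p) \<longrightarrow>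
     (\<integral>x. f x powr p \<partial>wm \<sigma>) \<le> 1 \<longrightarrow>
     finite_sparse.op_norm S \<omega> \<sigma> p r \<alpha> f \<le> C * A * finite_sparse.K_real \<omega> \<sigma> p p r \<alpha>"
proof -
  define x where "x = r / p"
  have x: "0 < x" "x < 1" using p r by (auto simp: x_def)
  define N where "N = 2 * (2 * conj_exp p) powr p"
  define M where "M = 2 * (2 * conj_exp (1 / (1 - x))) powr (1 / (1 - x))"
  define C where "C = ((N / \<eta>) powr x * (M / \<eta>) powr (1 - x)) powr (1 / r)"
  have N: "0 < N" using p by (simp add: N_def conj_exp_def)
  have "1 < 1 / (1 - x)" using x by simp
  then have "0 < conj_exp (1 / (1 - x))" unfolding conj_exp_def using x by (intro divide_pos_pos) auto
  then have M: "0 < M" by (simp add: M_def)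
  show ?thesis
  proof (intro exI[of _ C] conjI allI impI)
    show C: "0 < C" using N M \<eta> by (simp add: C_def)
    fix S :: "(real ^ 'n) set set" and \<omega> \<sigma> A f
    assume "finite_sparse \<eta> S \<omega> \<sigma>"
    then interpret finite_sparse \<eta> S \<omega> \<sigma> .
    assume S: "S \<noteq> {}" and A: "\<forall>Q\<in>S. char p p \<alpha> Q \<le> A"
      and f: "f \<in> borel_measurable lebesgue" "\<forall>x. 0 \<le> f x" "integrable (wm \<sigma>) (\<lambda>x. f x powr p)"
        "(\<integral>x. f x powr p \<partial>wm \<sigma>) \<le> 1"
    have A0: "0 < A" using S A char_pos by (meson ex_in_conv less_le_trans)
    define \<Sigma> where "\<Sigma> = enn2real (Ainf_const \<sigma>)"
    define \<Omega> where "\<Omega> = enn2real (Ainf_const \<omega>)"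
    have pos1: "0 < \<Sigma>" "0 < \<Omega>" using Ainf_const_eq[OF S] by (auto simp: \<Sigma>_def \<Omega>_def)
    define k where "k = \<Sigma> powr (1 / r * x) * \<Omega> powr (1 / r * (1 - x))"
    \<comment> \<open>The \<eta> inside \<open>\<Gamma>\<sigma>\<close> and
      \<open>\<Gamma>\<omega>\<close> is what divides \<open>N\<close> and \<open>M\<close> in
      \<open>C\<close>.\<close>
    have kr: "(C * A * k) powr r = A powr r * ((\<Gamma>\<sigma> * N) powr x * (\<Gamma>\<omega> * M) powr (1 - x))"
      using A0 N M \<eta> r pos1 unfolding C_def k_def \<Gamma>\<sigma>_def \<Gamma>\<omega>_def \<Sigma>_def[symmetric] \<Omega>_def[symmetric]
      by (simp add: powr_mult powr_powr powr_divide mult_ac)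
    have "op_norm p r \<alpha> f \<le> C * A * k"
    proof (rule op_norm_le_of_form)
      fix g :: "real ^ 'n \<Rightarrow> real"
      assume g: "g \<in> borel_measurable lebesgue" "\<And>x. 0 \<le> g x" "integrable (wm \<omega>) (\<lambda>x. g x powr (1 / (1 - r / p)))"
      let ?I = "\<integral>x. g x powr (1 / (1 - r / p)) \<partial>wm \<omega>"
      have I: "0 \<le> ?I" by simp
      have "(\<Sum>Q\<in>S. coeff r \<alpha> f Q * (\<integral>x. g x * indicator Q x \<partial>wm \<omega>))
        \<le> A powr r * ((\<Gamma>\<sigma> * N) powr (r / p) * (\<Gamma>\<omega> * (M * ?I)) powr (1 - r / p))"
        unfolding N_def M_def x_def using A p r S f g by (intro diagonal_form_bound) auto
      also have "(\<Gamma>\<omega> * (M * ?I)) powr (1 - r / p) = (\<Gamma>\<omega> * M) powr (1 - r / p) * ?I powr (1 - r / p)"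
        using \<Gamma>_pos[OF S] M I by (simp add: powr_mult mult_ac)
      finally show "(\<Sum>Q\<in>S. coeff r \<alpha> f Q * (\<integral>x. g x * indicator Q x \<partial>wm \<omega>))
         \<le> (C * A * k) powr r * ?I powr (1 - r / p)"
        unfolding kr by (simp add: x_def mult_ac)
    qed (use r C A0 in \<open>auto simp: k_def\<close>)
    \<comment> \<open>The exponent \<open>x\<close> of \<open>\<Sigma>\<close> lies between the exponents \<open>x\<^sup>2\<close> and \<open>1 - (1 - x)\<^sup>2\<close> of \<open>K\<close>.\<close>
    also have "k \<le> K_real p p r \<alpha>"
    proof (cases "\<Omega> \<le> \<Sigma>")
      case True
      have "k \<le> \<Sigma> powr (1 / r * (1 - (1 - x)\<^sup>2)) * \<Omega> powr (1 / r * (1 - x)\<^sup>2)"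
        unfolding k_def
      proof (rule powr_interchange_le)
        have "x \<le> 1 - (1 - x)\<^sup>2" using x mult_left_mono[of x 1 x] by (simp add: power2_eq_square algebra_simps)
        then show "1 / r * x \<le> 1 / r * (1 - (1 - x)\<^sup>2)" using r by (intro mult_left_mono) auto
        show "1 / r * x + 1 / r * (1 - x) = 1 / r * (1 - (1 - x)\<^sup>2) + 1 / r * (1 - x)\<^sup>2"
          unfolding distrib_left[symmetric] by simp
      qed (use True pos1 in auto)
      then show ?thesis
        using r \<alpha> by (simp add: K_real_def \<Sigma>_def[symmetric] \<Omega>_def[symmetric] x_def[symmetric] mult.commute add_increasing2)
    next
      case False
      have "\<Omega> powr (1 / r * (1 - x)) * \<Sigma> powr (1 / r * x) \<le> \<Omega> powr (1 / r * (1 - x\<^sup>2)) * \<Sigma> powr (1 / r * x\<^sup>2)"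
      proof (rule powr_interchange_le)
        have "x\<^sup>2 \<le> x" using x mult_left_mono[of x 1 x] by (simp add: power2_eq_square)
        then show "1 / r * (1 - x) \<le> 1 / r * (1 - x\<^sup>2)" using r by (intro mult_left_mono) auto
        show "1 / r * (1 - x) + 1 / r * x = 1 / r * (1 - x\<^sup>2) + 1 / r * x\<^sup>2"
          unfolding distrib_left[symmetric] by simp
      qed (use False pos1 in auto)
      then show ?thesis
        using r \<alpha> by (simp add: K_real_def k_def \<Sigma>_def[symmetric] \<Omega>_def[symmetric] x_def[symmetric] mult.commute add_increasing)
    qed
    finally show "op_norm p r \<alpha> f \<le> C * A * K_real p p r \<alpha>"
      using C A0 by (simp add: mult_left_mono)
  qed
qed

lemma finite_bound_generic:
  fixes p q r \<alpha> \<eta> :: real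
  assumes p: "1 < p" "p \<le> q" and r: "0 < r" "r \<le> p" "r < q" and \<eta>: "0 < \<eta>"
    and \<alpha>: "0 < \<alpha>" "\<alpha> \<le> 1" "p < q \<or> \<alpha> = 1"
  shows "\<exists>C>0. \<forall>(S :: (real ^ 'n) set set) \<omega> \<sigma> A f. finite_sparse \<eta> S \<omega> \<sigma> \<longrightarrow> S \<noteq> {} \<longrightarrow>
     (\<forall>Q\<in>S. finite_sparse.char \<omega> \<sigma> p q \<alpha> Q \<le> A) \<longrightarrow>
     f \<in> borel_measurable lebesgue \<longrightarrow> (\<forall>x. 0 \<le> f x) \<longrightarrow> integrable (wm \<sigma>) (\<lambda>x. f x powr p) \<longrightarrow>
     (\<integral>x. f x powr p \<partial>wm \<sigma>) \<le> 1 \<longrightarrow>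
     finite_sparse.op_norm S \<omega> \<sigma> q r \<alpha> f \<le> C * A * finite_sparse.K_real \<omega> \<sigma> p q r \<alpha>"
proof -
  define x where "x = r / p"
  define y where "y = r / q"
  have xy: "0 < y" "y \<le> x" "x \<le> 1" "y < 1" "0 < x" using p r by (auto simp: x_def y_def frac_le)
  \<comment> \<open>The first two bounds keep the exponents of the weights positive after the trade.
    For \<open>p < q\<close> the third lets the gap \<open>x - y\<close> pay for the loss
    \<open>\<epsilon> * (1 - \<alpha>)\<close>; otherwise \<open>\<alpha> = 1\<close>, there is no
    loss, and the \<open>1\<close> is neutral since \<open>x / 2 < 1\<close>.\<close>
  define \<epsilon> where "\<epsilon> = min (min (x / 2) ((1 - y) / 2)) (if p < q then x - y else 1)"
  have P: "1 < conj_exp p" using p by (simp add: conj_exp_def)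
  have "y < x" if "p < q" unfolding x_def y_def using that p r by (intro divide_strict_left_mono) auto
  then have \<epsilon>0: "0 < \<epsilon>" using xy by (auto simp: \<epsilon>_def)
  have "\<epsilon> / conj_exp p \<le> \<epsilon> / 1" "\<epsilon> / q \<le> \<epsilon> / 1" using \<epsilon>0 P p by (intro divide_left_mono; simp)+
  moreover have "\<epsilon> \<le> min (x / 2) ((1 - y) / 2)" unfolding \<epsilon>_def by (rule min.cobounded1)
  then have "\<epsilon> \<le> x / 2" "\<epsilon> \<le> (1 - y) / 2" unfolding min.bounded_iff by blast+
  ultimately have \<epsilon>12: "\<epsilon> / conj_exp p < x" "\<epsilon> / q < 1 - y" using xy by auto
  \<comment> \<open>Since \<open>1 / conj_exp p + 1 / q \<le> 1\<close>, the exponents add up to at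
    least \<open>1 + (x - y) - \<epsilon> * (1 - \<alpha>)\<close>.\<close>
  have \<epsilon>3: "1 \<le> (x - \<epsilon> / conj_exp p) + (1 - y - \<epsilon> / q) + \<alpha> * \<epsilon>"
  proof -
    have "\<epsilon> / conj_exp p = \<epsilon> - \<epsilon> / p" using p by (simp add: conj_exp_def field_simps)
    moreover have "\<epsilon> / q \<le> \<epsilon> / p" using p \<epsilon>0 by (intro divide_left_mono) auto
    moreover have "\<epsilon> - \<alpha> * \<epsilon> \<le> x - y"
    proof (cases "p < q")
      case True
      then have "\<epsilon> \<le> x - y" by (simp add: \<epsilon>_def)
      moreover have "0 \<le> \<alpha> * \<epsilon>" using \<alpha> \<epsilon>0 by simp
      ultimately show ?thesis by linarith
    next
      case False
      then show ?thesis using \<alpha> xy by simp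
    qed
    ultimately show ?thesis by linarith
  qed
  define N where "N = 2 * (2 * conj_exp p) powr p"
  define M where "M = 2 * (2 * conj_exp (1 / (1 - y))) powr (1 / (1 - y))"
  define D where "D = 2 powr \<epsilon> * (2 * (1 / \<eta>) * (x - \<epsilon> / conj_exp p + (1 - y - \<epsilon> / q) + \<alpha> * \<epsilon>) / (\<alpha> * \<epsilon>))"
  \<comment> \<open>A common bound for the powers of \<open>1 / \<eta>\<close> in the two Carleson
    constants, so that the sum of the A-infinity powers can be factored out.\<close>
  define H where "H = \<eta> powr (- y) + \<eta> powr (- (1 - x))"
  define C0 where "C0 = 2 powr r / (1 - 2 powr (- r)) * D * N powr x * M powr (1 - y) * H"
  define C where "C = C0 powr (1 / r) * 2 powr (1 / r)"
  have N: "0 < N" using p by (simp add: N_def conj_exp_def)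
  have "1 < 1 / (1 - y)" using xy by simp
  then have "0 < conj_exp (1 / (1 - y))" unfolding conj_exp_def using xy by (intro divide_pos_pos) auto
  then have M: "0 < M" by (simp add: M_def)
  have D: "0 < D" unfolding D_def using \<epsilon>0 \<epsilon>3 \<alpha> \<eta> by (intro mult_pos_pos divide_pos_pos) auto
  have H: "0 < H" using \<eta> by (simp add: H_def add_pos_pos)
  have C0: "0 < C0"
    unfolding C0_def using N M D H r by (intro mult_pos_pos divide_pos_pos) (auto simp: powr_less_one)
  show ?thesis
  proof (intro exI[of _ C] conjI allI impI)
    show C: "0 < C" using C0 by (simp add: C_def)
    fix S :: "(real ^ 'n) set set" and \<omega> \<sigma> A f
    assume "finite_sparse \<eta> S \<omega> \<sigma>"
    then interpret finite_sparse \<eta> S \<omega> \<sigma> .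
    assume S: "S \<noteq> {}" and A: "\<forall>Q\<in>S. char p q \<alpha> Q \<le> A"
      and f: "f \<in> borel_measurable lebesgue" "\<forall>x. 0 \<le> f x" "integrable (wm \<sigma>) (\<lambda>x. f x powr p)"
        "(\<integral>x. f x powr p \<partial>wm \<sigma>) \<le> 1"
    have A0: "0 < A" using S A char_pos by (meson ex_in_conv less_le_trans)
    define \<Sigma> where "\<Sigma> = enn2real (Ainf_const \<sigma>)"
    define \<Omega> where "\<Omega> = enn2real (Ainf_const \<omega>)"
    have pos1: "0 < \<Sigma>" "0 < \<Omega>" using Ainf_const_eq[OF S] by (auto simp: \<Sigma>_def \<Omega>_def)
    define k where "k = (\<Sigma> powr y + \<Omega> powr (1 - x)) powr (1 / r)"
    have "op_norm q r \<alpha> f \<le> C0 powr (1 / r) * A * k"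
    proof (rule op_norm_le_of_form)
      fix g :: "real ^ 'n \<Rightarrow> real"
      assume g: "g \<in> borel_measurable lebesgue" "\<And>x. 0 \<le> g x" "integrable (wm \<omega>) (\<lambda>x. g x powr (1 / (1 - r / q)))"
      let ?I = "\<integral>x. g x powr (1 / (1 - r / q)) \<partial>wm \<omega>"
      have I: "0 \<le> ?I" by simp
      have "(t / \<eta>) powr e = t powr e * \<eta> powr (- e)" if "0 < t" for t e
        using that \<eta> by (simp add: powr_divide powr_minus_divide)
      from this[OF pos1(1)] this[OF pos1(2)]
      have "\<Gamma>\<sigma> powr y = \<Sigma> powr y * \<eta> powr (- y)" "\<Gamma>\<omega> powr (1 - x) = \<Omega> powr (1 - x) * \<eta> powr (- (1 - x))"
        by (simp_all only: \<Gamma>\<sigma>_def \<Gamma>\<omega>_def \<Sigma>_def \<Omega>_def)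
      moreover have "0 \<le> \<Sigma> powr y * \<eta> powr (- (1 - x))" "0 \<le> \<Omega> powr (1 - x) * \<eta> powr (- y)" by auto
      ultimately have \<Gamma>: "\<Gamma>\<sigma> powr y + \<Gamma>\<omega> powr (1 - x) \<le> H * (\<Sigma> powr y + \<Omega> powr (1 - x))"
        unfolding H_def by (simp add: algebra_simps)
      have "(\<Sum>Q\<in>S. coeff r \<alpha> f Q * (\<integral>x. g x * indicator Q x \<partial>wm \<omega>))
        \<le> 2 powr r / (1 - 2 powr (- r)) * D * A powr r *
           ((\<Gamma>\<sigma> powr y + \<Gamma>\<omega> powr (1 - x)) * N powr x * (M * ?I) powr (1 - y))"
        unfolding N_def M_def x_def y_def
        by (rule level_form_bound[OF p r S \<epsilon>0 \<epsilon>12[unfolded x_def y_def] \<epsilon>3[unfolded x_def y_def] \<alpha>(1)])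
          (use A f g in \<open>auto simp: D_def x_def y_def\<close>)
      also have "\<dots> \<le> 2 powr r / (1 - 2 powr (- r)) * D * A powr r *
           (H * (\<Sigma> powr y + \<Omega> powr (1 - x)) * N powr x * (M * ?I) powr (1 - y))"
      proof (intro mult_left_mono mult_right_mono \<Gamma>)
        have "2 powr (- r) < 1" using r by (simp add: powr_less_one)
        then show "0 \<le> 2 powr r / (1 - 2 powr (- r)) * D * A powr r" using D by simp
      qed auto
      also have "(M * ?I) powr (1 - y) = M powr (1 - y) * ?I powr (1 - y)"
        using M I by (simp add: powr_mult)
      also have "2 powr r / (1 - 2 powr (- r)) * D * A powr r *
           (H * (\<Sigma> powr y + \<Omega> powr (1 - x)) * N powr x * (M powr (1 - y) * ?I powr (1 - y)))
          = C0 * A powr r * (\<Sigma> powr y + \<Omega> powr (1 - x)) * ?I powr (1 - y)"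
        by (simp add: C0_def)
      also have "C0 * A powr r * (\<Sigma> powr y + \<Omega> powr (1 - x)) = (C0 powr (1 / r) * A * k) powr r"
        using C0 A0 r by (simp add: k_def powr_mult powr_powr)
      finally show "(\<Sum>Q\<in>S. coeff r \<alpha> f Q * (\<integral>x. g x * indicator Q x \<partial>wm \<omega>))
         \<le> (C0 powr (1 / r) * A * k) powr r * ?I powr (1 - r / q)"
        by (simp add: y_def)
    qed (use r A0 in \<open>auto simp: k_def\<close>)
    \<comment> \<open>The \<open>r\<close>-th root is distributed over the sum at the price of
      \<open>2 powr (1 / r)\<close>; the exponents become \<open>y / r = 1 / q\<close> and
      \<open>(1 - x) / r = 1 / r - 1 / p\<close>, the latter nonnegative as
      \<open>r \<le> p\<close>.\<close>
    also have "k \<le> 2 powr (1 / r) * (\<Sigma> powr (y * (1 / r)) + \<Omega> powr ((1 - x) * (1 / r)))"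
      unfolding k_def powr_powr[symmetric] using r by (intro powr_add_le) auto
    also have "y * (1 / r) = 1 / q" using r by (simp add: y_def)
    also have "(1 - x) * (1 / r) = max (1 / r - 1 / p) 0"
    proof -
      have "1 / p \<le> 1 / r" using r by (intro divide_left_mono) auto
      then show ?thesis using r by (simp add: x_def field_simps max_def)
    qed
    also have "\<Sigma> powr (1 / q) + \<Omega> powr max (1 / r - 1 / p) 0 = K_real p q r \<alpha>"
      using \<alpha> by (auto simp: K_real_def \<Sigma>_def \<Omega>_def)
    finally have "op_norm q r \<alpha> f \<le> C0 powr (1 / r) * A * (2 powr (1 / r) * K_real p q r \<alpha>)"
      using A0 by (simp add: mult_left_mono)
    then show "op_norm q r \<alpha> f \<le> C * A * K_real p q r \<alpha>"
      by (simp add: C_def mult_ac)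
  qed
qed

subsection \<open>Extended powers\<close>

lemma ennreal_epowr: "0 \<le> t \<Longrightarrow> 0 < a \<Longrightarrow> ennreal t epowr a = ennreal (t powr a)"
  by (auto simp: epowr_def)

lemma ennreal_epowr_pos: "0 < t \<Longrightarrow> ennreal t epowr a = ennreal (t powr a)"
  by (auto simp: epowr_def)

lemma top_epowr: "0 < a \<Longrightarrow> top epowr a = top"
  by (simp add: epowr_def)

lemma epowr_one [simp]: "x epowr 1 = x"
  by (cases x) (auto simp: ennreal_epowr top_epowr)

lemma epowr_mono:
  assumes "0 < a" "x \<le> y"
  shows "x epowr a \<le> y epowr a"
proof (cases "y = top")
  case True
  then show ?thesis using assms by (simp add: top_epowr)
next
  case False
  then obtain t u where "x = ennreal t" "y = ennreal u" "0 \<le> t" "0 \<le> u"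
    using assms(2) by (metis ennreal_cases neq_top_trans)
  then show ?thesis using assms by (auto simp: ennreal_epowr intro!: ennreal_leI powr_mono2)
qed

lemma epowr_epowr: "0 < a \<Longrightarrow> 0 < b \<Longrightarrow> (x epowr a) epowr b = x epowr (a * b)"
  by (cases x) (auto simp: ennreal_epowr top_epowr powr_powr)

text \<open>The powers with exponents \<open>a\<close> and \<open>1 / a\<close> are adjoint on
  \<open>[0, \<infinity>]\<close>. This yields compatibility with arbitrary suprema by pure order
  theory, and lets bounds on a norm and on its power be exchanged.\<close>

lemma epowr_le_iff:
  assumes "0 < a"
  shows "x epowr a \<le> y \<longleftrightarrow> x \<le> y epowr (1 / a)"
proof
  assume "x epowr a \<le> y"
  then have "(x epowr a) epowr (1 / a) \<le> y epowr (1 / a)" using assms by (intro epowr_mono) auto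
  then show "x \<le> y epowr (1 / a)" using assms by (simp add: epowr_epowr)
next
  assume "x \<le> y epowr (1 / a)"
  then have "x epowr a \<le> (y epowr (1 / a)) epowr a" using assms by (intro epowr_mono) auto
  then show "x epowr a \<le> y" using assms by (simp add: epowr_epowr)
qed

lemma SUP_epowr:
  assumes "0 < a"
  shows "(SUP i\<in>I. X i) epowr a = (SUP i\<in>I. X i epowr a)"
proof (rule antisym)
  have "X i \<le> (SUP i\<in>I. X i epowr a) epowr (1 / a)" if "i \<in> I" for i
    using that by (intro epowr_le_iff[OF assms, THEN iffD1] SUP_upper)
  then show "(SUP i\<in>I. X i) epowr a \<le> (SUP i\<in>I. X i epowr a)"
    by (intro epowr_le_iff[OF assms, THEN iffD2] SUP_least)
  show "(SUP i\<in>I. X i epowr a) \<le> (SUP i\<in>I. X i) epowr a"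
    using assms by (auto intro!: SUP_least epowr_mono SUP_upper)
qed

subsection \<open>The sparse operator over a finite family\<close>

context finite_sparse
begin

text \<open>Finiteness of the family and integrability of \<open>f\<close> on its members make all
  quantities finite, so the extended-valued operator reduces to a real power of a step
  function.\<close>

lemma sparse_op_eq:
  assumes r: "0 < r" and f: "f \<in> borel_measurable lebesgue" "\<And>x. 0 \<le> f x"
    "\<And>Q. Q \<in> S \<Longrightarrow> integrable (wm \<sigma>) (\<lambda>x. f x * indicator Q x)"
  shows "sparse_op r \<alpha> S (\<lambda>x. f x * \<sigma> x) x = ennreal ((\<Sum>Q\<in>S. coeff r \<alpha> f Q * indicator Q x) powr (1 / r))"
proof -
  have "(ennreal (vol Q powr (- \<alpha>)) * (\<integral>\<^sup>+y\<in>Q. ennreal (f y * \<sigma> y) \<partial>lebesgue)) epowr r = ennreal (coeff r \<alpha> f Q)"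
    if Q: "Q \<in> S" for Q
  proof -
    have "(\<integral>\<^sup>+y\<in>Q. ennreal (f y * \<sigma> y) \<partial>lebesgue) = (\<integral>\<^sup>+y. ennreal (f y * indicator Q y) * ennreal (\<sigma> y) \<partial>lebesgue)"
      using f(2) weights(2) by (intro nn_integral_cong) (auto simp: indicator_def weight_def ennreal_mult)
    also have "\<dots> = (\<integral>\<^sup>+y. ennreal (f y * indicator Q y) \<partial>wm \<sigma>)"
      using weights(2) f(1) sets_S[OF Q] by (subst nn_integral_wm) auto
    also have "\<dots> = ennreal (\<integral>y. f y * indicator Q y \<partial>wm \<sigma>)"
      using f(2) f(3)[OF Q] by (intro nn_integral_eq_integral) auto
    finally show ?thesis
      using f(2) r by (simp add: coeff_def ennreal_epowr flip: ennreal_mult)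
  qed
  then have "sparse_op r \<alpha> S (\<lambda>x. f x * \<sigma> x) x = (\<Sum>Q\<in>S. ennreal (coeff r \<alpha> f Q) * indicator Q x) epowr (1 / r)"
    using finite_S by (simp add: sparse_op_def)
  also have "(\<Sum>Q\<in>S. ennreal (coeff r \<alpha> f Q) * indicator Q x) = (\<Sum>Q\<in>S. ennreal (coeff r \<alpha> f Q * indicator Q x))"
    by (intro sum.cong) (auto simp: indicator_def)
  also have "\<dots> = ennreal (\<Sum>Q\<in>S. coeff r \<alpha> f Q * indicator Q x)"
    by (rule sum_ennreal) (simp add: coeff_def)
  also have "\<dots> epowr (1 / r) = ennreal ((\<Sum>Q\<in>S. coeff r \<alpha> f Q * indicator Q x) powr (1 / r))"
    using r by (intro ennreal_epowr sum_nonneg) (auto simp: coeff_def)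
  finally show ?thesis .
qed

lemma integrable_op:
  assumes "0 < r" "0 < q"
  shows "integrable (wm \<omega>) (\<lambda>x. (\<Sum>Q\<in>S. coeff r \<alpha> f Q * indicator Q x) powr (q / r))"
proof -
  have eq: "(\<Sum>Q\<in>S. coeff r \<alpha> f Q * indicator Q x) = sum (coeff r \<alpha> f) {R\<in>S. x \<in> R}" for x
    using finite_S by (simp add: sum.If_cases indicator_def Int_def cong: sum.cong)
  show ?thesis unfolding eq
    by (rule sum_measure_increment) (use finite_S nested_S sets_S emeasure_fin in auto)
qed

lemma wnorm_sparse_op_eq:
  assumes r: "0 < r" "0 < q" and f: "f \<in> borel_measurable lebesgue" "\<And>x. 0 \<le> f x"
    "\<And>Q. Q \<in> S \<Longrightarrow> integrable (wm \<sigma>) (\<lambda>x. f x * indicator Q x)"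
  shows "wnorm q \<omega> (sparse_op r \<alpha> S (\<lambda>x. f x * \<sigma> x)) = ennreal (op_norm q r \<alpha> f)"
proof -
  let ?\<phi> = "\<lambda>x. (\<Sum>Q\<in>S. coeff r \<alpha> f Q * indicator Q x)"
  have "sparse_op r \<alpha> S (\<lambda>x. f x * \<sigma> x) x epowr q = ennreal (?\<phi> x powr (q / r))" for x
    using r f by (simp add: sparse_op_eq ennreal_epowr powr_powr)
  then have "(\<integral>\<^sup>+x. (sparse_op r \<alpha> S (\<lambda>x. f x * \<sigma> x) x epowr q) * ennreal (\<omega> x) \<partial>lebesgue)
     = (\<integral>\<^sup>+x. ennreal (?\<phi> x powr (q / r)) \<partial>wm \<omega>)"
    using borel_measurable_integrable[OF integrable_op[OF r]] weights(1)
    by (subst nn_integral_wm) auto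
  also have "\<dots> = ennreal (\<integral>x. ?\<phi> x powr (q / r) \<partial>wm \<omega>)"
    using integrable_op[OF r] by (intro nn_integral_eq_integral) auto
  finally show ?thesis
    using r by (simp add: wnorm_def op_norm_def ennreal_epowr)
qed

text \<open>Monotonicity of sequence norms in the exponent: \<open>coeff r\<close> is the power
  \<open>r / p \<ge> 1\<close> of \<open>coeff p\<close>, and such powers of nonnegative numbers sum
  to at most the power of the sum.\<close>

lemma op_norm_mono:
  assumes "0 < p" "p \<le> r" "0 < q"
  shows "op_norm q r \<alpha> f \<le> op_norm q p \<alpha> f"
proof -
  have r: "0 < r" using assms by simp
  have c0: "0 \<le> coeff t \<alpha> f Q" for t Q by (simp add: coeff_def)
  have "(\<Sum>Q\<in>S. coeff r \<alpha> f Q * indicator Q x) powr (q / r) \<le> (\<Sum>Q\<in>S. coeff p \<alpha> f Q * indicator Q x) powr (q / p)" for x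
  proof -
    have "(\<Sum>Q\<in>S. coeff r \<alpha> f Q * indicator Q x) = (\<Sum>Q\<in>S. (coeff p \<alpha> f Q * indicator Q x) powr (r / p))"
      using assms r by (intro sum.cong) (auto simp: indicator_def coeff_def powr_powr)
    also have "\<dots> \<le> (\<Sum>Q\<in>S. coeff p \<alpha> f Q * indicator Q x) powr (r / p)"
      using assms c0 finite_S by (intro sum_powr_le_powr_sum) auto
    finally have "(\<Sum>Q\<in>S. coeff r \<alpha> f Q * indicator Q x) powr (q / r) \<le> ((\<Sum>Q\<in>S. coeff p \<alpha> f Q * indicator Q x) powr (r / p)) powr (q / r)"
      using assms r c0 by (intro powr_mono2 sum_nonneg) auto
    then show ?thesis using assms r by (simp add: powr_powr)
  qed
  then have "(\<integral>x. (\<Sum>Q\<in>S. coeff r \<alpha> f Q * indicator Q x) powr (q / r) \<partial>wm \<omega>)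
      \<le> (\<integral>x. (\<Sum>Q\<in>S. coeff p \<alpha> f Q * indicator Q x) powr (q / p) \<partial>wm \<omega>)"
    using assms r by (intro integral_mono integrable_op) auto
  then show ?thesis
    unfolding op_norm_def using assms by (intro powr_mono2 integral_nonneg) auto
qed

lemma char_eq:
  assumes "Q \<in> S"
  shows "ennreal (vol Q powr (- \<alpha>)) * (wmeas \<omega> Q epowr (1 / q)) * (wmeas \<sigma> Q epowr (1 / conj_exp p))
     = ennreal (char p q \<alpha> Q)"
  using pos[OF assms] by (simp add: wmeas_eq[OF assms] ennreal_epowr_pos char_def ennreal_mult)

lemma K_const_eq:
  assumes "S \<noteq> {}"
  shows "K_const p q r \<alpha> \<omega> \<sigma> = ennreal (K_real p q r \<alpha>)"
proof -
  have "0 < enn2real (Ainf_const \<sigma>)" "0 < enn2real (Ainf_const \<omega>)"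
    using Ainf_const_eq[OF assms] by auto
  then have "Ainf_const \<sigma> epowr a = ennreal (enn2real (Ainf_const \<sigma>) powr a)"
    "Ainf_const \<omega> epowr a = ennreal (enn2real (Ainf_const \<omega>) powr a)" for a
    using Ainf_const_eq(1,3)[OF assms] ennreal_epowr_pos by metis+
  then show ?thesis by (simp add: K_const_def K_real_def ennreal_mult)
qed

end

lemma finite_bound:
  fixes p q r \<alpha> \<eta> :: real
  assumes p: "1 < p" "p \<le> q" and r: "0 < r" and \<eta>: "0 < \<eta>" and \<alpha>: "0 < \<alpha>" "\<alpha> \<le> 1"
  shows "\<exists>C>0. \<forall>(S :: (real ^ 'n) set set) \<omega> \<sigma> A f. finite_sparse \<eta> S \<omega> \<sigma> \<longrightarrow> S \<noteq> {} \<longrightarrow>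
     (\<forall>Q\<in>S. finite_sparse.char \<omega> \<sigma> p q \<alpha> Q \<le> A) \<longrightarrow>
     f \<in> borel_measurable lebesgue \<longrightarrow> (\<forall>x. 0 \<le> f x) \<longrightarrow> integrable (wm \<sigma>) (\<lambda>x. f x powr p) \<longrightarrow>
     (\<integral>x. f x powr p \<partial>wm \<sigma>) \<le> 1 \<longrightarrow>
     finite_sparse.op_norm S \<omega> \<sigma> q r \<alpha> f \<le> C * A * finite_sparse.K_real \<omega> \<sigma> p q r \<alpha>"
    (is "?P r")
proof -
  have small: "?P r" if r: "0 < r" "r \<le> p" for r
  \<comment> \<open>The generic bound requires \<open>r < q\<close>, so the endpoint
    \<open>p = q = r\<close> is kept out of it and treated apart for every \<alpha>.\<close>
  proof (cases "p < q \<or> r < p \<and> \<alpha> = 1")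
    case True
    then show ?thesis using finite_bound_generic[OF p r _ \<eta> \<alpha>] p r by auto
  next
    case False
    then have [simp]: "q = p" using p by simp
    show ?thesis
    proof (cases "r = p")
      case True
      then show ?thesis using finite_bound_diagonal_end[OF p(1) \<eta>, of \<alpha>] by simp
    next
      case False
      with \<open>\<not> (p < q \<or> r < p \<and> \<alpha> = 1)\<close> show ?thesis
        using finite_bound_diagonal[OF p(1) r(1) _ \<eta>, of \<alpha>] r \<alpha> by simp
    qed
  qed
  show ?thesis
  proof (cases "r \<le> p")
    case True
    then show ?thesis using small r by blast
  next
    case False
    have "0 < p" using p by simp
    from small[OF this order_refl] obtain C where C: "0 < C"
      "\<And>S :: (real ^ 'n) set set. \<And>\<omega> \<sigma> A f. finite_sparse \<eta> S \<omega> \<sigma> \<Longrightarrow> S \<noteq> {} \<Longrightarrow>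
     (\<forall>Q\<in>S. finite_sparse.char \<omega> \<sigma> p q \<alpha> Q \<le> A) \<Longrightarrow>
     f \<in> borel_measurable lebesgue \<Longrightarrow> (\<forall>x. 0 \<le> f x) \<Longrightarrow> integrable (wm \<sigma>) (\<lambda>x. f x powr p) \<Longrightarrow>
     (\<integral>x. f x powr p \<partial>wm \<sigma>) \<le> 1 \<Longrightarrow>
     finite_sparse.op_norm S \<omega> \<sigma> q p \<alpha> f \<le> C * A * finite_sparse.K_real \<omega> \<sigma> p q p \<alpha>"
      by metis
    show ?thesis
    proof (intro exI[of _ C] conjI allI impI)
      fix S :: "(real ^ 'n) set set" and \<omega> \<sigma> A f
      assume fs: "finite_sparse \<eta> S \<omega> \<sigma>"
      then interpret finite_sparse \<eta> S \<omega> \<sigma> .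
      assume *: "S \<noteq> {}" "\<forall>Q\<in>S. char p q \<alpha> Q \<le> A"
        "f \<in> borel_measurable lebesgue" "\<forall>x. 0 \<le> f x" "integrable (wm \<sigma>) (\<lambda>x. f x powr p)"
        "(\<integral>x. f x powr p \<partial>wm \<sigma>) \<le> 1"
      have "op_norm q r \<alpha> f \<le> op_norm q p \<alpha> f"
        using False p by (intro op_norm_mono) auto
      also have "\<dots> \<le> C * A * K_real p q p \<alpha>" using C(2)[OF fs *] .
      \<comment> \<open>For \<open>r \<ge> p\<close> the exceptional formula is not selected and the
        exponent of the constant of \<omega> is \<open>0\<close>, so \<open>K\<close> does not
        change when \<open>r\<close> is lowered to \<open>p\<close>.\<close>
      also have "K_real p q p \<alpha> = K_real p q r \<alpha>"
      proof -
        have "1 / r \<le> 1 / p" using False p by (intro divide_left_mono) auto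
        then show ?thesis using False p by (auto simp: K_real_def)
      qed
      finally show "op_norm q r \<alpha> f \<le> C * A * K_real p q r \<alpha>" .
    qed (rule C(1))
  qed
qed

subsection \<open>Passage to infinite families\<close>

lemma finite_sparse_of_grid:
  assumes D: "is_dyadic_grid \<D>" "S \<subseteq> \<D>" and sp: "sparse_collection \<eta> S" and F: "finite F" "F \<subseteq> S"
    and w: "Ainf_weight \<omega>" "Ainf_weight \<sigma>"
  shows "finite_sparse \<eta> F \<omega> \<sigma>"
proof
  have FD: "F \<subseteq> \<D>" using F D by blast
  then show "nested F" using dyadic_grid_nested[OF D(1)] unfolding nested_def by blast
  show "sparse_collection \<eta> F"
    using sp F unfolding sparse_collection_def disjoint_family_on_def by (meson subsetD)
  show "is_cube Q" "bounded Q" "Q \<in> sets lebesgue" "0 < vol Q" if "Q \<in> F" for Q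
    using dyadic_grid_cube[OF D(1), of Q] FD that by auto
  show "{} \<notin> F" using dyadic_grid_cube(2)[OF D(1)] FD by blast
qed (use F w in auto)

lemma sparse_op_mono:
  assumes "0 < r" "S \<subseteq> S'"
  shows "sparse_op r \<alpha> S f x \<le> sparse_op r \<alpha> S' f x"
  unfolding sparse_op_def using assms
  by (intro epowr_mono infsum_mono_neutral nonneg_summable_on_complete) auto

lemma wnorm_mono:
  assumes "0 < q" "\<And>x. g x \<le> h x"
  shows "wnorm q \<omega> g \<le> wnorm q \<omega> h"
  unfolding wnorm_def using assms
  by (intro epowr_mono nn_integral_mono mult_right_mono) auto

lemma infsum_ennreal_exhaustion:
  fixes T :: "'b \<Rightarrow> ennreal"
  assumes "\<And>n. finite (I n)" "incseq I" "(\<Union>n. I n) = S"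
  shows "infsum T S = (SUP n. sum T (I n))"
proof (rule antisym)
  have "sum T F \<le> (SUP n. sum T (I n))" if F: "finite F" "F \<subseteq> S" for F
  proof -
    have "\<exists>n. F \<subseteq> I n" using F
    proof (induction F)
      case (insert a F)
      then obtain n m where "F \<subseteq> I n" "a \<in> I m" using assms(3) by blast
      then have "insert a F \<subseteq> I (max n m)"
        using assms(2) by (metis insert_subset max.cobounded1 max.cobounded2 monoD order_trans subsetD)
      then show ?case by blast
    qed simp
    then obtain n where "F \<subseteq> I n" by blast
    then have "sum T F \<le> sum T (I n)" using assms(1) by (intro sum_mono2) auto
    then show ?thesis by (rule order_trans) (rule SUP_upper, simp)
  qed
  then show "infsum T S \<le> (SUP n. sum T (I n))"
    unfolding nonneg_infsum_complete[of S T, simplified] by (intro SUP_least) auto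
  show "(SUP n. sum T (I n)) \<le> infsum T S"
    unfolding nonneg_infsum_complete[of S T, simplified] using assms
    by (intro SUP_least SUP_upper) auto
qed

text \<open>Since the grid is countable, \<open>S\<close> is exhausted by an increasing sequence of
  finite families. Monotone convergence is used twice along it, for the sum defining the operator
  and for the integral defining the norm; powers commute with suprema, so the two limits fit
  together.\<close>

lemma wnorm_sparse_op_le:
  assumes D: "is_dyadic_grid \<D>" "S \<subseteq> \<D>" "S \<noteq> {}" and sp: "sparse_collection \<eta> S"
    and w: "Ainf_weight \<omega>" "Ainf_weight \<sigma>" and q: "0 < q" "0 < r"
    and f: "f \<in> borel_measurable lebesgue" "\<And>x. 0 \<le> f x"
      "\<And>Q. Q \<in> S \<Longrightarrow> integrable (wm \<sigma>) (\<lambda>x. f x * indicator Q x)"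
    and B: "\<And>F. finite F \<Longrightarrow> F \<subseteq> S \<Longrightarrow> F \<noteq> {} \<Longrightarrow> wnorm q \<omega> (sparse_op r \<alpha> F (\<lambda>x. f x * \<sigma> x)) \<le> B"
  shows "wnorm q \<omega> (sparse_op r \<alpha> S (\<lambda>x. f x * \<sigma> x)) \<le> B"
proof -
  have "countable S" using dyadic_grid_countable[OF D(1)] D(2) countable_subset by blast
  define I where "I n = from_nat_into S ` {..n}" for n :: nat
  have I: "finite (I n)" "I n \<noteq> {}" "I n \<subseteq> S" for n
    using from_nat_into[OF D(3)] by (auto simp: I_def)
  have inc: "incseq I" by (auto simp: I_def incseq_def)
  have un: "(\<Union>n. I n) = S"
  proof -
    have "(\<Union>n. I n) = range (from_nat_into S)" by (auto simp: I_def)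
    then show ?thesis using range_from_nat_into[OF D(3) \<open>countable S\<close>] by simp
  qed
  let ?op = "\<lambda>F. sparse_op r \<alpha> F (\<lambda>x. f x * \<sigma> x)"
  have meas: "(\<lambda>x. (?op (I n) x epowr q) * ennreal (\<omega> x)) \<in> borel_measurable lebesgue" for n
  proof -
    interpret finite_sparse \<eta> "I n" \<omega> \<sigma>
      using finite_sparse_of_grid[OF D(1,2) sp I(1,3) w] .
    have eq: "?op (I n) x = ennreal ((\<Sum>Q\<in>I n. coeff r \<alpha> f Q * indicator Q x) powr (1 / r))" for x
      using q f I by (intro sparse_op_eq) blast+
    have "(\<lambda>x. (\<Sum>Q\<in>I n. coeff r \<alpha> f Q * indicator Q x) powr (q / r)) \<in> borel_measurable lebesgue"
      using borel_measurable_integrable[OF integrable_op[OF q(2,1)]] by simp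
    then show ?thesis
      using q weight_measurable[OF weights(1)] by (simp add: eq ennreal_epowr powr_powr)
  qed
  have "(?op S x epowr q) * ennreal (\<omega> x) = (SUP n. (?op (I n) x epowr q) * ennreal (\<omega> x))" for x
  proof -
    have "?op S x = (SUP n. ?op (I n) x)"
      unfolding sparse_op_def infsum_ennreal_exhaustion[OF I(1) inc un]
      using q I by (subst SUP_epowr) auto
    then show ?thesis using q by (simp add: SUP_epowr SUP_mult_right_ennreal)
  qed
  then have "(\<integral>\<^sup>+x. (?op S x epowr q) * ennreal (\<omega> x) \<partial>lebesgue)
     = (SUP n. \<integral>\<^sup>+x. (?op (I n) x epowr q) * ennreal (\<omega> x) \<partial>lebesgue)"
    using meas q inc
    by (simp, intro nn_integral_monotone_convergence_SUP)
      (auto simp: incseq_def le_fun_def intro!: mult_right_mono epowr_mono sparse_op_mono)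
  also have "\<dots> \<le> B epowr q"
  proof (rule SUP_least)
    fix n
    have "wnorm q \<omega> (?op (I n)) \<le> B" using I by (intro B)
    then show "(\<integral>\<^sup>+x. (?op (I n) x epowr q) * ennreal (\<omega> x) \<partial>lebesgue) \<le> B epowr q"
      unfolding wnorm_def using q by (subst (asm) epowr_le_iff) auto
  qed
  finally show ?thesis unfolding wnorm_def using q by (subst epowr_le_iff) auto
qed

text \<open>For one cube the operator applied to the test function is an explicit multiple of an
  indicator, and discarding the other cubes only lowers the norm. The constant is \<open>1\<close>
  because the test function has norm exactly \<open>1\<close> and the single-cube norm is exactly
  the term of the characteristic at \<open>Q\<close>.\<close>

lemma Apq_char_le_sparse_op_norm:
  assumes D: "is_dyadic_grid \<D>" "S \<subseteq> \<D>" and sp: "sparse_collection \<eta> S"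
    and w: "Ainf_weight \<omega>" "Ainf_weight \<sigma>" and p: "1 < p" and q: "0 < q" and r: "0 < r"
  shows "Apq_char p q \<alpha> S \<omega> \<sigma> \<le> sparse_op_norm r \<alpha> S p q \<sigma> \<omega>"
  unfolding Apq_char_def
proof (rule SUP_least)
  fix Q assume Q: "Q \<in> S"
  interpret finite_sparse \<eta> "{Q}" \<omega> \<sigma>
    by (rule finite_sparse_of_grid[OF D sp]) (use Q w in auto)
  have Q1: "Q \<in> {Q}" by simp
  define c where "c = s Q powr (- 1 / p)"
  define f :: "real ^ 'a \<Rightarrow> real" where "f x = c * indicator Q x" for x
  have c: "0 < c" using pos[OF Q1] by (simp add: c_def)
  have f: "f \<in> borel_measurable lebesgue" "\<And>x. 0 \<le> f x"
    using sets_S[OF Q1] c unfolding f_def by auto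
  have ff: "f x * indicator Q x = c * indicator Q x" for x by (simp add: f_def indicator_def)
  have int: "integrable (wm \<sigma>) (\<lambda>x. f x * indicator Q x)"
    unfolding ff using emeasure_fin[OF Q1] sets_S[OF Q1] by (intro integrable_mult_right integrable_real_indicator) auto
  have "wnorm p \<sigma> (\<lambda>x. ennreal (f x)) = 1"
  proof -
    have "(\<integral>\<^sup>+x. (ennreal (f x) epowr p) * ennreal (\<sigma> x) \<partial>lebesgue) = (\<integral>\<^sup>+x. ennreal (c powr p) * indicator Q x * ennreal (\<sigma> x) \<partial>lebesgue)"
      using p c by (intro nn_integral_cong) (auto simp: f_def indicator_def ennreal_epowr)
    also have "\<dots> = (\<integral>\<^sup>+x. ennreal (c powr p) * indicator Q x \<partial>wm \<sigma>)"
      using weights(2) sets_S[OF Q1] by (subst nn_integral_wm) auto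
    also have "\<dots> = ennreal (c powr p) * emeasure (wm \<sigma>) Q"
      using sets_S[OF Q1] by (intro nn_integral_cmult_indicator) simp
    also have "\<dots> = ennreal (c powr p * s Q)"
      using wmeas_eq[OF Q1] emeasure_wm[OF weights(2) sets_S[OF Q1]] by (simp add: ennreal_mult)
    also have "c powr p * s Q = 1"
      unfolding c_def powr_powr using pos[OF Q1] p by (simp add: powr_minus_divide)
    finally show ?thesis using p by (simp add: wnorm_def ennreal_epowr_pos flip: ennreal_1)
  qed
  then have "wnorm q \<omega> (sparse_op r \<alpha> S (\<lambda>x. f x * \<sigma> x)) \<le> sparse_op_norm r \<alpha> S p q \<sigma> \<omega>"
    unfolding sparse_op_norm_def using f by (intro SUP_upper) auto
  moreover have "wnorm q \<omega> (sparse_op r \<alpha> {Q} (\<lambda>x. f x * \<sigma> x)) \<le> wnorm q \<omega> (sparse_op r \<alpha> S (\<lambda>x. f x * \<sigma> x))"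
    using q r Q by (intro wnorm_mono sparse_op_mono) auto
  moreover have "wnorm q \<omega> (sparse_op r \<alpha> {Q} (\<lambda>x. f x * \<sigma> x)) = ennreal (op_norm q r \<alpha> f)"
    using r q f int by (intro wnorm_sparse_op_eq) auto
  moreover have "op_norm q r \<alpha> f = char p q \<alpha> Q"
  proof -
    define t where "t = vol Q powr (- \<alpha>) * (c * s Q)"
    have t: "0 < t" using vol_pos[OF Q1] pos[OF Q1] c by (simp add: t_def)
    have "coeff r \<alpha> f Q = t powr r"
      using sets_S[OF Q1] by (simp add: coeff_def ff t_def)
    then have "(\<integral>x. (\<Sum>Q\<in>{Q}. coeff r \<alpha> f Q * indicator Q x) powr (q / r) \<partial>wm \<omega>) = (\<integral>x. t powr q * indicator Q x \<partial>wm \<omega>)"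
      using r t by (intro Bochner_Integration.integral_cong) (auto simp: indicator_def powr_powr)
    also have "\<dots> = t powr q * w Q"
      using sets_S[OF Q1] by simp
    finally have "op_norm q r \<alpha> f = t * w Q powr (1 / q)"
      using t q pos[OF Q1] by (simp add: op_norm_def powr_mult powr_powr)
    moreover have "c * s Q = s Q powr (1 / conj_exp p)"
    proof -
      have "c * s Q = s Q powr (- 1 / p + 1)"
        unfolding c_def powr_add using pos[OF Q1] by simp
      also have "- 1 / p + 1 = 1 / conj_exp p" using p by (simp add: conj_exp_def field_simps)
      finally show ?thesis .
    qed
    ultimately show ?thesis by (simp add: t_def char_def)
  qed
  ultimately show "ennreal (vol Q powr (- \<alpha>)) * (wmeas \<omega> Q epowr (1 / q)) * (wmeas \<sigma> Q epowr (1 / conj_exp p))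
      \<le> sparse_op_norm r \<alpha> S p q \<sigma> \<omega>"
    unfolding char_eq[OF Q1] by simp
qed

section \<open>Assembling the two bounds\<close>

lemma integrable_of_wnorm:
  assumes \<sigma>: "weight \<sigma>" and p: "0 < p" and f: "f \<in> borel_measurable lebesgue" "\<And>x. 0 \<le> f x"
    and n: "wnorm p \<sigma> (\<lambda>x. ennreal (f x)) \<le> 1"
  shows "integrable (wm \<sigma>) (\<lambda>x. f x powr p)" "(\<integral>x. f x powr p \<partial>wm \<sigma>) \<le> 1"
proof -
  have "(\<integral>\<^sup>+x. ennreal (f x powr p) \<partial>wm \<sigma>) = (\<integral>\<^sup>+x. (ennreal (f x) epowr p) * ennreal (\<sigma> x) \<partial>lebesgue)"
    using f p \<sigma> by (subst nn_integral_wm) (auto simp: ennreal_epowr)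
  also have "\<dots> \<le> 1 epowr p"
    using n p unfolding wnorm_def by (subst (asm) epowr_le_iff) auto
  also have "1 epowr p = 1" using p ennreal_epowr_pos[of 1 p] by simp
  finally have le: "(\<integral>\<^sup>+x. ennreal (f x powr p) \<partial>wm \<sigma>) \<le> 1" .
  show int: "integrable (wm \<sigma>) (\<lambda>x. f x powr p)"
    using f le by (intro integrableI_bounded) (auto simp: le_less_trans)
  have "ennreal (\<integral>x. f x powr p \<partial>wm \<sigma>) \<le> ennreal 1"
    using le int by (subst nn_integral_eq_integral[symmetric]) auto
  then show "(\<integral>x. f x powr p \<partial>wm \<sigma>) \<le> 1" by (subst (asm) ennreal_le_iff) auto
qed

theorem theorem1p1:
  fixes p q r \<alpha> \<eta> :: real
  assumes "1 < p" and "p \<le> q" and "0 < r" and "0 < \<alpha>" and "\<alpha> \<le> 1" and "0 < \<eta>"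
  shows "\<exists>C::real. C > 0 \<and>
    (\<forall>(\<D> :: (real ^ 'n) set set) \<S> \<omega> \<sigma>.
       is_dyadic_grid \<D> \<longrightarrow> \<S> \<subseteq> \<D> \<longrightarrow> \<S> \<noteq> {} \<longrightarrow> sparse_collection \<eta> \<S> \<longrightarrow>
       Ainf_weight \<omega> \<longrightarrow> Ainf_weight \<sigma> \<longrightarrow>
         (sparse_op_norm r \<alpha> \<S> p q \<sigma> \<omega> < \<infinity> \<longleftrightarrow> Apq_char p q \<alpha> \<S> \<omega> \<sigma> < \<infinity>) \<and>
         (Apq_char p q \<alpha> \<S> \<omega> \<sigma> < \<infinity> \<longrightarrow>
            Apq_char p q \<alpha> \<S> \<omega> \<sigma> \<le> sparse_op_norm r \<alpha> \<S> p q \<sigma> \<omega> \<and>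
            sparse_op_norm r \<alpha> \<S> p q \<sigma> \<omega>
              \<le> ennreal C * Apq_char p q \<alpha> \<S> \<omega> \<sigma> * K_const p q r \<alpha> \<omega> \<sigma>))"
proof -
  obtain C where C: "0 < C"
    "\<And>S :: (real ^ 'n) set set. \<And>\<omega> \<sigma> A f. finite_sparse \<eta> S \<omega> \<sigma> \<Longrightarrow> S \<noteq> {} \<Longrightarrow>
     (\<forall>Q\<in>S. finite_sparse.char \<omega> \<sigma> p q \<alpha> Q \<le> A) \<Longrightarrow>
     f \<in> borel_measurable lebesgue \<Longrightarrow> (\<forall>x. 0 \<le> f x) \<Longrightarrow> integrable (wm \<sigma>) (\<lambda>x. f x powr p) \<Longrightarrow>
     (\<integral>x. f x powr p \<partial>wm \<sigma>) \<le> 1 \<Longrightarrow>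
     finite_sparse.op_norm S \<omega> \<sigma> q r \<alpha> f \<le> C * A * finite_sparse.K_real \<omega> \<sigma> p q r \<alpha>"
    using finite_bound[OF assms(1-3,6,4,5)] by metis
  have q: "0 < q" using assms by simp
  have upper: "sparse_op_norm r \<alpha> S p q \<sigma> \<omega> \<le> ennreal C * Apq_char p q \<alpha> S \<omega> \<sigma> * K_const p q r \<alpha> \<omega> \<sigma>"
      "K_const p q r \<alpha> \<omega> \<sigma> < \<infinity>"
    if D: "is_dyadic_grid \<D>" "S \<subseteq> \<D>" "S \<noteq> {}" and sp: "sparse_collection \<eta> S"
      and w: "Ainf_weight \<omega>" "Ainf_weight \<sigma>" and fin: "Apq_char p q \<alpha> S \<omega> \<sigma> < \<infinity>"
    for \<D> S and \<omega> \<sigma> :: "real ^ 'n \<Rightarrow> real"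
  proof -
    have fs: "finite_sparse \<eta> F \<omega> \<sigma>" if "finite F" "F \<subseteq> S" for F
      by (rule finite_sparse_of_grid[OF D(1,2) sp that w])
    \<comment> \<open>Facts about the weights alone are read off from one singleton family; this is
      where \<open>S \<noteq> {}\<close> enters.\<close>
    obtain Q0 where Q0: "Q0 \<in> S" using D by blast
    interpret Q0: finite_sparse \<eta> "{Q0}" \<omega> \<sigma> using Q0 by (intro fs) auto
    have K: "K_const p q r \<alpha> \<omega> \<sigma> = ennreal (finite_sparse.K_real \<omega> \<sigma> p q r \<alpha>)"
      by (rule Q0.K_const_eq) simp
    then show "K_const p q r \<alpha> \<omega> \<sigma> < \<infinity>" by simp
    define A where "A = enn2real (Apq_char p q \<alpha> S \<omega> \<sigma>)"
    have A: "Apq_char p q \<alpha> S \<omega> \<sigma> = ennreal A" "0 \<le> A" using fin by (auto simp: A_def)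
    show "sparse_op_norm r \<alpha> S p q \<sigma> \<omega> \<le> ennreal C * Apq_char p q \<alpha> S \<omega> \<sigma> * K_const p q r \<alpha> \<omega> \<sigma>"
      unfolding sparse_op_norm_def
    proof (rule SUP_least, clarify)
      fix f :: "real ^ 'n \<Rightarrow> real"
      assume f: "f \<in> borel_measurable lebesgue" "\<forall>x. 0 \<le> f x" "wnorm p \<sigma> (\<lambda>x. ennreal (f x)) \<le> 1"
      have fp: "integrable (wm \<sigma>) (\<lambda>x. f x powr p)" "(\<integral>x. f x powr p \<partial>wm \<sigma>) \<le> 1"
        using integrable_of_wnorm[OF Q0.weights(2) _ f(1) _ f(3)] f(2) assms(1) by auto
      have int: "integrable (wm \<sigma>) (\<lambda>x. f x * indicator Q x)" if Q: "Q \<in> S" for Q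
      proof -
        interpret Q: finite_sparse \<eta> "{Q}" \<omega> \<sigma> using Q by (intro fs) auto
        show ?thesis
          using f fp assms(1) Q.sets_S[of Q] Q.emeasure_fin[of Q]
          by (intro integrable_powr_imp_integrable_on) auto
      qed
      show "wnorm q \<omega> (sparse_op r \<alpha> S (\<lambda>x. f x * \<sigma> x)) \<le> ennreal C * Apq_char p q \<alpha> S \<omega> \<sigma> * K_const p q r \<alpha> \<omega> \<sigma>"
      proof (rule wnorm_sparse_op_le[OF D sp w q assms(3) f(1)])
        fix F assume F: "finite F" "F \<subseteq> S" "F \<noteq> {}"
        interpret F: finite_sparse \<eta> F \<omega> \<sigma> using F by (intro fs)
        have "F.char p q \<alpha> Q \<le> A" if "Q \<in> F" for Q
        proof -
          have "ennreal (F.char p q \<alpha> Q) \<le> ennreal A"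
            unfolding F.char_eq[OF that, symmetric] A(1)[symmetric] Apq_char_def
            using that F by (intro SUP_upper) auto
          then show ?thesis using A(2) by simp
        qed
        then have "F.op_norm q r \<alpha> f \<le> C * A * F.K_real p q r \<alpha>"
          using C(2)[OF F.finite_sparse_axioms F(3) _ f(1,2) fp] by blast
        moreover have "wnorm q \<omega> (sparse_op r \<alpha> F (\<lambda>x. f x * \<sigma> x)) = ennreal (F.op_norm q r \<alpha> f)"
          using assms(3) q f int F by (intro F.wnorm_sparse_op_eq) auto
        ultimately show "wnorm q \<omega> (sparse_op r \<alpha> F (\<lambda>x. f x * \<sigma> x))
            \<le> ennreal C * Apq_char p q \<alpha> S \<omega> \<sigma> * K_const p q r \<alpha> \<omega> \<sigma>"
          using C(1) A F.K_real_nonneg by (simp add: K ennreal_leI flip: ennreal_mult)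
      qed (use f int in auto)
    qed
  qed
  show ?thesis
  proof (intro exI[of _ C] conjI allI impI C(1))
    fix \<D> :: "(real ^ 'n) set set" and S and \<omega> \<sigma> :: "real ^ 'n \<Rightarrow> real"
    assume D: "is_dyadic_grid \<D>" "S \<subseteq> \<D>" "S \<noteq> {}" and sp: "sparse_collection \<eta> S"
      and w: "Ainf_weight \<omega>" "Ainf_weight \<sigma>"
    show lower: "Apq_char p q \<alpha> S \<omega> \<sigma> \<le> sparse_op_norm r \<alpha> S p q \<sigma> \<omega>"
      using Apq_char_le_sparse_op_norm[OF D(1,2) sp w assms(1) q assms(3)] .
    show "sparse_op_norm r \<alpha> S p q \<sigma> \<omega> \<le> ennreal C * Apq_char p q \<alpha> S \<omega> \<sigma> * K_const p q r \<alpha> \<omega> \<sigma>"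
      if "Apq_char p q \<alpha> S \<omega> \<sigma> < \<infinity>"
      using upper(1)[OF D sp w that] .
    show "sparse_op_norm r \<alpha> S p q \<sigma> \<omega> < \<infinity> \<longleftrightarrow> Apq_char p q \<alpha> S \<omega> \<sigma> < \<infinity>"
    proof
      assume fin: "Apq_char p q \<alpha> S \<omega> \<sigma> < \<infinity>"
      \<comment> \<open>Finiteness of \<open>K_const\<close>, which comes from the finite A-infinity
        constants, turns the quantitative bound into boundedness.\<close>
      have "ennreal C * Apq_char p q \<alpha> S \<omega> \<sigma> * K_const p q r \<alpha> \<omega> \<sigma> < \<infinity>"
        using fin upper(2)[OF D sp w fin] by (simp add: ennreal_mult_less_top)
      with upper(1)[OF D sp w fin] show "sparse_op_norm r \<alpha> S p q \<sigma> \<omega> < \<infinity>" by (rule le_less_trans)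
    qed (use lower in \<open>auto intro: le_less_trans\<close>)
  qed
qed

end
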